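(* Let $(\gamma,v_1,v_2):I\to H^3\times\Delta_5$ be a hyperbolic framed curve with $a^2+b^2\neq0$, $A^2>M^2$ and $MA'-M'A\equiv0$ on $I$, and let $p_0=(t_0,\theta_0)$ be a singular point of the hyperbolic focal surface $\mathcal{F}^h$. (a) If $N(t_0)\neq0$: (1) $p_0$ is a cuspidal edge iff $M(t_0)\neq0$; (2) $p_0$ is never a swallowtail or a cuspidal cross cap. (b) If $N(t_0)=0$: (1) $p_0$ is a cuspidal edge iff $\theta_0\neq0$ and $(AN\sqrt{A^2-M^2})'(t_0)\neq0$; (2) $p_0$ is never a cuspidal beaks, cuspidal lips, swallowtail or cuspidal cross cap.
   Context: $\mathbb{R}^4_1$ denotes $\mathbb{R}^4$ with $\langle x,y\rangle=-x_0y_0+x_1y_1+x_2y_2+x_3y_3$; $H^3=\{x:\langle x,x\rangle=-1\}$, $S^3_1=\{x:\langle x,x\rangle=1\}$. For $x^1,x^2,x^3\in\mathbb{R}^4_1$, $x^1\wedge x^2\wedge x^3$ is the vector given by the formal determinant with first row $(-e_0,e_1,e_2,e_3)$ and the components of $x^1,x^2,x^3$ as remaining rows. Let $\Delta_5=\{(v_1,v_2)\in S^3_1\times S^3_1:\langle v_1,v_2\rangle=0\}$. A hyperbolic framed curve is a smooth map $(\gamma,v_1,v_2):I\to H^3\times\Delta_5$ with $\langle\gamma,v_i\rangle=\langle\gamma',v_i\rangle=0$. Put $\mu=\gamma\wedge v_1\wedge v_2$; then $\gamma'=m\mu$, $v_1'=nv_2+a\mu$, $v_2'=-nv_1+b\mu$,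 $\mu'=m\gamma-av_1-bv_2$ with $m=\langle\gamma',\mu\rangle$, $n=\langle v_1',v_2\rangle$, $a=\langle v_1',\mu\rangle$, $b=\langle v_2',\mu\rangle$. Put $f=ab'-a'b+n(a^2+b^2)$. With $a^2+b^2\neq0$, the Frenet type frame is $n_1=(av_1+bv_2)/\sqrt{a^2+b^2}$, $n_2=(-bv_1+av_2)/\sqrt{a^2+b^2}$, giving $\gamma'=M\mu$, $n_1'=Nn_2+A\mu$, $n_2'=-Nn_1$, $\mu'=M\gamma-An_1$ with $M=m$, $N=f/(a^2+b^2)$, $A=\sqrt{a^2+b^2}$. Hyperbolic focal surface: $\mathcal{F}^h(t,\theta)=\frac{\cosh\theta}{\sqrt{A^2-M^2}}(A\gamma-Mn_1)+\sinh\theta\,n_2$, $(t,\theta)\in I\times\mathbb{R}$, with singular set $\{\lambda^h=0\}$, $\lambda^h=\frac{\cosh\theta(MA'-AM')-\sinh\theta\,AN\sqrt{A^2-M^2}}{A^2-M^2}$ (so under $MA'-M'A\equiv0$ the points $(t,0)$ are singular). Singularity types up to $\mathcal{A}$-equivalence: cuspidal edge $(u,v)\mapsto(u,v^2,v^3)$; swallowtail $(u,v)\mapsto(u,4v^3+2uv,3v^4+uv^2)$; cuspidal beaks $(u,v)\mapsto(u,2v^3-u^2v,3v^4-u^2v^2)$; cuspidal lips $(u,v)\mapsto(u,2v^3+u^2v,3v^4+u^2v^2)$; cuspidal cross cap $(u,v)\mapsto(u,v^2,uv^3)$. *)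

theory Defs
  imports "HOL-Analysis.Analysis"
begin

text \<open>Vectors of R^4_1 are elements of real^4; the paper's coordinates
x_0, x_1, x_2, x_3 are stored as x$1, x$2, x$3, x$4 (x$1 is the timelike one).\<close>

definition lor :: "real^4 \<Rightarrow> real^4 \<Rightarrow> real" where
  "lor x y = - x$1 * y$1 + x$2 * y$2 + x$3 * y$3 + x$4 * y$4"

definition det3 :: "real \<Rightarrow> real \<Rightarrow> real \<Rightarrow> real \<Rightarrow> real \<Rightarrow> real \<Rightarrow> real \<Rightarrow> real \<Rightarrow> real \<Rightarrow> real" where
  "det3 a1 a2 a3 b1 b2 b3 c1 c2 c3 =
     a1 * (b2 * c3 - b3 * c2) - a2 * (b1 * c3 - b3 * c1) + a3 * (b1 * c2 - b2 * c1)"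

text \<open>Formal determinant with first row (-e0, e1, e2, e3), expanded along the first row.\<close>
definition wedge3 :: "real^4 \<Rightarrow> real^4 \<Rightarrow> real^4 \<Rightarrow> real^4" where
  "wedge3 x y z = vector
     [ - det3 (x$2) (x$3) (x$4) (y$2) (y$3) (y$4) (z$2) (z$3) (z$4),
       - det3 (x$1) (x$3) (x$4) (y$1) (y$3) (y$4) (z$1) (z$3) (z$4),
         det3 (x$1) (x$2) (x$4) (y$1) (y$2) (y$4) (z$1) (z$2) (z$4),
       - det3 (x$1) (x$2) (x$3) (y$1) (y$2) (y$3) (z$1) (z$2) (z$3) ]"

fun Ck :: "nat \<Rightarrow> 'a::real_normed_vector set \<Rightarrow> ('a \<Rightarrow> 'b::real_normed_vector) \<Rightarrow> bool" where
  "Ck 0 S f = continuous_on S f"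
| "Ck (Suc k) S f = (f differentiable_on S \<and> (\<forall>v. Ck k S (\<lambda>x. frechet_derivative f (at x) v)))"

definition smooth_on :: "'a::real_normed_vector set \<Rightarrow> ('a \<Rightarrow> 'b::real_normed_vector) \<Rightarrow> bool" where
  "smooth_on S f \<longleftrightarrow> (\<forall>k. Ck k S f)"

definition diffeo_on :: "'a::real_normed_vector set \<Rightarrow> 'b::real_normed_vector set \<Rightarrow> ('a \<Rightarrow> 'b) \<Rightarrow> bool" where
  "diffeo_on V U \<phi> \<longleftrightarrow> open V \<and> open U \<and> \<phi> ` V = U \<and> inj_on \<phi> V \<and>
     smooth_on V \<phi> \<and> smooth_on U (inv_into V \<phi>)"

definition A_equiv_at :: "('a::real_normed_vector \<Rightarrow> 'b::real_normed_vector) \<Rightarrow> 'a \<Rightarrow>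
    ('c::real_normed_vector \<Rightarrow> 'd::real_normed_vector) \<Rightarrow> 'c \<Rightarrow> bool" where
  "A_equiv_at g p f q \<longleftrightarrow>
     (\<exists>V U \<phi> W W' \<psi>. q \<in> V \<and> diffeo_on V U \<phi> \<and> \<phi> q = p \<and>
        g p \<in> W \<and> diffeo_on W W' \<psi> \<and> \<psi> (g p) = f q \<and>
        (\<forall>x\<in>V. g (\<phi> x) \<in> W \<and> \<psi> (g (\<phi> x)) = f x))"

text \<open>Chart of H^3 (a local diffeomorphism from each sheet onto R^3): drop the time coordinate.\<close>
definition chartH :: "real^4 \<Rightarrow> real \<times> real \<times> real" where
  "chartH x = (x$2, x$3, x$4)"

definition cuspidal_edge :: "real \<times> real \<Rightarrow> real \<times> real \<times> real" where
  "cuspidal_edge = (\<lambda>(u, v). (u, v^2, v^3))"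
definition swallowtail :: "real \<times> real \<Rightarrow> real \<times> real \<times> real" where
  "swallowtail = (\<lambda>(u, v). (u, 4 * v^3 + 2 * u * v, 3 * v^4 + u * v^2))"
definition cuspidal_beaks :: "real \<times> real \<Rightarrow> real \<times> real \<times> real" where
  "cuspidal_beaks = (\<lambda>(u, v). (u, 2 * v^3 - u^2 * v, 3 * v^4 - u^2 * v^2))"
definition cuspidal_lips :: "real \<times> real \<Rightarrow> real \<times> real \<times> real" where
  "cuspidal_lips = (\<lambda>(u, v). (u, 2 * v^3 + u^2 * v, 3 * v^4 + u^2 * v^2))"
definition cuspidal_cross_cap :: "real \<times> real \<Rightarrow> real \<times> real \<times> real" where
  "cuspidal_cross_cap = (\<lambda>(u, v). (u, v^2, u * v^3))"

definition surf_germ_is :: "(real \<times> real \<Rightarrow> real^4) \<Rightarrow> real \<times> real \<Rightarrow> (real \<times> real \<Rightarrow> real \<times> real \<times> real) \<Rightarrow> bool" where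
  "surf_germ_is F p f \<longleftrightarrow> A_equiv_at (chartH \<circ> F) p f (0, 0)"

definition singular_point :: "(real \<times> real \<Rightarrow> real^4) \<Rightarrow> real \<times> real \<Rightarrow> bool" where
  "singular_point F p \<longleftrightarrow> \<not> inj (frechet_derivative F (at p))"

definition hyp_framed_curve :: "real set \<Rightarrow> (real \<Rightarrow> real^4) \<Rightarrow> (real \<Rightarrow> real^4) \<Rightarrow> (real \<Rightarrow> real^4) \<Rightarrow> bool" where
  "hyp_framed_curve I \<gamma> v1 v2 \<longleftrightarrow> open I \<and> is_interval I \<and>
     smooth_on I \<gamma> \<and> smooth_on I v1 \<and> smooth_on I v2 \<and>
     (\<forall>t\<in>I. lor (\<gamma> t) (\<gamma> t) = -1 \<and> lor (v1 t) (v1 t) = 1 \<and> lor (v2 t) (v2 t) = 1 \<and>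
        lor (v1 t) (v2 t) = 0 \<and> lor (\<gamma> t) (v1 t) = 0 \<and> lor (\<gamma> t) (v2 t) = 0 \<and>
        lor (vector_derivative \<gamma> (at t)) (v1 t) = 0 \<and>
        lor (vector_derivative \<gamma> (at t)) (v2 t) = 0)"

definition hmu :: "(real \<Rightarrow> real^4) \<Rightarrow> (real \<Rightarrow> real^4) \<Rightarrow> (real \<Rightarrow> real^4) \<Rightarrow> real \<Rightarrow> real^4" where
  "hmu \<gamma> v1 v2 t = wedge3 (\<gamma> t) (v1 t) (v2 t)"

definition hm :: "(real \<Rightarrow> real^4) \<Rightarrow> (real \<Rightarrow> real^4) \<Rightarrow> (real \<Rightarrow> real^4) \<Rightarrow> real \<Rightarrow> real" where
  "hm \<gamma> v1 v2 t = lor (vector_derivative \<gamma> (at t)) (hmu \<gamma> v1 v2 t)"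
definition hn :: "(real \<Rightarrow> real^4) \<Rightarrow> (real \<Rightarrow> real^4) \<Rightarrow> (real \<Rightarrow> real^4) \<Rightarrow> real \<Rightarrow> real" where
  "hn \<gamma> v1 v2 t = lor (vector_derivative v1 (at t)) (v2 t)"
definition ha :: "(real \<Rightarrow> real^4) \<Rightarrow> (real \<Rightarrow> real^4) \<Rightarrow> (real \<Rightarrow> real^4) \<Rightarrow> real \<Rightarrow> real" where
  "ha \<gamma> v1 v2 t = lor (vector_derivative v1 (at t)) (hmu \<gamma> v1 v2 t)"
definition hb :: "(real \<Rightarrow> real^4) \<Rightarrow> (real \<Rightarrow> real^4) \<Rightarrow> (real \<Rightarrow> real^4) \<Rightarrow> real \<Rightarrow> real" where
  "hb \<gamma> v1 v2 t = lor (vector_derivative v2 (at t)) (hmu \<gamma> v1 v2 t)"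

definition hf :: "(real \<Rightarrow> real^4) \<Rightarrow> (real \<Rightarrow> real^4) \<Rightarrow> (real \<Rightarrow> real^4) \<Rightarrow> real \<Rightarrow> real" where
  "hf \<gamma> v1 v2 t = ha \<gamma> v1 v2 t * deriv (hb \<gamma> v1 v2) t - deriv (ha \<gamma> v1 v2) t * hb \<gamma> v1 v2 t
     + hn \<gamma> v1 v2 t * ((ha \<gamma> v1 v2 t)^2 + (hb \<gamma> v1 v2 t)^2)"

definition hM :: "(real \<Rightarrow> real^4) \<Rightarrow> (real \<Rightarrow> real^4) \<Rightarrow> (real \<Rightarrow> real^4) \<Rightarrow> real \<Rightarrow> real" where
  "hM \<gamma> v1 v2 t = hm \<gamma> v1 v2 t"
definition hN :: "(real \<Rightarrow> real^4) \<Rightarrow> (real \<Rightarrow> real^4) \<Rightarrow> (real \<Rightarrow> real^4) \<Rightarrow> real \<Rightarrow> real" where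
  "hN \<gamma> v1 v2 t = hf \<gamma> v1 v2 t / ((ha \<gamma> v1 v2 t)^2 + (hb \<gamma> v1 v2 t)^2)"
definition hA :: "(real \<Rightarrow> real^4) \<Rightarrow> (real \<Rightarrow> real^4) \<Rightarrow> (real \<Rightarrow> real^4) \<Rightarrow> real \<Rightarrow> real" where
  "hA \<gamma> v1 v2 t = sqrt ((ha \<gamma> v1 v2 t)^2 + (hb \<gamma> v1 v2 t)^2)"

definition hn1 :: "(real \<Rightarrow> real^4) \<Rightarrow> (real \<Rightarrow> real^4) \<Rightarrow> (real \<Rightarrow> real^4) \<Rightarrow> real \<Rightarrow> real^4" where
  "hn1 \<gamma> v1 v2 t = (1 / hA \<gamma> v1 v2 t) *\<^sub>R (ha \<gamma> v1 v2 t *\<^sub>R v1 t + hb \<gamma> v1 v2 t *\<^sub>R v2 t)"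
definition hn2 :: "(real \<Rightarrow> real^4) \<Rightarrow> (real \<Rightarrow> real^4) \<Rightarrow> (real \<Rightarrow> real^4) \<Rightarrow> real \<Rightarrow> real^4" where
  "hn2 \<gamma> v1 v2 t = (1 / hA \<gamma> v1 v2 t) *\<^sub>R (- hb \<gamma> v1 v2 t *\<^sub>R v1 t + ha \<gamma> v1 v2 t *\<^sub>R v2 t)"

definition focal_h :: "(real \<Rightarrow> real^4) \<Rightarrow> (real \<Rightarrow> real^4) \<Rightarrow> (real \<Rightarrow> real^4) \<Rightarrow> real \<times> real \<Rightarrow> real^4" where
  "focal_h \<gamma> v1 v2 = (\<lambda>(t, \<theta>).
     (cosh \<theta> / sqrt ((hA \<gamma> v1 v2 t)^2 - (hM \<gamma> v1 v2 t)^2)) *\<^sub>R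
        (hA \<gamma> v1 v2 t *\<^sub>R \<gamma> t - hM \<gamma> v1 v2 t *\<^sub>R hn1 \<gamma> v1 v2 t)
     + sinh \<theta> *\<^sub>R hn2 \<gamma> v1 v2 t)"

end

theory Submission
  imports Defs
begin

text \<open>
  Since \<open>M A' - M' A = 0\<close> on an interval, \<open>M = c A\<close> with a constant \<open>c\<^sup>2 < 1\<close>; put \<open>s = sqrt (1 - c\<^sup>2)\<close>.
  With \<open>e = (\<gamma> - c n\<^sub>1) / s\<close> and \<open>g = (n\<^sub>1 - c \<gamma>) / s\<close> the focal surface is \<open>F = cosh \<theta> e + sinh \<theta> n\<^sub>2\<close>, and
  \<open>F\<^sub>t = - c \<nu> F\<^sub>\<theta> - \<nu> sinh \<theta> g\<close> for \<open>\<nu> = N / s\<close>. So the kernel field is \<open>\<partial>\<^sub>t + c \<nu> \<partial>\<^sub>\<theta>\<close>, its image is a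
  multiple \<open>l = - \<nu> sinh \<theta>\<close> of \<open>g\<close>, and the singular set is \<open>N sinh \<theta> = 0\<close>.

  If \<open>l\<close> has a nonzero derivative along a kernel field transversal to the singular set, then in coordinates
  \<open>(u, v)\<close> with singular set \<open>v = 0\<close> and kernel \<open>\<partial>\<^sub>v\<close> one has, by Whitney's theorem on even functions,
  \<open>F(u, v) = F(u, 0) + v\<^sup>2 E(u, v\<^sup>2) + v\<^sup>3 H(u, v\<^sup>2)\<close>, and \<open>(X, Y, Z) \<mapsto> F(X, 0) + Y E(X, Y) + Z H(X, Y)\<close> is
  a local diffeomorphism carrying the cuspidal edge to \<open>F\<close>. Whitney's theorem is proved by Seeley's
  extension of \<open>f(u, \<surd>w)\<close> to \<open>w < 0\<close>.

  The other normal forms are excluded by invariants. The swallowtail and the cuspidal cross cap are not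
  injective near the origin, whereas the cuspidal edge is. If \<open>l\<close> vanishes to second order, the differential is
  degenerate to higher order than for the cuspidal edge, the swallowtail and the cuspidal cross cap. If
  \<open>M = 0\<close> and \<open>N \<noteq> 0\<close>, a curve is collapsed to a point. If \<open>N = 0\<close>, the line \<open>t = t0\<close> is singular, whereas
  the origin is an isolated singular point of the lips; and the two crossing singular lines of the beaks are
  transversal to the kernel, which is not so for \<open>\<theta> = 0\<close>, and they force \<open>N\<close> to vanish near \<open>t0\<close> if \<open>\<theta> \<noteq> 0\<close> at the point.
\<close>

section \<open>Smooth maps\<close>

text \<open>The obstacle to the positive statements is that \<open>E\<close> and \<open>H\<close>
  are wanted at \<open>v ^ 2\<close>. Smoothness for w >= 0 is not enough, since the target map has
  to be a diffeomorphism of a full neighbourhood of the image point. Seeley's series sends w < 0 to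
  the points - 2^k w, which run off to infinity, so all derivatives must be bounded on the whole
  plane. This is the purpose of wrapping the coordinates in \<open>\<delta> * sin\<close>: a doubly
  periodic smooth map has bounded derivatives of every order, and near the origin the wrapping is
  itself a change of coordinates. The weights come from the coefficients c_k of Euler's product: the
  moments of c_k / (2^k + 1) against the powers of - 2^k do not depend on the power, and dividing by
  their common nonzero value makes them 1. Germs are compared through \<open>chartH\<close>, which
  forgets the timelike coordinate, while all computations use \<open>lor\<close>. The two fit
  together because tangent vectors of the surface are Lorentz orthogonal to the timelike position
  vector, so that their spatial part determines them.\<close>

declare Ck.simps(2) [simp del]

lemma Ck_SucD:
  assumes "Ck (Suc k) S f" "open S"
  shows "\<And>x. x \<in> S \<Longrightarrow> (f has_derivative frechet_derivative f (at x)) (at x)"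
    and "Ck k S (\<lambda>x. frechet_derivative f (at x) v)"
proof -
  show "(f has_derivative frechet_derivative f (at x)) (at x)" if "x \<in> S" for x
    using assms that
    by (metis (no_types) Ck.simps(2) differentiable_on_eq_differentiable_at frechet_derivative_works)
  show "Ck k S (\<lambda>x. frechet_derivative f (at x) v)"
    using assms(1) by (simp add: Ck.simps(2))
qed

lemma Ck_cong:
  assumes "open S" "\<And>x. x \<in> S \<Longrightarrow> f x = g x" "Ck k S f"
  shows "Ck k S g"
  using assms(2,3)
proof (induction k arbitrary: f g)
  case 0
  then show ?case by (metis Ck.simps(1) continuous_on_eq)
next
  case (Suc k)
  have *: "(g has_derivative frechet_derivative f (at x)) (at x)" if "x \<in> S" for x
    using Ck_SucD(1)[OF Suc.prems(2) \<open>open S\<close> that] Suc.prems(1) that \<open>open S\<close>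
    by (metis has_derivative_transform_within_open)
  have "Ck k S (\<lambda>x. frechet_derivative g (at x) v)" for v
  proof (rule Suc.IH)
    show "Ck k S (\<lambda>x. frechet_derivative f (at x) v)"
      by (rule Ck_SucD(2)[OF Suc.prems(2) \<open>open S\<close>])
    show "frechet_derivative f (at x) v = frechet_derivative g (at x) v" if "x \<in> S" for x
      using frechet_derivative_at[OF *[OF that]] by simp
  qed
  moreover have "g differentiable_on S"
    using * by (metis differentiable_def differentiable_at_withinI differentiable_on_def)
  ultimately show ?case by (simp add: Ck.simps(2))
qed

text \<open>By uniqueness of derivatives at interior points, any explicit formula may replace the
  choice made by \<open>frechet_derivative\<close>.\<close>

lemma Ck_SucI:
  assumes S: "open S" and f': "\<And>x. x \<in> S \<Longrightarrow> (f has_derivative f' x) (at x)"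
    and "\<And>v. Ck k S (\<lambda>x. f' x v)"
  shows "Ck (Suc k) S f"
  unfolding Ck.simps(2)
proof (intro conjI allI)
  show "f differentiable_on S"
    using f' by (metis differentiable_def differentiable_at_withinI differentiable_on_def)
  fix v
  show "Ck k S (\<lambda>x. frechet_derivative f (at x) v)"
  proof (rule Ck_cong[OF S _ assms(3)[of v]])
    show "f' x v = frechet_derivative f (at x) v" if "x \<in> S" for x
      using frechet_derivative_at[OF f'[OF that]] by simp
  qed
qed

lemma Ck_Suc_imp: "open S \<Longrightarrow> Ck (Suc k) S f \<Longrightarrow> Ck k S f"
proof (induction k arbitrary: f)
  case 0
  then show ?case
    by (simp add: Ck.simps(2) differentiable_imp_continuous_on)
next
  case (Suc k)
  then show ?case
    by (metis Ck.simps(2))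
qed

lemma Ck_subset:
  assumes "open T" "T \<subseteq> S" "Ck k S f"
  shows "Ck k T f"
  using assms(3)
proof (induction k arbitrary: f)
  case 0
  then show ?case using assms continuous_on_subset by auto
next
  case (Suc k)
  then show ?case using assms by (auto simp: Ck.simps(2) intro: differentiable_on_subset)
qed

text \<open>The induction on \<open>k\<close> runs over the whole class \<open>P\<close> at once;
  closure of the class under directional derivatives replaces a formula for the k-th
  derivative.\<close>

lemma Ck_family:
  assumes "open S" "P f"
    and step: "\<And>f. P f \<Longrightarrow> \<exists>f'. (\<forall>x\<in>S. (f has_derivative f' x) (at x)) \<and> (\<forall>v. P (\<lambda>x. f' x v))"
  shows "Ck k S f"
  using assms(2)
proof (induction k arbitrary: f)
  case 0
  obtain f' where "\<forall>x\<in>S. (f has_derivative f' x) (at x)" using step[OF 0] by blast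
  then show ?case
    by (auto intro!: continuous_at_imp_continuous_on has_derivative_continuous)
next
  case (Suc k)
  obtain f' where f': "\<forall>x\<in>S. (f has_derivative f' x) (at x)" "\<forall>v. P (\<lambda>x. f' x v)"
    using step[OF Suc.prems] by blast
  show ?case
    by (rule Ck_SucI[OF \<open>open S\<close>, where f' = f']) (use f' Suc.IH \<open>open S\<close> in auto)
qed

lemma Ck_const: "open S \<Longrightarrow> Ck k S (\<lambda>x. c)"
  by (rule Ck_family[where P = "\<lambda>f. \<exists>c. f = (\<lambda>x. c)"])
     (auto intro!: exI[where x="\<lambda>x v. 0"])

lemma Ck_bounded_linear_compose:
  assumes L: "bounded_linear L" and S: "open S" and "Ck k S f"
  shows "Ck k S (\<lambda>x. L (f x))"
  using assms(3)
proof (induction k arbitrary: f)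
  case 0
  then show ?case
    using bounded_linear.continuous_on[OF L] by auto
next
  case (Suc k)
  show ?case
    by (rule Ck_SucI[OF S, where f' = "\<lambda>x v. L (frechet_derivative f (at x) v)"])
       (use Ck_SucD[OF Suc.prems S] Suc.IH S in
         \<open>auto intro!: bounded_linear.has_derivative[OF L]\<close>)
qed

lemma Ck_id: "open S \<Longrightarrow> Ck k S (\<lambda>x. x)"
proof (cases k)
  case (Suc n)
  then show "open S \<Longrightarrow> ?thesis"
    by (auto intro!: Ck_SucI[where f'="\<lambda>x v. v"] Ck_const derivative_eq_intros)
qed auto

lemma Ck_add:
  assumes S: "open S" and "Ck k S f" "Ck k S g"
  shows "Ck k S (\<lambda>x. f x + g x)"
  using assms(2,3)
proof (induction k arbitrary: f g)
  case 0
  then show ?case by (auto intro: continuous_intros)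
next
  case (Suc k)
  show ?case
    by (rule Ck_SucI[OF S, where
          f' = "\<lambda>x v. frechet_derivative f (at x) v + frechet_derivative g (at x) v"])
       (use Ck_SucD[OF Suc.prems(1) S] Ck_SucD[OF Suc.prems(2) S] Suc.IH S in
         \<open>auto intro!: has_derivative_add\<close>)
qed

lemma Ck_bilinear:
  assumes B: "bounded_bilinear B" and S: "open S" and "Ck k S f" "Ck k S g"
  shows "Ck k S (\<lambda>x. B (f x) (g x))"
  using assms(3,4)
proof (induction k arbitrary: f g)
  case 0
  then show ?case by (auto intro: bounded_bilinear.continuous_on[OF B])
next
  case (Suc k)
  show ?case
    by (rule Ck_SucI[OF S, where
          f' = "\<lambda>x v. B (f x) (frechet_derivative g (at x) v) + B (frechet_derivative f (at x) v) (g x)"])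
       (use Ck_SucD[OF Suc.prems(1) S] Ck_SucD[OF Suc.prems(2) S] Suc.IH S
            Ck_Suc_imp[OF S Suc.prems(1)] Ck_Suc_imp[OF S Suc.prems(2)] in
         \<open>auto intro!: bounded_bilinear.FDERIV[OF B] Ck_add\<close>)
qed

lemma Ck_sum:
  assumes S: "open S" and "\<And>i. i \<in> A \<Longrightarrow> Ck k S (f i)"
  shows "Ck k S (\<lambda>x. \<Sum>i\<in>A. f i x)"
  using assms(2)
  by (induction A rule: infinite_finite_induct) (auto intro!: Ck_const Ck_add S)

text \<open>\<open>Ck\<close> controls derivatives in fixed directions, whereas the chain rule
  applies the derivative of \<open>g\<close> to the varying vector \<open>?f x v\<close>. Expanding
  that vector in \<open>Basis\<close> leaves scalar factors and fixed directions, to which the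
  induction hypothesis applies.\<close>

lemma Ck_compose:
  fixes f :: "'a::real_normed_vector \<Rightarrow> 'b::euclidean_space" and g :: "'b \<Rightarrow> 'c::real_normed_vector"
  assumes S: "open S" and T: "open T" and im: "\<And>x. x \<in> S \<Longrightarrow> f x \<in> T"
    and "Ck k S f" "Ck k T g"
  shows "Ck k S (\<lambda>x. g (f x))"
  using assms(4,5)
proof (induction k arbitrary: g)
  case 0
  then show ?case using im by (auto intro: continuous_on_compose2)
next
  case (Suc k)
  let ?g = "\<lambda>x. frechet_derivative g (at x)" and ?f = "\<lambda>x. frechet_derivative f (at x)"
  have fk: "Ck k S f" by (rule Ck_Suc_imp[OF S Suc.prems(1)])
  show ?case
  proof (rule Ck_SucI[OF S, where f' = "\<lambda>x v. \<Sum>i\<in>Basis. (?f x v \<bullet> i) *\<^sub>R ?g (f x) i"])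
    fix x assume x: "x \<in> S"
    have g: "(g has_derivative ?g (f x)) (at (f x))"
      using Ck_SucD(1)[OF Suc.prems(2) T im[OF x]] .
    have "(\<lambda>v. ?g (f x) (?f x v)) = (\<lambda>v. \<Sum>i\<in>Basis. (?f x v \<bullet> i) *\<^sub>R ?g (f x) i)"
    proof
      fix v
      have "?g (f x) (?f x v) = ?g (f x) (\<Sum>i\<in>Basis. (?f x v \<bullet> i) *\<^sub>R i)"
        by (simp add: euclidean_representation)
      also have "\<dots> = (\<Sum>i\<in>Basis. (?f x v \<bullet> i) *\<^sub>R ?g (f x) i)"
        using g by (simp add: linear_sum linear_cmul has_derivative_linear o_def)
      finally show "?g (f x) (?f x v) = \<dots>" .
    qed
    then show "((\<lambda>x. g (f x)) has_derivative (\<lambda>v. \<Sum>i\<in>Basis. (?f x v \<bullet> i) *\<^sub>R ?g (f x) i)) (at x)"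
      using has_derivative_compose[OF Ck_SucD(1)[OF Suc.prems(1) S x] g] by simp
  next
    fix v
    show "Ck k S (\<lambda>x. \<Sum>i\<in>Basis. (?f x v \<bullet> i) *\<^sub>R ?g (f x) i)"
      by (intro Ck_sum S Ck_bilinear[OF bounded_bilinear_scaleR]
            Ck_bounded_linear_compose[OF bounded_linear_inner_left]
            Ck_SucD(2)[OF Suc.prems(1)] Suc.IH[OF fk] Ck_SucD(2)[OF Suc.prems(2) T])
  qed
qed

lemma smooth_onI: "(\<And>k. Ck k S f) \<Longrightarrow> smooth_on S f"
  by (simp add: smooth_on_def)

lemma smooth_onD: "smooth_on S f \<Longrightarrow> Ck k S f"
  by (simp add: smooth_on_def)

lemma smooth_on_cong:
  "open S \<Longrightarrow> (\<And>x. x \<in> S \<Longrightarrow> f x = g x) \<Longrightarrow> smooth_on S f \<Longrightarrow> smooth_on S g"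
  unfolding smooth_on_def using Ck_cong by blast

lemma smooth_on_subset: "open T \<Longrightarrow> T \<subseteq> S \<Longrightarrow> smooth_on S f \<Longrightarrow> smooth_on T f"
  unfolding smooth_on_def using Ck_subset by blast

lemma smooth_on_const: "open S \<Longrightarrow> smooth_on S (\<lambda>x. c)"
  by (simp add: smooth_on_def Ck_const)

lemma smooth_on_id: "open S \<Longrightarrow> smooth_on S (\<lambda>x. x)"
  by (simp add: smooth_on_def Ck_id)

lemma smooth_on_linear_compose:
  "bounded_linear L \<Longrightarrow> open S \<Longrightarrow> smooth_on S f \<Longrightarrow> smooth_on S (\<lambda>x. L (f x))"
  by (simp add: smooth_on_def Ck_bounded_linear_compose)

lemma smooth_on_bilinear:
  "bounded_bilinear B \<Longrightarrow> open S \<Longrightarrow> smooth_on S f \<Longrightarrow> smooth_on S g \<Longrightarrow> smooth_on S (\<lambda>x. B (f x) (g x))"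
  by (simp add: smooth_on_def Ck_bilinear)

lemma smooth_on_add: "open S \<Longrightarrow> smooth_on S f \<Longrightarrow> smooth_on S g \<Longrightarrow> smooth_on S (\<lambda>x. f x + g x)"
  by (simp add: smooth_on_def Ck_add)

lemma smooth_on_minus: "open S \<Longrightarrow> smooth_on S f \<Longrightarrow> smooth_on S (\<lambda>x. - f x)"
  by (rule smooth_on_linear_compose[OF bounded_linear_minus[OF bounded_linear_ident]])

lemma smooth_on_diff: "open S \<Longrightarrow> smooth_on S f \<Longrightarrow> smooth_on S g \<Longrightarrow> smooth_on S (\<lambda>x. f x - g x)"
  unfolding diff_conv_add_uminus by (intro smooth_on_add smooth_on_minus)

lemma smooth_on_mult:
  fixes f g :: "'a::real_normed_vector \<Rightarrow> 'b::real_normed_algebra"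
  shows "open S \<Longrightarrow> smooth_on S f \<Longrightarrow> smooth_on S g \<Longrightarrow> smooth_on S (\<lambda>x. f x * g x)"
  by (rule smooth_on_bilinear[OF bounded_bilinear_mult])

lemma smooth_on_scaleR: "open S \<Longrightarrow> smooth_on S f \<Longrightarrow> smooth_on S g \<Longrightarrow> smooth_on S (\<lambda>x. f x *\<^sub>R g x)"
  by (rule smooth_on_bilinear[OF bounded_bilinear_scaleR])

lemma smooth_on_power:
  fixes f :: "'a::real_normed_vector \<Rightarrow> 'b::real_normed_algebra_1"
  shows "open S \<Longrightarrow> smooth_on S f \<Longrightarrow> smooth_on S (\<lambda>x. f x ^ n)"
  by (induction n) (auto intro!: smooth_on_const smooth_on_mult)

lemma smooth_on_sum:
  "open S \<Longrightarrow> (\<And>i. i \<in> A \<Longrightarrow> smooth_on S (f i)) \<Longrightarrow> smooth_on S (\<lambda>x. \<Sum>i\<in>A. f i x)"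
  by (simp add: smooth_on_def Ck_sum)

lemma smooth_on_compose:
  fixes f :: "'a::real_normed_vector \<Rightarrow> 'b::euclidean_space" and g :: "'b \<Rightarrow> 'c::real_normed_vector"
  assumes "open S" "open T" "\<And>x. x \<in> S \<Longrightarrow> f x \<in> T" "smooth_on S f" "smooth_on T g"
  shows "smooth_on S (\<lambda>x. g (f x))"
  using assms Ck_compose[of S T f] unfolding smooth_on_def by blast

lemma smooth_on_fst: "open S \<Longrightarrow> smooth_on S f \<Longrightarrow> smooth_on S (\<lambda>x. fst (f x))"
  by (rule smooth_on_linear_compose[OF bounded_linear_fst])

lemma smooth_on_snd: "open S \<Longrightarrow> smooth_on S f \<Longrightarrow> smooth_on S (\<lambda>x. snd (f x))"
  by (rule smooth_on_linear_compose[OF bounded_linear_snd])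

lemma smooth_on_Pair:
  fixes f :: "'a::real_normed_vector \<Rightarrow> 'b::real_normed_vector" and g :: "'a \<Rightarrow> 'c::real_normed_vector"
  assumes "open S" "smooth_on S f" "smooth_on S g"
  shows "smooth_on S (\<lambda>x. (f x, g x))"
proof -
  have "bounded_linear (\<lambda>x::'b. (x, 0::'c))" "bounded_linear (\<lambda>x::'c. (0::'b, x))"
    by (intro bounded_linear_Pair bounded_linear_ident bounded_linear_zero)+
  from smooth_on_add[OF assms(1) smooth_on_linear_compose[OF this(1) assms(1,2)]
      smooth_on_linear_compose[OF this(2) assms(1,3)]]
  show ?thesis by simp
qed

lemma smooth_on_nth: "open S \<Longrightarrow> smooth_on S f \<Longrightarrow> smooth_on S (\<lambda>x. f x $ i)"
  by (rule smooth_on_linear_compose[OF bounded_linear_vec_nth])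

lemma smooth_on_componentwise:
  fixes f :: "'a::real_normed_vector \<Rightarrow> 'b::euclidean_space"
  assumes "open S" "\<And>b. b \<in> Basis \<Longrightarrow> smooth_on S (\<lambda>x. f x \<bullet> b)"
  shows "smooth_on S f"
proof -
  have "smooth_on S (\<lambda>x. \<Sum>b\<in>Basis. (f x \<bullet> b) *\<^sub>R b)"
    by (intro smooth_on_sum smooth_on_scaleR smooth_on_const assms)
  then show ?thesis by (simp add: euclidean_representation)
qed

lemma smooth_on_vec:
  fixes f :: "'a::real_normed_vector \<Rightarrow> real ^ 'n"
  assumes "open S" "\<And>i. smooth_on S (\<lambda>x. f x $ i)"
  shows "smooth_on S f"
proof (rule smooth_on_componentwise[OF assms(1)])
  fix b :: "real ^ 'n" assume "b \<in> Basis"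
  then obtain i where "b = axis i 1"
    unfolding Basis_vec_def by auto
  then show "smooth_on S (\<lambda>x. f x \<bullet> b)"
    using assms(2)[of i] by (simp add: inner_axis)
qed

section \<open>Derivatives of smooth maps\<close>

lemma smooth_on_has_derivative:
  "smooth_on S f \<Longrightarrow> open S \<Longrightarrow> x \<in> S \<Longrightarrow> (f has_derivative frechet_derivative f (at x)) (at x)"
  by (rule Ck_SucD(1)[OF smooth_onD])

lemma smooth_on_frechet:
  "smooth_on S f \<Longrightarrow> open S \<Longrightarrow> smooth_on S (\<lambda>x. frechet_derivative f (at x) v)"
  by (rule smooth_onI, rule Ck_SucD(2)[OF smooth_onD])

lemma smooth_on_continuous_on: "smooth_on S f \<Longrightarrow> continuous_on S f"
  using smooth_onD[of S f 0] by simp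

lemma smooth_onI_derivative:
  assumes "open S" "\<And>x. x \<in> S \<Longrightarrow> (f has_derivative f' x) (at x)" "\<And>v. smooth_on S (\<lambda>x. f' x v)"
  shows "smooth_on S f"
proof (rule smooth_onI)
  fix k show "Ck k S f"
    by (rule Ck_Suc_imp[OF assms(1)], rule Ck_SucI[OF assms(1,2)])
       (auto intro: smooth_onD assms(3))
qed

lemma smooth_on_vector_derivative:
  fixes f :: "real \<Rightarrow> 'b::real_normed_vector"
  assumes "open S" "smooth_on S f"
  shows "\<And>x. x \<in> S \<Longrightarrow> (f has_vector_derivative vector_derivative f (at x)) (at x)"
    and "smooth_on S (\<lambda>x. vector_derivative f (at x))"
proof -
  show *: "(f has_vector_derivative vector_derivative f (at x)) (at x)" if "x \<in> S" for x
    using smooth_on_has_derivative[OF assms(2,1) that]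
    by (meson differentiableI vector_derivative_works)
  show "smooth_on S (\<lambda>x. vector_derivative f (at x))"
    by (rule smooth_on_cong[OF assms(1) _ smooth_on_frechet[OF assms(2,1), of 1]])
       (use * in \<open>metis frechet_derivative_at has_vector_derivative_def scaleR_one\<close>)
qed

lemma smooth_onI_vector_derivative:
  fixes f :: "real \<Rightarrow> 'b::real_normed_vector"
  assumes "open S" "\<And>x. x \<in> S \<Longrightarrow> (f has_vector_derivative f' x) (at x)" "smooth_on S f'"
  shows "smooth_on S f"
  by (rule smooth_onI_derivative[OF assms(1), where f' = "\<lambda>x v. v *\<^sub>R f' x"])
     (use assms in \<open>auto simp: has_vector_derivative_def intro!: smooth_on_scaleR smooth_on_const\<close>)

lemma smooth_on_deriv:
  fixes f :: "real \<Rightarrow> real"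
  assumes "open S" "smooth_on S f"
  shows "\<And>x. x \<in> S \<Longrightarrow> (f has_real_derivative deriv f x) (at x)"
    and "smooth_on S (deriv f)"
proof -
  show *: "(f has_real_derivative deriv f x) (at x)" if "x \<in> S" for x
    using smooth_on_has_derivative[OF assms(2,1) that]
    by (metis DERIV_deriv_iff_real_differentiable differentiableI)
  show "smooth_on S (deriv f)"
    by (rule smooth_on_cong[OF assms(1) _ smooth_on_vector_derivative(2)[OF assms]])
       (use * in \<open>metis has_real_derivative_iff_has_vector_derivative vector_derivative_at\<close>)
qed

section \<open>Smoothness of elementary functions\<close>

lemma Ck_inverse: "Ck k {x::real. x \<noteq> 0} inverse"
proof (rule Ck_family[where P = "\<lambda>f. \<exists>c n. f = (\<lambda>x. c * inverse x ^ n)"])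
  have "{x::real. x \<noteq> 0} = - {0}" by auto
  then show "open {x::real. x \<noteq> 0}" by (metis open_Compl closed_singleton)
  show "\<exists>c n. inverse = (\<lambda>x::real. c * inverse x ^ n)"
    by (rule exI[of _ 1], rule exI[of _ 1]) auto
  fix f :: "real \<Rightarrow> real" assume "\<exists>c n. f = (\<lambda>x. c * inverse x ^ n)"
  then obtain c n where f: "f = (\<lambda>x. c * inverse x ^ n)" by blast
  show "\<exists>f'. (\<forall>x\<in>{x. x \<noteq> 0}. (f has_derivative f' x) (at x)) \<and>
             (\<forall>v. \<exists>c n. (\<lambda>x. f' x v) = (\<lambda>x. c * inverse x ^ n))"
  proof (intro exI[of _ "\<lambda>x v. (- (c * n * v)) * inverse x ^ (n + 1)"] conjI ballI allI)
    fix x :: real assume "x \<in> {x. x \<noteq> 0}"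
    then have "(f has_real_derivative c * (n * (- (inverse x ^ 2) * inverse x ^ (n - 1)))) (at x)"
      unfolding f using DERIV_cmult[OF DERIV_power[OF DERIV_inverse]] by (simp add: numeral_2_eq_2)
    moreover have "(*) (c * (n * (- (inverse x ^ 2) * inverse x ^ (n - 1)))) = (\<lambda>v. (- (c * n * v)) * inverse x ^ (n + 1))"
      by (cases n) (auto simp: power2_eq_square)
    ultimately show "(f has_derivative (\<lambda>v. (- (c * n * v)) * inverse x ^ (n + 1))) (at x)"
      by (simp only: has_field_derivative_def)
  next
    show "\<exists>d m. (\<lambda>x. (- (c * n * v)) * inverse x ^ (n + 1)) = (\<lambda>x. d * inverse x ^ m)" for v
      by blast
  qed
qed

lemma smooth_on_inverse:
  fixes f :: "'a::real_normed_vector \<Rightarrow> real"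
  assumes "open S" "smooth_on S f" "\<And>x. x \<in> S \<Longrightarrow> f x \<noteq> 0"
  shows "smooth_on S (\<lambda>x. inverse (f x))"
proof (rule smooth_on_compose[OF assms(1) _ _ assms(2)])
  have "{x::real. x \<noteq> 0} = - {0}" by auto
  then show "open {x::real. x \<noteq> 0}" by (metis open_Compl closed_singleton)
qed (use assms Ck_inverse in \<open>auto simp: smooth_on_def\<close>)

lemma smooth_on_divide:
  fixes f :: "'a::real_normed_vector \<Rightarrow> real"
  shows "open S \<Longrightarrow> smooth_on S f \<Longrightarrow> smooth_on S g \<Longrightarrow> (\<And>x. x \<in> S \<Longrightarrow> g x \<noteq> 0) \<Longrightarrow>
    smooth_on S (\<lambda>x. f x / g x)"
  by (simp add: divide_inverse smooth_on_mult smooth_on_inverse)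

text \<open>The derivative is half of \<open>inverse (sqrt x)\<close>, so order k for
  \<open>sqrt\<close> itself yields order k + 1.\<close>

lemma Ck_sqrt: "Ck k {0<..} sqrt"
proof (induction k)
  case 0
  then show ?case by (auto intro: continuous_intros)
next
  case (Suc k)
  have op: "open {x::real. x \<noteq> 0}"
  proof -
    have "{x::real. x \<noteq> 0} = - {0}" by auto
    then show ?thesis by (metis open_Compl closed_singleton)
  qed
  show ?case
  proof (rule Ck_SucI[where f' = "\<lambda>x v. (v / 2) * inverse (sqrt x)"])
    show "(sqrt has_derivative (\<lambda>v. (v / 2) * inverse (sqrt x))) (at x)" if "x \<in> {0<..}" for x
      using that by (auto intro!: derivative_eq_intros simp: field_simps)
    show "Ck k {0<..} (\<lambda>x. (v / 2) * inverse (sqrt x))" for v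
      by (rule Ck_bounded_linear_compose[OF bounded_linear_mult_right _
            Ck_compose[OF _ op _ Suc Ck_inverse]]) auto
  qed auto
qed

lemma smooth_on_sqrt:
  fixes f :: "'a::real_normed_vector \<Rightarrow> real"
  assumes "open S" "smooth_on S f" "\<And>x. x \<in> S \<Longrightarrow> f x > 0"
  shows "smooth_on S (\<lambda>x. sqrt (f x))"
  by (rule smooth_on_compose[OF assms(1) open_greaterThan _ assms(2)])
     (use assms Ck_sqrt in \<open>auto simp: smooth_on_def\<close>)

lemma Ck_sin_cos: "Ck k UNIV (\<lambda>x::real. a * sin x + b * cos x)"
proof (rule Ck_family[where P = "\<lambda>f. \<exists>a b. f = (\<lambda>x. a * sin x + b * cos x)"])
  fix f :: "real \<Rightarrow> real" assume "\<exists>a b. f = (\<lambda>x. a * sin x + b * cos x)"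
  then obtain a b where f: "f = (\<lambda>x. a * sin x + b * cos x)" by blast
  show "\<exists>f'. (\<forall>x\<in>UNIV. (f has_derivative f' x) (at x)) \<and>
             (\<forall>v. \<exists>a b. (\<lambda>x. f' x v) = (\<lambda>x. a * sin x + b * cos x))"
  proof (intro exI[of _ "\<lambda>x v. (- v * b) * sin x + (v * a) * cos x"] conjI ballI allI)
    show "(f has_derivative (\<lambda>v. (- v * b) * sin x + (v * a) * cos x)) (at x)" for x
      unfolding f by (auto intro!: derivative_eq_intros ext simp: algebra_simps)
    show "\<exists>c d. (\<lambda>x. (- v * b) * sin x + (v * a) * cos x) = (\<lambda>x. c * sin x + d * cos x)" for v
      by blast
  qed
qed auto

lemma Ck_sinh_cosh: "Ck k UNIV (\<lambda>x::real. a * sinh x + b * cosh x)"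
proof (rule Ck_family[where P = "\<lambda>f. \<exists>a b. f = (\<lambda>x. a * sinh x + b * cosh x)"])
  fix f :: "real \<Rightarrow> real" assume "\<exists>a b. f = (\<lambda>x. a * sinh x + b * cosh x)"
  then obtain a b where f: "f = (\<lambda>x. a * sinh x + b * cosh x)" by blast
  show "\<exists>f'. (\<forall>x\<in>UNIV. (f has_derivative f' x) (at x)) \<and>
             (\<forall>v. \<exists>a b. (\<lambda>x. f' x v) = (\<lambda>x. a * sinh x + b * cosh x))"
  proof (intro exI[of _ "\<lambda>x v. (v * b) * sinh x + (v * a) * cosh x"] conjI ballI allI)
    show "(f has_derivative (\<lambda>v. (v * b) * sinh x + (v * a) * cosh x)) (at x)" for x
      unfolding f by (auto intro!: derivative_eq_intros ext simp: algebra_simps)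
    show "\<exists>c d. (\<lambda>x. (v * b) * sinh x + (v * a) * cosh x) = (\<lambda>x. c * sinh x + d * cosh x)" for v
      by blast
  qed
qed auto

lemma smooth_on_sin: "open S \<Longrightarrow> smooth_on S f \<Longrightarrow> smooth_on S (\<lambda>x. sin (f x :: real))"
  using Ck_sin_cos[of _ 1 0] smooth_on_compose[of S UNIV f sin] by (auto simp: smooth_on_def)

lemma smooth_on_cos: "open S \<Longrightarrow> smooth_on S f \<Longrightarrow> smooth_on S (\<lambda>x. cos (f x :: real))"
  using Ck_sin_cos[of _ 0 1] smooth_on_compose[of S UNIV f cos] by (auto simp: smooth_on_def)

lemma smooth_on_sinh: "open S \<Longrightarrow> smooth_on S f \<Longrightarrow> smooth_on S (\<lambda>x. sinh (f x :: real))"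
  using Ck_sinh_cosh[of _ 1 0] smooth_on_compose[of S UNIV f sinh] by (auto simp: smooth_on_def)

lemma smooth_on_cosh: "open S \<Longrightarrow> smooth_on S f \<Longrightarrow> smooth_on S (\<lambda>x. cosh (f x :: real))"
  using Ck_sinh_cosh[of _ 0 1] smooth_on_compose[of S UNIV f cosh] by (auto simp: smooth_on_def)

section \<open>The inverse function theorem for smooth maps\<close>

text \<open>At a zero of \<open>q\<close> the product rule needs only continuity of
  \<open>p\<close>: the error \<open>q y *\<^sub>R (p y - p x)\<close> is a product of a term of
  size O(norm (y - x)) and one that tends to 0.\<close>

lemma has_derivative_scaleR_vanishing:
  fixes q :: "'a::real_normed_vector \<Rightarrow> real" and p :: "'a \<Rightarrow> 'b::real_normed_vector"
  assumes q: "(q has_derivative Q) (at x)" and "q x = 0" and p: "isCont p x"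
  shows "((\<lambda>y. q y *\<^sub>R p y) has_derivative (\<lambda>h. Q h *\<^sub>R p x)) (at x)"
proof -
  obtain K where K: "K > 0" "\<And>h. norm (Q h) \<le> norm h * K"
    using bounded_linear.pos_bounded[OF has_derivative_bounded_linear[OF q]] by blast
  have "((\<lambda>y. q y *\<^sub>R (p y - p x)) has_derivative (\<lambda>h. 0)) (at x)"
    unfolding has_derivative_at_alt
  proof (intro conjI allI impI)
    show "bounded_linear (\<lambda>h::'a. 0::'b)" by simp
    fix e :: real assume e: "e > 0"
    have "e / (K + 1) > 0" using e K(1) by simp
    with p obtain d1 where d1: "d1 > 0" "\<And>y. dist y x < d1 \<Longrightarrow> dist (p y) (p x) < e / (K + 1)"
      unfolding continuous_at_eps_delta by (metis dist_commute)
    obtain d2 where d2: "d2 > 0"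
      "\<And>y. norm (y - x) < d2 \<Longrightarrow> norm (q y - q x - Q (y - x)) \<le> 1 * norm (y - x)"
      using q unfolding has_derivative_at_alt by (metis zero_less_one)
    show "\<exists>d>0. \<forall>y. norm (y - x) < d \<longrightarrow>
      norm (q y *\<^sub>R (p y - p x) - q x *\<^sub>R (p x - p x) - 0) \<le> e * norm (y - x)"
    proof (intro exI[of _ "min d1 d2"] conjI allI impI)
      fix y assume y: "norm (y - x) < min d1 d2"
      have "\<bar>q y\<bar> \<le> \<bar>q y - q x - Q (y - x)\<bar> + \<bar>Q (y - x)\<bar>" using \<open>q x = 0\<close> by linarith
      also have "\<dots> \<le> norm (y - x) + norm (y - x) * K"
        using d2(2)[of y] K(2)[of "y - x"] y by (simp add: add_mono)
      finally have *: "\<bar>q y\<bar> \<le> (K + 1) * norm (y - x)" by (simp add: algebra_simps)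
      have "norm (q y *\<^sub>R (p y - p x)) \<le> ((K + 1) * norm (y - x)) * (e / (K + 1))"
        unfolding norm_scaleR using * d1(2)[of y] y K(1)
        by (intro mult_mono) (auto simp: dist_norm less_imp_le)
      also have "\<dots> = e * norm (y - x)"
      proof -
        have "K + 1 \<noteq> 0" using K(1) by linarith
        then show ?thesis by (metis nonzero_mult_div_cancel_left mult.assoc mult.commute times_divide_eq_right)
      qed
      finally show "norm (q y *\<^sub>R (p y - p x) - q x *\<^sub>R (p x - p x) - 0) \<le> e * norm (y - x)"
        unfolding diff_self scaleR_zero_right diff_0_right .
    qed (use d1 d2 in auto)
  qed
  then have "((\<lambda>y. q y *\<^sub>R p x + q y *\<^sub>R (p y - p x)) has_derivative (\<lambda>h. Q h *\<^sub>R p x + 0)) (at x)"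
    by (intro has_derivative_add has_derivative_scaleR_left q)
  then show ?thesis by (simp add: algebra_simps)
qed

lemma linear_basis_sum:
  fixes L :: "'a::euclidean_space \<Rightarrow> 'b::real_vector"
  assumes "linear L"
  shows "L z = (\<Sum>j\<in>Basis. (z \<bullet> j) *\<^sub>R L j)"
proof -
  have "L z = L (\<Sum>j\<in>Basis. (z \<bullet> j) *\<^sub>R j)" by (simp add: euclidean_representation)
  also have "\<dots> = (\<Sum>j\<in>Basis. (z \<bullet> j) *\<^sub>R L j)"
    using assms by (simp add: linear_sum linear_cmul o_def)
  finally show ?thesis .
qed

section \<open>Inverses of smooth families of invertible linear maps\<close>

context
  fixes L :: "'a::real_normed_vector \<Rightarrow> 'b::euclidean_space \<Rightarrow> 'b" and S :: "'a set"
  assumes S: "open S" and lin: "\<And>x. x \<in> S \<Longrightarrow> linear (L x)" and inj: "\<And>x. x \<in> S \<Longrightarrow> inj (L x)"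
    and smooth: "\<And>v. smooth_on S (\<lambda>x. L x v)"
begin

lemma inv_family_bij: "x \<in> S \<Longrightarrow> bij (L x)"
  using lin inj by (simp add: bij_def linear_injective_imp_surjective)

lemma inv_family_linear: "x \<in> S \<Longrightarrow> linear (inv (L x))"
  using lin inj by (metis inj_linear_imp_inv_linear linear_injective_imp_surjective surj_def)

text \<open>The resolvent identity; it reduces continuity and differentiability of the inverses to
  those of \<open>L\<close>.\<close>

lemma inv_family_diff:
  assumes "x \<in> S" "y \<in> S"
  shows "inv (L y) v = inv (L x) v - inv (L y) (L y (inv (L x) v) - L x (inv (L x) v))"
  using assms inv_family_bij[of x] inv_family_bij[of y] inv_family_linear[of y]
  by (simp add: linear_diff bij_is_surj surj_f_inv_f bij_is_inj)

text \<open>A lower bound \<open>c * norm h\<close> for \<open>norm (L x h)\<close> persists with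
  \<open>c / 2\<close> at all nearby points, so the inverses are bounded by \<open>2 / c\<close>
  there, and the resolvent identity gives convergence.\<close>

lemma inv_family_continuous:
  shows "continuous_on S (\<lambda>x. inv (L x) v)"
proof (rule continuous_at_imp_continuous_on, rule ballI)
  fix x assume x: "x \<in> S"
  have *: "a \<le> (2 / c) * b" if "c > 0" "(c / 2) * a \<le> b" for a b c :: real
    using that by (simp add: field_simps)
  obtain c where c: "c > 0" "\<And>h. c * norm h \<le> norm (L x h)"
    using linear_inj_bounded_below_pos[OF lin[OF x] inj[OF x]] by blast
  have Lcont: "((\<lambda>y. L y z) \<longlongrightarrow> L x z) (at x)" for z
    using smooth_on_continuous_on[OF smooth, of z] x
    unfolding continuous_on_eq_continuous_at[OF S] continuous_at by (rule bspec)
  have "((\<lambda>y. \<Sum>i\<in>Basis. norm (L y i - L x i)) \<longlongrightarrow> (\<Sum>i\<in>Basis. norm (L x i - L x i))) (at x)"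
    by (intro tendsto_intros Lcont)
  then have "((\<lambda>y. \<Sum>i\<in>Basis. norm (L y i - L x i)) \<longlongrightarrow> 0) (at x)" by simp
  then have "\<forall>\<^sub>F y in at x. (\<Sum>i\<in>Basis. norm (L y i - L x i)) < c / 2"
    by (rule order_tendstoD(2)) (use c(1) in simp)
  moreover have "\<forall>\<^sub>F y in at x. y \<in> S"
    using S x by (rule eventually_at_in_open')
  ultimately have ev: "\<forall>\<^sub>F y in at x. norm (inv (L y) v - inv (L x) v)
      \<le> (2 / c) * norm (L y (inv (L x) v) - L x (inv (L x) v))"
  proof eventually_elim
    case (elim y)
    have low: "(c / 2) * norm h \<le> norm (L y h)" for h
    proof -
      have "L y h - L x h = (\<Sum>i\<in>Basis. (h \<bullet> i) *\<^sub>R (L y i - L x i))"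
        using linear_basis_sum[OF lin[OF x], of h] linear_basis_sum[OF lin[OF elim(2)], of h]
        by (simp add: algebra_simps sum_subtractf)
      also have "norm \<dots> \<le> (\<Sum>i\<in>Basis. norm h * norm (L y i - L x i))"
        by (intro sum_norm_le) (auto intro!: mult_right_mono Basis_le_norm)
      also have "\<dots> \<le> norm h * (c / 2)"
        unfolding sum_distrib_left[symmetric] using elim(1) by (intro mult_left_mono) auto
      finally have "norm (L y h - L x h) \<le> norm h * (c / 2)" .
      moreover have "norm (L x h) \<le> norm (L y h) + norm (L y h - L x h)"
        by (metis add.commute norm_minus_commute norm_triangle_sub)
      ultimately show ?thesis using c(2)[of h] by (simp add: algebra_simps)
    qed
    let ?z = "L y (inv (L x) v) - L x (inv (L x) v)"
    have "inv (L y) v - inv (L x) v = - inv (L y) ?z"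
      using inv_family_diff[OF x elim(2), of v] by simp
    then have "norm (inv (L y) v - inv (L x) v) = norm (inv (L y) ?z)"
      by (simp only: norm_minus_cancel)
    moreover have "norm (inv (L y) ?z) \<le> (2 / c) * norm ?z"
    proof -
      have "L y (inv (L y) ?z) = ?z"
        by (rule surj_f_inv_f[OF bij_is_surj[OF inv_family_bij[OF elim(2)]]])
      then have "(c / 2) * norm (inv (L y) ?z) \<le> norm ?z"
        using low[of "inv (L y) ?z"] by (simp only:)
      then show ?thesis by (rule *[OF c(1)])
    qed
    ultimately show ?case by (simp only:)
  qed
  have "((\<lambda>y. (2 / c) * norm (L y (inv (L x) v) - L x (inv (L x) v)))
      \<longlongrightarrow> (2 / c) * norm (L x (inv (L x) v) - L x (inv (L x) v))) (at x)"
    by (intro tendsto_intros Lcont)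
  then have "((\<lambda>y. (2 / c) * norm (L y (inv (L x) v) - L x (inv (L x) v))) \<longlongrightarrow> 0) (at x)"
    by simp
  from Lim_null_comparison[OF ev this]
  have "((\<lambda>y. inv (L y) v - inv (L x) v) \<longlongrightarrow> 0) (at x)" .
  then show "isCont (\<lambda>x. inv (L x) v) x"
    unfolding continuous_at by (rule LIM_zero_cancel)
qed

text \<open>In the resolvent identity the inner difference \<open>L y w - L x w\<close>, with w the
  value of the inverse at x, vanishes at \<open>y = x\<close>; hence continuity of the outer inverse
  suffices for the product rule.\<close>

lemma inv_family_derivative:
  assumes x: "x \<in> S"
  shows "((\<lambda>y. inv (L y) v) has_derivative
    (\<lambda>h. - (\<Sum>i\<in>Basis. (\<Sum>j\<in>Basis. (inv (L x) v \<bullet> j) * (frechet_derivative (\<lambda>y. L y j) (at x) h \<bullet> i))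
        *\<^sub>R inv (L x) i))) (at x)"
proof -
  let ?w = "inv (L x) v"
  let ?q = "\<lambda>i y. \<Sum>j\<in>Basis. (?w \<bullet> j) * ((L y j - L x j) \<bullet> i)"
  have q: "(?q i has_derivative (\<lambda>h. \<Sum>j\<in>Basis. (?w \<bullet> j) * (frechet_derivative (\<lambda>y. L y j) (at x) h \<bullet> i))) (at x)" for i
  proof (intro has_derivative_sum has_derivative_mult_right)
    fix j
    have "((\<lambda>y. (L y j - L x j) \<bullet> i) has_derivative (\<lambda>h. (frechet_derivative (\<lambda>y. L y j) (at x) h - 0) \<bullet> i)) (at x)"
      by (intro has_derivative_inner_left has_derivative_diff has_derivative_const
            smooth_on_has_derivative[OF smooth S x])
    then show "((\<lambda>y. (L y j - L x j) \<bullet> i) has_derivative (\<lambda>h. frechet_derivative (\<lambda>y. L y j) (at x) h \<bullet> i)) (at x)"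
      by simp
  qed
  have "((\<lambda>y. ?w - (\<Sum>i\<in>Basis. ?q i y *\<^sub>R inv (L y) i)) has_derivative
    (\<lambda>h. 0 - (\<Sum>i\<in>Basis. (\<Sum>j\<in>Basis. (?w \<bullet> j) * (frechet_derivative (\<lambda>y. L y j) (at x) h \<bullet> i)) *\<^sub>R inv (L x) i))) (at x)"
    using inv_family_continuous S x
    by (intro has_derivative_diff has_derivative_const has_derivative_sum
          has_derivative_scaleR_vanishing[OF q]) (auto simp: continuous_on_eq_continuous_at)
  moreover have "?w - (\<Sum>i\<in>Basis. ?q i y *\<^sub>R inv (L y) i) = inv (L y) v" if y: "y \<in> S" for y
  proof -
    have "(L y ?w - L x ?w) \<bullet> i = ?q i y" for i
      using linear_basis_sum[OF lin[OF x], of ?w] linear_basis_sum[OF lin[OF y], of ?w]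
      by (simp add: inner_sum_left inner_diff_left algebra_simps sum_subtractf)
    then show ?thesis
      using inv_family_diff[OF x y, of v]
        linear_basis_sum[OF inv_family_linear[OF y], of "L y ?w - L x ?w"] by simp
  qed
  ultimately show ?thesis
    by (auto intro: has_derivative_transform_within_open[OF _ S x])
qed

text \<open>The derivative is built from products of the inverses with derivatives of
  \<open>L\<close>, so order k for every \<open>v\<close> gives order k + 1.\<close>

lemma inv_family_smooth: "smooth_on S (\<lambda>x. inv (L x) v)"
proof (rule smooth_onI)
  show "Ck k S (\<lambda>x. inv (L x) v)" for k
  proof (induction k arbitrary: v)
    case 0
    then show ?case by (simp add: inv_family_continuous)
  next
    case (Suc k)
    show ?case
    proof (rule Ck_SucI[OF S inv_family_derivative])
      fix h
      show "Ck k S (\<lambda>x. - (\<Sum>i\<in>Basis. (\<Sum>j\<in>Basis. (inv (L x) v \<bullet> j) * (frechet_derivative (\<lambda>y. L y j) (at x) h \<bullet> i)) *\<^sub>R inv (L x) i))"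
        by (rule Ck_bounded_linear_compose[OF bounded_linear_minus[OF bounded_linear_ident] S])
           (intro Ck_sum S Ck_bilinear[OF bounded_bilinear_scaleR] Ck_bilinear[OF bounded_bilinear_mult]
             Suc.IH Ck_bounded_linear_compose[OF bounded_linear_inner_left]
             smooth_onD[OF smooth_on_frechet[OF smooth S]])
    qed
  qed
qed

end

theorem smooth_inverse_function:
  fixes f :: "'a::euclidean_space \<Rightarrow> 'a"
  assumes S: "open S" and f: "smooth_on S f" and x0: "x0 \<in> S"
    and d: "(f has_derivative d) (at x0)" "inj d"
  obtains U V where "open U" "U \<subseteq> S" "x0 \<in> U" "diffeo_on U V f"
proof -
  let ?D = "\<lambda>x. frechet_derivative f (at x)"
  have der: "(f has_derivative ?D x) (at x)" if "x \<in> S" for x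
    by (rule smooth_on_has_derivative[OF f S that])
  have D: "blinfun_apply (Blinfun (?D x)) = ?D x" if "x \<in> S" for x
    by (rule bounded_linear_Blinfun_apply[OF has_derivative_bounded_linear[OF der[OF that]]])
  have "?D x0 = d" using frechet_derivative_at[OF d(1)] by simp
  then obtain g0 where g0: "linear g0" "g0 \<circ> ?D x0 = id"
    using linear_injective_left_inverse[OF has_derivative_linear[OF d(1)] d(2)] by auto
  have g0b: "blinfun_apply (Blinfun g0) = g0"
    by (rule bounded_linear_Blinfun_apply) (use g0 linear_conv_bounded_linear in blast)
  obtain U V g g' where U: "open U" "U \<subseteq> S" "x0 \<in> U" "open V" "homeomorphism U V f g"
    and g: "\<And>y. y \<in> V \<Longrightarrow> (g has_derivative (g' y)) (at y)"
      "\<And>y. y \<in> V \<Longrightarrow> g' y = inv (blinfun_apply (Blinfun (?D (g y))))"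
      "\<And>y. y \<in> V \<Longrightarrow> bij (blinfun_apply (Blinfun (?D (g y))))"
  proof (rule inverse_function_theorem[OF S, where f' = "\<lambda>x. Blinfun (?D x)" and f = f and invf = "Blinfun g0"])
    show "continuous_on S (\<lambda>x. Blinfun (?D x))"
    proof (rule continuous_on_blinfun_componentwise)
      fix i
      show "continuous_on S (\<lambda>x. blinfun_apply (Blinfun (?D x)) i)"
        using smooth_on_continuous_on[OF smooth_on_frechet[OF f S, of i]] D
        by (metis (mono_tags, lifting) continuous_on_cong)
    qed
    show "Blinfun g0 o\<^sub>L Blinfun (?D x0) = id_blinfun"
      by (rule blinfun_eqI) (use g0(2) D[OF x0] g0b in \<open>simp add: fun_eq_iff\<close>)
  qed (use der D x0 in auto)
  have gU: "g y \<in> U" "g y \<in> S" "f (g y) = y" if "y \<in> V" for y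
    using U(2,5) that unfolding homeomorphism_def by auto
  have fV: "f x \<in> V" "g (f x) = x" if "x \<in> U" for x
    using U(5) that unfolding homeomorphism_def by auto
  have US: "x \<in> S" if "x \<in> U" for x using that U(2) by auto
  have w: "smooth_on U (\<lambda>x. inv (?D x) v)" for v
  proof (rule inv_family_smooth[OF U(1)])
    fix x assume x: "x \<in> U"
    show "linear (?D x)" using has_derivative_linear[OF der[OF US[OF x]]] .
    show "inj (?D x)" using g(3)[OF fV(1)[OF x]] fV(2)[OF x] D[OF US[OF x]] by (simp add: bij_is_inj)
  qed (rule smooth_on_subset[OF U(1,2) smooth_on_frechet[OF f S]])
  \<comment> \<open>Bootstrapping: the derivative of \<open>g\<close> is the smooth field of inverse
    differentials composed with \<open>g\<close>, so each order of \<open>g\<close> yields the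
    next.\<close>
  have "Ck k V g" for k
  proof (induction k)
    case 0
    show ?case using g(1) by (auto intro!: continuous_at_imp_continuous_on has_derivative_continuous)
  next
    case (Suc k)
    show ?case
    proof (rule Ck_SucI[OF U(4), where f' = "\<lambda>y v. inv (?D (g y)) v"])
      show "(g has_derivative (\<lambda>v. inv (?D (g y)) v)) (at y)" if "y \<in> V" for y
        using g(1,2)[OF that] D gU[OF that] by simp
      show "Ck k V (\<lambda>y. inv (?D (g y)) v)" for v
        by (rule Ck_compose[OF U(4,1) _ Suc smooth_onD[OF w]]) (rule gU)
    qed
  qed
  then have "smooth_on V g" by (rule smooth_onI)
  have inv: "inv_into U f y = g y" if "y \<in> V" for y
    using that gU fV by (metis (full_types) imageI inv_into_f_f inj_on_def inv_into_into f_inv_into_f)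
  have "diffeo_on U V f"
    unfolding diffeo_on_def
  proof (intro conjI)
    show "smooth_on V (inv_into U f)"
      by (rule smooth_on_cong[OF U(4) _ \<open>smooth_on V g\<close>]) (simp add: inv)
    show "f ` U = V" using U(5) unfolding homeomorphism_def by auto
    show "inj_on f U" using fV by (metis inj_onI)
    show "smooth_on U f" by (rule smooth_on_subset[OF U(1,2) f])
  qed (use U in auto)
  then show ?thesis using that U by blast
qed

lemma diffeo_on_inv:
  assumes "diffeo_on U V f"
  shows "diffeo_on V U (inv_into U f)"
  using assms unfolding diffeo_on_def
proof (elim conjE, intro conjI)
  assume *: "f ` U = V" "inj_on f U" "smooth_on U f" "open U"
  then show im: "inv_into U f ` V = U" by auto
  show inj: "inj_on (inv_into U f) V" using * by (metis inj_on_inv_into order_refl)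
  show "smooth_on U (inv_into V (inv_into U f))"
  proof (rule smooth_on_cong[OF _ _ *(3)])
    fix x assume x: "x \<in> U"
    have "inv_into V (inv_into U f) (inv_into U f (f x)) = f x"
      by (rule inv_into_f_f[OF inj]) (use x * in auto)
    then show "f x = inv_into V (inv_into U f) x" using x * by simp
  qed fact
qed

text \<open>Injectivity of two differentials at the base points is enough, since the inverse
  function theorem shrinks both domains. \<open>\<Psi>\<close> leads from the normal form to
  \<open>g\<close>, opposite to the target map in \<open>A_equiv_at\<close>, so its inverse is the
  witness.\<close>

lemma A_equiv_atI:
  fixes g :: "'a::euclidean_space \<Rightarrow> 'b::euclidean_space" and f :: "'a \<Rightarrow> 'b"
  assumes S: "open S" "q \<in> S" "smooth_on S h" "(h has_derivative h') (at q)" "inj h'"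
    and T: "open T" "f q \<in> T" "smooth_on T \<Psi>" "(\<Psi> has_derivative \<Psi>') (at (f q))" "inj \<Psi>'"
    and f: "continuous_on S f"
    and eq: "\<And>x. x \<in> S \<Longrightarrow> f x \<in> T \<Longrightarrow> g (h x) = \<Psi> (f x)"
  shows "A_equiv_at g (h q) f q"
proof -
  obtain T0 W where T0: "open T0" "T0 \<subseteq> T" "f q \<in> T0" "diffeo_on T0 W \<Psi>"
    using smooth_inverse_function[OF T(1,3,2,4,5)] .
  let ?S = "S \<inter> f -` T0"
  have "open ?S" using f S(1) T0(1) by (metis continuous_on_open_vimage Int_commute)
  moreover have "smooth_on ?S h" by (rule smooth_on_subset[OF \<open>open ?S\<close> _ S(3)]) auto
  moreover have "q \<in> ?S" using S T0 by auto
  ultimately obtain V U where V: "open V" "V \<subseteq> ?S" "q \<in> V" "diffeo_on V U h"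
    using smooth_inverse_function[OF _ _ _ S(4,5)] by metis
  have inj: "inj_on \<Psi> T0" and im: "\<Psi> ` T0 = W" using T0(4) unfolding diffeo_on_def by auto
  have *: "g (h x) \<in> W \<and> inv_into T0 \<Psi> (g (h x)) = f x" if "x \<in> V" for x
  proof -
    have "f x \<in> T0" "x \<in> S" using V(2) that by auto
    moreover have "g (h x) = \<Psi> (f x)" using eq[of x] \<open>x \<in> S\<close> \<open>f x \<in> T0\<close> T0(2) by blast
    ultimately show ?thesis using inj im by auto
  qed
  show ?thesis
    unfolding A_equiv_at_def
    by (rule exI[of _ V], rule exI[of _ U], rule exI[of _ h], rule exI[of _ W], rule exI[of _ T0],
        rule exI[of _ "inv_into T0 \<Psi>"])
       (use V(2,3,4) T0(2,3) diffeo_on_inv[OF T0(4)] * in blast)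
qed

section \<open>Whitney's theorem on even functions\<close>

text \<open>Partial derivatives of every order, in any sequence of variables, are continuous and
  bounded. Coinduction avoids counting orders. The bounds are global because the reflected series
  evaluates a function and its derivatives at points tending to infinity.\<close>

coinductive bounded_smooth :: "(real \<Rightarrow> real \<Rightarrow> real) \<Rightarrow> bool" where
  "continuous_on UNIV (\<lambda>z. f (fst z) (snd z)) \<Longrightarrow> (\<And>u v. \<bar>f u v\<bar> \<le> B) \<Longrightarrow>
   (\<And>u v. ((\<lambda>u. f u v) has_real_derivative fu u v) (at u)) \<Longrightarrow>
   (\<And>u v. (f u has_real_derivative fv u v) (at v)) \<Longrightarrow>
   bounded_smooth fu \<Longrightarrow> bounded_smooth fv \<Longrightarrow> bounded_smooth f"

definition pdu :: "(real \<Rightarrow> real \<Rightarrow> real) \<Rightarrow> real \<Rightarrow> real \<Rightarrow> real" where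
  "pdu f u v = deriv (\<lambda>u. f u v) u"

definition pdv :: "(real \<Rightarrow> real \<Rightarrow> real) \<Rightarrow> real \<Rightarrow> real \<Rightarrow> real" where
  "pdv f u v = deriv (f u) v"

lemma pdu_eqI:
  assumes "\<And>u v. ((\<lambda>u. f u v) has_real_derivative fu u v) (at u)"
  shows "pdu f = fu"
proof (rule ext, rule ext)
  show "pdu f u v = fu u v" for u v
    unfolding pdu_def by (rule DERIV_imp_deriv, rule assms)
qed

lemma pdv_eqI:
  assumes "\<And>u v. (f u has_real_derivative fv u v) (at v)"
  shows "pdv f = fv"
proof (rule ext, rule ext)
  show "pdv f u v = fv u v" for u v
    unfolding pdv_def by (rule DERIV_imp_deriv, rule assms)
qed

lemma bounded_smoothD:
  assumes "bounded_smooth f"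
  shows bounded_smooth_continuous: "continuous_on UNIV (\<lambda>z. f (fst z) (snd z))"
    and bounded_smooth_bounded: "\<exists>B. \<forall>u v. \<bar>f u v\<bar> \<le> B"
    and bounded_smooth_deriv_u: "((\<lambda>u. f u v) has_real_derivative pdu f u v) (at u)"
    and bounded_smooth_deriv_v: "(f u has_real_derivative pdv f u v) (at v)"
    and bounded_smooth_pdu: "bounded_smooth (pdu f)"
    and bounded_smooth_pdv: "bounded_smooth (pdv f)"
proof -
  from assms obtain B fu fv where *: "continuous_on UNIV (\<lambda>z. f (fst z) (snd z))"
    "\<And>u v. \<bar>f u v\<bar> \<le> B"
    "\<And>u v. ((\<lambda>u. f u v) has_real_derivative fu u v) (at u)"
    "\<And>u v. (f u has_real_derivative fv u v) (at v)" "bounded_smooth fu" "bounded_smooth fv"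
    by (rule bounded_smooth.cases) (hypsubst, rule that)
  have eq: "pdu f = fu" "pdv f = fv"
    by (rule pdu_eqI[of f fu, OF *(3)], rule pdv_eqI[of f fv, OF *(4)])
  show "continuous_on UNIV (\<lambda>z. f (fst z) (snd z))" "bounded_smooth (pdu f)" "bounded_smooth (pdv f)"
    "((\<lambda>u. f u v) has_real_derivative pdu f u v) (at u)" "(f u has_real_derivative pdv f u v) (at v)"
    unfolding eq by (rule *(1), rule *(5), rule *(6), rule *(3), rule *(4))
  show "\<exists>B. \<forall>u v. \<bar>f u v\<bar> \<le> B" using *(2) by blast
qed

text \<open>One unfolding of \<open>bounded_smooth\<close> with \<open>P\<close> in the recursive
  places; coinduction then amounts to a class closed under both partial derivatives.\<close>

definition bounded_step :: "((real \<Rightarrow> real \<Rightarrow> real) \<Rightarrow> bool) \<Rightarrow> (real \<Rightarrow> real \<Rightarrow> real) \<Rightarrow> bool" where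
  "bounded_step P f \<longleftrightarrow> (\<exists>B fu fv. continuous_on UNIV (\<lambda>z. f (fst z) (snd z)) \<and> (\<forall>u v. \<bar>f u v\<bar> \<le> B) \<and>
      (\<forall>u v. ((\<lambda>u. f u v) has_real_derivative fu u v) (at u)) \<and>
      (\<forall>u v. (f u has_real_derivative fv u v) (at v)) \<and> P fu \<and> P fv)"

lemma bounded_stepI:
  assumes "continuous_on UNIV (\<lambda>z. f (fst z) (snd z))" "\<And>u v. \<bar>f u v\<bar> \<le> B"
    "\<And>u v. ((\<lambda>u. f u v) has_real_derivative fu u v) (at u)"
    "\<And>u v. (f u has_real_derivative fv u v) (at v)" "P fu" "P fv"
  shows "bounded_step P f"
  unfolding bounded_step_def
  by (intro exI[of _ B] exI[of _ fu] exI[of _ fv] conjI allI assms)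

lemma bounded_smooth_family:
  assumes "P f" and "\<And>f. P f \<Longrightarrow> bounded_step P f"
  shows "bounded_smooth f"
  using assms(1)
proof (coinduction arbitrary: f)
  case (bounded_smooth f)
  from assms(2)[OF this] obtain B fu fv where "continuous_on UNIV (\<lambda>z. f (fst z) (snd z))"
    "\<forall>u v. \<bar>f u v\<bar> \<le> B" "\<forall>u v. ((\<lambda>u. f u v) has_real_derivative fu u v) (at u)"
    "\<forall>u v. (f u has_real_derivative fv u v) (at v)" "P fu" "P fv"
    unfolding bounded_step_def by (elim exE conjE)
  then show ?case
    by (intro exI[of _ f] exI[of _ B] exI[of _ fu] exI[of _ fv] conjI refl disjI1)
qed

lemma bounded_smooth_lincomb:
  assumes "bounded_smooth f" "bounded_smooth g"
  shows "bounded_smooth (\<lambda>u v. a * f u v + b * g u v)"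
proof -
  let ?P = "\<lambda>h :: real \<Rightarrow> real \<Rightarrow> real. \<exists>f g. bounded_smooth f \<and> bounded_smooth g \<and> h = (\<lambda>u v. a * f u v + b * g u v)"
  have PI: "?P (\<lambda>u v. a * f u v + b * g u v)" if "bounded_smooth f" "bounded_smooth g" for f g
    using that by blast
  show ?thesis
  proof (rule bounded_smooth_family[where P = ?P, OF PI[OF assms]])
    fix h assume "?P h"
    then obtain f g where f: "bounded_smooth f" and g: "bounded_smooth g"
      and h: "h = (\<lambda>u v. a * f u v + b * g u v)" by blast
    obtain B where B: "\<And>u v. \<bar>f u v\<bar> \<le> B" using bounded_smooth_bounded[OF f] by blast
    obtain C where C: "\<And>u v. \<bar>g u v\<bar> \<le> C" using bounded_smooth_bounded[OF g] by blast
    show "bounded_step ?P h"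
      unfolding h
    proof (rule bounded_stepI[where P = ?P and B = "\<bar>a\<bar> * B + \<bar>b\<bar> * C"
          and fu = "\<lambda>u v. a * pdu f u v + b * pdu g u v" and fv = "\<lambda>u v. a * pdv f u v + b * pdv g u v"])
      show "?P (\<lambda>u v. a * pdu f u v + b * pdu g u v)" "?P (\<lambda>u v. a * pdv f u v + b * pdv g u v)"
        by (rule PI[OF bounded_smooth_pdu[OF f] bounded_smooth_pdu[OF g]],
            rule PI[OF bounded_smooth_pdv[OF f] bounded_smooth_pdv[OF g]])
      show "\<bar>a * f u v + b * g u v\<bar> \<le> \<bar>a\<bar> * B + \<bar>b\<bar> * C" for u v
        by (rule order_trans[OF abs_triangle_ineq], unfold abs_mult)
           (intro add_mono mult_left_mono B C abs_ge_zero)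
      show "continuous_on UNIV (\<lambda>z. a * f (fst z) (snd z) + b * g (fst z) (snd z))"
        by (intro continuous_on_add continuous_on_mult_left
            bounded_smooth_continuous[OF f] bounded_smooth_continuous[OF g])
      show "((\<lambda>u. a * f u v + b * g u v) has_real_derivative a * pdu f u v + b * pdu g u v) (at u)" for u v
        by (intro DERIV_add DERIV_cmult bounded_smooth_deriv_u[OF f] bounded_smooth_deriv_u[OF g])
      show "((\<lambda>v. a * f u v + b * g u v) has_real_derivative a * pdv f u v + b * pdv g u v) (at v)" for u v
        by (intro DERIV_add DERIV_cmult bounded_smooth_deriv_v[OF f] bounded_smooth_deriv_v[OF g])
    qed
  qed
qed

lemma bounded_smooth_reflect:
  assumes "bounded_smooth f"
  shows "bounded_smooth (\<lambda>u v. f u (- v))"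
proof -
  let ?P = "\<lambda>h :: real \<Rightarrow> real \<Rightarrow> real. \<exists>c f. bounded_smooth f \<and> h = (\<lambda>u v. c * f u (- v))"
  have PI: "?P (\<lambda>u v. c * f u (- v))" if "bounded_smooth f" for f c
    using that by blast
  have "bounded_smooth (\<lambda>u v. 1 * f u (- v))"
  proof (rule bounded_smooth_family[where P = ?P, OF PI[OF assms]])
    fix h assume "?P h"
    then obtain c f where f: "bounded_smooth f" and h: "h = (\<lambda>u v. c * f u (- v))" by blast
    obtain B where B: "\<And>u v. \<bar>f u v\<bar> \<le> B" using bounded_smooth_bounded[OF f] by blast
    show "bounded_step ?P h"
      unfolding h
    proof (rule bounded_stepI[where P = ?P and B = "\<bar>c\<bar> * B"
          and fu = "\<lambda>u v. c * pdu f u (- v)" and fv = "\<lambda>u v. - c * pdv f u (- v)"])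
      show "?P (\<lambda>u v. c * pdu f u (- v))" "?P (\<lambda>u v. - c * pdv f u (- v))"
        by (rule PI[OF bounded_smooth_pdu[OF f]], rule PI[OF bounded_smooth_pdv[OF f]])
      show "\<bar>c * f u (- v)\<bar> \<le> \<bar>c\<bar> * B" for u v
        unfolding abs_mult by (intro mult_left_mono B abs_ge_zero)
      have "continuous_on UNIV (\<lambda>z. f (fst z) (- snd z))"
        using continuous_on_compose2[OF bounded_smooth_continuous[OF f], of UNIV "\<lambda>z. (fst z, - snd z)"]
        by (simp add: continuous_intros)
      then show "continuous_on UNIV (\<lambda>z. c * f (fst z) (- snd z))" by (intro continuous_intros)
      show "((\<lambda>u. c * f u (- v)) has_real_derivative c * pdu f u (- v)) (at u)" for u v
        by (intro DERIV_cmult bounded_smooth_deriv_u f)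
      have *: "((\<lambda>v. f u (- v)) has_real_derivative pdv f u (- v) * (- 1)) (at v)" for u v
        by (rule DERIV_chain2[OF bounded_smooth_deriv_v[OF f]]) (auto intro!: derivative_eq_intros)
      show "((\<lambda>v. c * f u (- v)) has_real_derivative - c * pdv f u (- v)) (at v)" for u v
        using DERIV_cmult[OF *[of u v], of c] by simp
    qed
  qed
  then show ?thesis by simp
qed

lemma bounded_smooth_has_derivative:
  assumes f: "bounded_smooth f"
  shows "((\<lambda>z. f (fst z) (snd z)) has_derivative (\<lambda>h. fst h * pdu f u v + snd h * pdv f u v)) (at (u, v))"
proof -
  have "((\<lambda>(x, y). f x y) has_derivative (\<lambda>(tx, ty). pdu f u v * tx + blinfun_mult_right (pdv f u v) ty))
    (at (u, v) within UNIV \<times> UNIV)"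
  proof (rule has_derivative_partialsI)
    show "((\<lambda>x. f x v) has_derivative (\<lambda>tx. pdu f u v * tx)) (at u)"
      using bounded_smooth_deriv_u[OF f] by (simp add: has_field_derivative_def)
    show "(f x has_derivative blinfun_apply (blinfun_mult_right (pdv f x y))) (at y)" for x y
      using bounded_smooth_deriv_v[OF f] by (simp add: has_field_derivative_def)
    have "continuous_on UNIV (\<lambda>z. blinfun_mult_right (pdv f (fst z) (snd z)))"
      by (rule bounded_linear.continuous_on[OF bounded_linear_blinfun_mult_right
          bounded_smooth_continuous[OF bounded_smooth_pdv[OF f]]])
    then show "continuous (at (u, v) within UNIV \<times> UNIV) (\<lambda>(x, y). blinfun_mult_right (pdv f x y))"
      by (simp add: continuous_on_eq_continuous_at split_beta')
  qed auto
  moreover have "(\<lambda>(tx, ty). pdu f u v * tx + blinfun_mult_right (pdv f u v) ty)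
      = (\<lambda>h. fst h * pdu f u v + snd h * pdv f u v)"
    by (auto simp: fun_eq_iff)
  moreover have "(\<lambda>(x, y). f x y) = (\<lambda>z. f (fst z) (snd z))" by auto
  ultimately show ?thesis by (simp only: UNIV_Times_UNIV)
qed

lemma bounded_smooth_imp_smooth_on:
  assumes "bounded_smooth f"
  shows "smooth_on UNIV (\<lambda>z. f (fst z) (snd z))"
proof (rule smooth_onI, rule Ck_family[where P = "\<lambda>h. \<exists>f. bounded_smooth f \<and> h = (\<lambda>z. f (fst z) (snd z))"])
  fix h :: "real \<times> real \<Rightarrow> real" assume "\<exists>f. bounded_smooth f \<and> h = (\<lambda>z. f (fst z) (snd z))"
  then obtain f where f: "bounded_smooth f" and h: "h = (\<lambda>z. f (fst z) (snd z))" by blast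
  show "\<exists>h'. (\<forall>x\<in>UNIV. (h has_derivative h' x) (at x)) \<and>
      (\<forall>v. \<exists>f. bounded_smooth f \<and> (\<lambda>x. h' x v) = (\<lambda>z. f (fst z) (snd z)))"
  proof (intro exI[of _ "\<lambda>z k. fst k * pdu f (fst z) (snd z) + snd k * pdv f (fst z) (snd z)"] conjI ballI allI)
    show "(h has_derivative (\<lambda>k. fst k * pdu f (fst z) (snd z) + snd k * pdv f (fst z) (snd z))) (at z)" for z
      using bounded_smooth_has_derivative[OF f, of "fst z" "snd z"] unfolding h by simp
    show "\<exists>fa. bounded_smooth fa \<and> (\<lambda>x. fst v * pdu f (fst x) (snd x) + snd v * pdv f (fst x) (snd x)) = (\<lambda>z. fa (fst z) (snd z))" for v
      by (rule exI[of _ "\<lambda>x y. fst v * pdu f x y + snd v * pdv f x y"], rule conjI[OF _ refl],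
          rule bounded_smooth_lincomb[OF bounded_smooth_pdu[OF f] bounded_smooth_pdv[OF f]])
  qed
next
  show "\<exists>fa. bounded_smooth fa \<and> (\<lambda>z. f (fst z) (snd z)) = (\<lambda>z. fa (fst z) (snd z))"
    by (rule exI[of _ f], rule conjI[OF assms refl])
qed (rule open_UNIV)

text \<open>All values are taken on one compact square, and the partial derivatives inherit both
  periods.\<close>

lemma periodic_bounded_smooth:
  fixes F :: "real \<times> real \<Rightarrow> real"
  assumes "smooth_on UNIV F" "p > 0" "\<And>u v. F (u + p, v) = F (u, v)" "\<And>u v. F (u, v + p) = F (u, v)"
  shows "bounded_smooth (\<lambda>u v. F (u, v))"
proof -
  let ?P = "\<lambda>h :: real \<Rightarrow> real \<Rightarrow> real. \<exists>F. smooth_on UNIV F \<and> (\<forall>u v. F (u + p, v) = F (u, v))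
    \<and> (\<forall>u v. F (u, v + p) = F (u, v)) \<and> h = (\<lambda>u v. F (u, v))"
  have PI: "?P (\<lambda>u v. F (u, v))" if "smooth_on UNIV F" "\<And>u v. F (u + p, v) = F (u, v)"
    "\<And>u v. F (u, v + p) = F (u, v)" for F
    by (rule exI[of _ F]) (simp add: that)
  show ?thesis
  proof (rule bounded_smooth_family[where P = ?P, OF PI[OF assms(1,3,4)]])
    fix h assume "?P h"
    then obtain F where F: "smooth_on UNIV F" and per: "\<And>u v. F (u + p, v) = F (u, v)" "\<And>u v. F (u, v + p) = F (u, v)"
      and h: "h = (\<lambda>u v. F (u, v))" by blast
    let ?D = "\<lambda>e z. frechet_derivative F (at z) e"
    have der: "(F has_derivative frechet_derivative F (at z)) (at z)" for z
      by (rule smooth_on_has_derivative[OF F]) auto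
    have shift: "frechet_derivative F (at (z + w)) = frechet_derivative F (at z)"
      if "\<And>z. F (z + w) = F z" for z w
    proof -
      have "((\<lambda>z. z + w) has_derivative (\<lambda>k. k)) (at z)" by (auto intro!: derivative_eq_intros)
      from has_derivative_compose[OF this der[of "z + w"]] that
      have "(F has_derivative frechet_derivative F (at (z + w))) (at z)" by simp
      then show ?thesis by (rule frechet_derivative_at)
    qed
    have perD: "?D e (u + p, v) = ?D e (u, v)" "?D e (u, v + p) = ?D e (u, v)" for e u v
    proof -
      have "F (z + (p, 0)) = F z" "F (z + (0, p)) = F z" for z
        using per by (cases z; simp)+
      from shift[OF this(1), of "(u, v)"] shift[OF this(2), of "(u, v)"]
      show "?D e (u + p, v) = ?D e (u, v)" "?D e (u, v + p) = ?D e (u, v)" by simp_all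
    qed
    have smD: "smooth_on UNIV (?D e)" for e by (rule smooth_on_frechet[OF F]) auto
    have cont: "continuous_on UNIV F" by (rule smooth_on_continuous_on[OF F])
    have "compact (F ` ({0..p} \<times> {0..p}))"
      by (intro compact_continuous_image continuous_on_subset[OF cont] compact_Times) auto
    from compact_imp_bounded[OF this] obtain B where "\<forall>y\<in>F ` ({0..p} \<times> {0..p}). norm y \<le> B"
      unfolding bounded_iff by (elim exE)
    then have B: "\<bar>F z\<bar> \<le> B" if "z \<in> {0..p} \<times> {0..p}" for z
      using that by (cases z) auto
    have pu: "F (x + of_int n * p, y) = F (x, y)" for x y n
    proof -
      interpret periodic_fun_simple "\<lambda>u. F (u, y)" p by standard (rule per)
      show ?thesis by (rule plus_of_int)
    qed
    have pv: "F (x, y + of_int n * p) = F (x, y)" for x y n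
    proof -
      interpret periodic_fun_simple "\<lambda>v. F (x, v)" p by standard (rule per)
      show ?thesis by (rule plus_of_int)
    qed
    have bound: "\<bar>h u v\<bar> \<le> B" for u v
    proof -
      let ?r = "\<lambda>x. x + of_int (- \<lfloor>x / p\<rfloor>) * p"
      have r: "?r x \<in> {0..p}" for x
      proof -
        have *: "of_int \<lfloor>x / p\<rfloor> \<le> x / p" "x / p \<le> of_int \<lfloor>x / p\<rfloor> + 1" by linarith+
        have "of_int \<lfloor>x / p\<rfloor> * p \<le> x" "x \<le> (of_int \<lfloor>x / p\<rfloor> + 1) * p"
          by (rule pos_le_divide_eq[OF \<open>p > 0\<close>, THEN iffD1, OF *(1)],
              rule pos_divide_le_eq[OF \<open>p > 0\<close>, THEN iffD1, OF *(2)])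
        then show ?thesis by (auto simp: algebra_simps)
      qed
      have "F (u, v) = F (?r u, ?r v)"
        by (simp only: pu pv)
      moreover have "\<bar>F (?r u, ?r v)\<bar> \<le> B" by (rule B, rule SigmaI, rule r, rule r)
      ultimately show ?thesis by (simp only: h)
    qed
    have du: "((\<lambda>u. h u v) has_real_derivative ?D (1, 0) (u, v)) (at u)" for u v
    proof -
      have "((\<lambda>u. (u, v)) has_derivative (\<lambda>k. (k, 0))) (at u)" by (auto intro!: derivative_eq_intros)
      from has_derivative_compose[OF this der] have "((\<lambda>u. F (u, v)) has_derivative (\<lambda>k. ?D (k, 0) (u, v))) (at u)" .
      moreover have "(\<lambda>k. ?D (k, 0) (u, v)) = (*) (?D (1, 0) (u, v))"
      proof (rule ext)
        show "?D (k, 0) (u, v) = ?D (1, 0) (u, v) * k" for k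
          using linear_cmul[OF has_derivative_linear[OF der], of "(u, v)" k "(1, 0)"]
          by (simp add: mult.commute)
      qed
      ultimately show ?thesis unfolding h has_field_derivative_def by (simp only:)
    qed
    have dv: "(h u has_real_derivative ?D (0, 1) (u, v)) (at v)" for u v
    proof -
      have "((\<lambda>v. (u, v)) has_derivative (\<lambda>k. (0, k))) (at v)" by (auto intro!: derivative_eq_intros)
      from has_derivative_compose[OF this der] have "((\<lambda>v. F (u, v)) has_derivative (\<lambda>k. ?D (0, k) (u, v))) (at v)" .
      moreover have "(\<lambda>k. ?D (0, k) (u, v)) = (*) (?D (0, 1) (u, v))"
      proof (rule ext)
        show "?D (0, k) (u, v) = ?D (0, 1) (u, v) * k" for k
          using linear_cmul[OF has_derivative_linear[OF der], of "(u, v)" k "(0, 1)"]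
          by (simp add: mult.commute)
      qed
      ultimately show ?thesis unfolding h has_field_derivative_def by (simp only:)
    qed
    show "bounded_step ?P h"
    proof (rule bounded_stepI[where P = ?P, OF _ bound du dv])
      show "continuous_on UNIV (\<lambda>z. h (fst z) (snd z))" by (simp add: h cont)
      show "?P (\<lambda>u v. ?D (1, 0) (u, v))" "?P (\<lambda>u v. ?D (0, 1) (u, v))"
        by (rule PI[OF smD perD], rule PI[OF smD perD])
    qed
  qed
qed

section \<open>Weights for Seeley's reflection\<close>

primrec euler_coeff :: "nat \<Rightarrow> real" where
  "euler_coeff 0 = 1"
| "euler_coeff (Suc k) = - 2 * euler_coeff k / (2 ^ Suc k - 1)"

text \<open>This compares coefficients in P(2 z) = (1 - 2 z) P(z), the functional equation of the
  product P of the factors 1 - z / 2^j.\<close>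

lemma euler_coeff_rec: "(2 ^ Suc k - 1) * euler_coeff (Suc k) = - 2 * euler_coeff k"
proof -
  have "(1::real) \<le> 2 ^ k" by simp
  then have "(2::real) ^ Suc k - 1 \<noteq> 0" unfolding power_Suc by linarith
  then show ?thesis unfolding euler_coeff.simps(2) by (rule nonzero_mult_div_cancel_left[THEN trans[OF times_divide_eq_right]])
qed

text \<open>Consecutive terms have the ratio 2 * 2^n / (2^(k+1) - 1), which is at most 1/2 once k >=
  n + 2.\<close>

lemma summable_euler_coeff: "summable (\<lambda>k. \<bar>euler_coeff k\<bar> * (2 ^ k) ^ n)"
proof (rule summable_ratio_test[of "1 / 2" "n + 2"])
  fix k assume k: "n + 2 \<le> k"
  define x y where "x = (2::real) ^ k" and "y = (2::real) ^ n"
  have y: "0 < y" "4 * y \<le> x" "1 \<le> x"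
    using power_increasing[OF k, of "2::real"] by (auto simp: x_def y_def power_add)
  have "2 * y / (2 * x - 1) \<le> 1 / 2" using y by (simp add: divide_simps)
  moreover have "(2 ^ Suc k) ^ n = y * x ^ n"
    by (simp add: x_def y_def power_mult_distrib)
  moreover have "\<bar>euler_coeff (Suc k)\<bar> = 2 * \<bar>euler_coeff k\<bar> / (2 * x - 1)"
    unfolding euler_coeff.simps(2) power_Suc x_def[symmetric] using y(3) by (simp add: abs_mult)
  ultimately have "\<bar>euler_coeff (Suc k)\<bar> * (2 ^ Suc k) ^ n = (2 * y / (2 * x - 1)) * (\<bar>euler_coeff k\<bar> * x ^ n)"
    by simp
  also have "\<dots> \<le> (1 / 2) * (\<bar>euler_coeff k\<bar> * x ^ n)"
    using \<open>2 * y / (2 * x - 1) \<le> 1 / 2\<close> y by (intro mult_right_mono) auto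
  finally show "norm (\<bar>euler_coeff (Suc k)\<bar> * (2 ^ Suc k) ^ n) \<le> 1 / 2 * norm (\<bar>euler_coeff k\<bar> * (2 ^ k) ^ n)"
    by (simp add: x_def abs_mult)
qed simp

text \<open>By Euler, \<open>\<Sum>k. euler_coeff k * z ^ k\<close> is the product of the factors \<open>1 - z / 2 ^ j\<close>, \<open>j \<ge> 0\<close>;
  hence it vanishes at the powers of two.\<close>

lemma euler_coeff_sums_zero: "(\<lambda>k. euler_coeff k * (2 ^ k) ^ n) sums 0"
proof (induction n)
  case 0
  \<comment> \<open>The recursion makes the partial sums telescope to a multiple of the last
    coefficient.\<close>
  have part: "(\<Sum>k<Suc m. euler_coeff k) = euler_coeff m / 2 ^ m" for m
  proof (induction m)
    case (Suc m)
    have "euler_coeff m = - ((2 ^ Suc m - 1) * euler_coeff (Suc m)) / 2"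
      using euler_coeff_rec[of m] by linarith
    then show ?case
      using Suc by (simp add: field_simps del: euler_coeff.simps)
  qed simp
  have "(\<lambda>m. \<bar>euler_coeff m\<bar>) \<longlonglongrightarrow> 0"
    using summable_LIMSEQ_zero[OF summable_euler_coeff[of 0]] by simp
  then have "(\<lambda>m. euler_coeff m / 2 ^ m) \<longlonglongrightarrow> 0"
  proof (rule Lim_null_comparison[rotated], intro always_eventually allI)
    fix m
    have "\<bar>euler_coeff m\<bar> / 2 ^ m \<le> \<bar>euler_coeff m\<bar> / 1" by (rule divide_left_mono) auto
    then show "norm (euler_coeff m / 2 ^ m) \<le> \<bar>euler_coeff m\<bar>" by simp
  qed
  then have "(\<lambda>m. \<Sum>k<Suc m. euler_coeff k) \<longlonglongrightarrow> 0" by (simp only: part)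
  from LIMSEQ_imp_Suc[OF this] show ?case by (simp add: sums_def)
next
  case (Suc n)
  \<comment> \<open>The new factor 2^k is split as (2^k - 1) + 1. By the recursion the first part is
    a shifted multiple of the series for \<open>n\<close>, and the second part is that series
    itself; both sum to 0.\<close>
  let ?r = "\<lambda>k. euler_coeff k * (2 ^ k - 1) * (2 ^ k) ^ n"
  have r: "- 2 * 2 ^ n * (euler_coeff k * (2 ^ k) ^ n) = ?r (Suc k)" for k
  proof -
    have "?r (Suc k) = ((2 ^ Suc k - 1) * euler_coeff (Suc k)) * (2 ^ Suc k) ^ n"
      by (simp only: mult.commute mult.left_commute)
    also have "\<dots> = - 2 * euler_coeff k * (2 ^ Suc k) ^ n" by (simp only: euler_coeff_rec)
    finally show ?thesis by (simp add: power_mult_distrib)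
  qed
  have "(\<lambda>k. ?r (Suc k)) sums 0"
    using sums_mult[OF Suc, of "- 2 * 2 ^ n"] unfolding r mult_zero_right .
  from sums_add[OF sums_Suc[OF this] Suc] show ?case
    by (simp add: algebra_simps)
qed

lemma euler_quotient_bound: "\<bar>euler_coeff k / (2 ^ k + 1)\<bar> \<le> \<bar>euler_coeff k\<bar>"
proof -
  have "\<bar>euler_coeff k\<bar> / (2 ^ k + 1) \<le> \<bar>euler_coeff k\<bar> / 1"
    by (rule divide_left_mono) (auto simp: add_pos_pos)
  then show ?thesis by (simp add: abs_div_pos[symmetric] add_pos_pos)
qed

text \<open>This sum is the common value of all moments by which the weights are normalised, so it
  must not vanish. The first three terms dominate the tail.\<close>

lemma euler_sum_pos:
  "summable (\<lambda>k. euler_coeff k / (2 ^ k + 1))" "0 < (\<Sum>k. euler_coeff k / (2 ^ k + 1))"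
proof -
  let ?t = "\<lambda>k. euler_coeff k / (2 ^ k + 1)"
  have "norm (?t k) \<le> \<bar>euler_coeff k\<bar> * (2 ^ k) ^ 0" for k
    using euler_quotient_bound[of k] by simp
  then show sm: "summable ?t"
    by (rule summable_comparison_test'[OF summable_euler_coeff[of 0], of 0])
  \<comment> \<open>The constant 8/189 is the absolute value of the term of index 3; from there on
    each term is at most half of its predecessor.\<close>
  have b: "\<bar>?t (k + 3)\<bar> \<le> (8 / 189) * (1 / 2) ^ k" for k
  proof (induction k)
    case 0
    show ?case by (simp add: eval_nat_numeral)
  next
    case (Suc k)
    define x where "x = (2::real) ^ (k + 3)"
    have x: "x \<ge> 8" using power_increasing[of 3 "k + 3" "2::real"] by (simp add: x_def)
    have e: "euler_coeff (Suc k + 3) = - 2 * euler_coeff (k + 3) / (2 * x - 1)"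
      unfolding add_Suc euler_coeff.simps(2) power_Suc x_def ..
    have xx: "8 * x \<le> x * x" using x by (intro mult_right_mono) auto
    have "4 * (x + 1) \<le> 4 * y - 1" if "8 * x \<le> y" for y using that x by simp
    from this[OF xx] have "4 * (x + 1) \<le> 4 * (x * x) - 1" .
    also have "\<dots> = (2 * x - 1) * (2 * x + 1)" by (simp add: algebra_simps)
    finally have "4 * (x + 1) \<le> (2 * x - 1) * (2 * x + 1)" .
    then have q: "2 * (x + 1) / ((2 * x - 1) * (2 * x + 1)) \<le> 1 / 2"
      using x by (simp add: divide_simps)
    have "?t (Suc k + 3) = - (2 * (x + 1) / ((2 * x - 1) * (2 * x + 1))) * ?t (k + 3)"
    proof -
      have p: "(2::real) ^ (Suc k + 3) = 2 * x" unfolding x_def add_Suc power_Suc ..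
      have "- 2 * c / (2 * x - 1) / (2 * x + 1) = - (2 * (x + 1) / ((2 * x - 1) * (2 * x + 1))) * (c / (x + 1))" for c
        using x by (simp add: divide_simps)
      then show ?thesis unfolding e p x_def[symmetric] .
    qed
    then have "\<bar>?t (Suc k + 3)\<bar> = (2 * (x + 1) / ((2 * x - 1) * (2 * x + 1))) * \<bar>?t (k + 3)\<bar>"
      using x by (simp add: abs_mult)
    also have "\<dots> \<le> (1 / 2) * ((8 / 189) * (1 / 2) ^ k)"
      by (rule mult_mono[OF q Suc]) auto
    finally show ?case by simp
  qed
  have geo: "(\<lambda>k. (8 / 189) * (1 / 2) ^ k) sums ((8 / 189) * (1 / (1 - 1 / 2 :: real)))"
    by (intro sums_mult geometric_sums) simp
  have sm3: "summable (\<lambda>k. \<bar>?t (k + 3)\<bar>)"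
    by (rule summable_comparison_test'[OF sums_summable[OF geo], of 0]) (use b in simp)
  have "\<bar>\<Sum>k. ?t (k + 3)\<bar> \<le> (\<Sum>k. \<bar>?t (k + 3)\<bar>)" by (rule summable_rabs[OF sm3])
  also have "\<dots> \<le> (\<Sum>k. (8 / 189) * (1 / 2) ^ k)"
    by (rule suminf_le[OF b sm3 sums_summable[OF geo]])
  also have "\<dots> = 16 / 189" using sums_unique[OF geo] by simp
  finally have "- (16 / 189) \<le> (\<Sum>k. ?t (k + 3))" by linarith
  \<comment> \<open>The terms are 1/2, -2/3 and 4/15, and 1/10 exceeds the bound 16/189 of the
    tail.\<close>
  moreover have "(\<Sum>k<3. ?t k) = 1 / 10" by (simp add: eval_nat_numeral)
  ultimately show "0 < (\<Sum>k. ?t k)"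
    using suminf_split_initial_segment[OF sm, of 3] by simp
qed

text \<open>Seeley's moment conditions: differentiating h(- 2^k w) n times in w brings out (-
  2^k)^n, so moments equal to 1 match the n-th derivatives at 0. The absolute summability keeps the
  differentiated series convergent.\<close>

definition reflection_weights :: "(nat \<Rightarrow> real) \<Rightarrow> bool" where
  "reflection_weights a \<longleftrightarrow> (\<forall>n. summable (\<lambda>k. \<bar>a k\<bar> * (2 ^ k) ^ n)) \<and>
     (\<forall>n. (\<lambda>k. a k * (- (2 ^ k)) ^ n) sums 1)"

text \<open>For the weights \<open>?t k\<close>, consecutive moments differ by the sum of
  \<open>?t k * (1 + 2 ^ k) * (- (2 ^ k)) ^ n\<close>, where the denominator cancels and an
  alternating sign times a vanishing Euler sum remains. So all moments agree with the zeroth, which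
  is \<open>?C\<close>.\<close>

lemma reflection_weights_exist: "\<exists>a. reflection_weights a"
proof -
  let ?t = "\<lambda>k. euler_coeff k / (2 ^ k + 1)"
  let ?C = "\<Sum>k. ?t k"
  have C: "?C > 0" by (rule euler_sum_pos)
  have s: "(\<lambda>k. ?t k * (- (2 ^ k)) ^ n) sums ?C" for n
  proof (induction n)
    case 0
    then show ?case using summable_sums[OF euler_sum_pos(1)] unfolding power_0 mult_1_right .
  next
    case (Suc n)
    have e: "?t k * (- (2 ^ k)) ^ n - (- 1) ^ n * (euler_coeff k * (2 ^ k) ^ n) = ?t k * (- (2 ^ k)) ^ Suc n" for k
    proof -
      have "(2::real) ^ k + 1 > 0" by (simp add: add_pos_pos)
      then have c: "euler_coeff k = ?t k * (2 ^ k + 1)" by simp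
      have d: "(- ((2::real) ^ k)) ^ n = (- 1) ^ n * (2 ^ k) ^ n"
        by (metis mult_minus1 power_mult_distrib)
      have *: "T * p - s * (C * y) = T * (- x * p)" if "C = T * (x + 1)" "p = s * y" for C T x p s y :: real
        using that by (simp add: algebra_simps)
      show ?thesis unfolding power_Suc by (rule *[OF c d])
    qed
    show ?case
      using sums_diff[OF Suc sums_mult[OF euler_coeff_sums_zero[of n], of "(- 1) ^ n"]]
      unfolding e mult_zero_right diff_zero .
  qed
  have "reflection_weights (\<lambda>k. ?t k / ?C)"
    unfolding reflection_weights_def
  proof (intro conjI allI)
    fix n
    show "(\<lambda>k. ?t k / ?C * (- (2 ^ k)) ^ n) sums 1"
    proof -
      have "(\<lambda>k. ?t k * (- (2 ^ k)) ^ n / ?C) sums 1"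
        using sums_divide[OF s[of n], of ?C] C unfolding divide_self[OF C[THEN less_imp_neq, symmetric]] by (simp only:)
      then show ?thesis by (simp only: times_divide_eq_left)
    qed
    have "norm (\<bar>?t k / ?C\<bar> * (2 ^ k) ^ n) \<le> (1 / ?C) * (\<bar>euler_coeff k\<bar> * (2 ^ k) ^ n)" for k
    proof -
      have "\<bar>?t k\<bar> * (2 ^ k) ^ n / ?C \<le> \<bar>euler_coeff k\<bar> * (2 ^ k) ^ n / ?C"
        using C by (intro divide_right_mono mult_right_mono euler_quotient_bound) auto
      moreover have "norm (\<bar>?t k / ?C\<bar> * (2 ^ k) ^ n) = \<bar>?t k\<bar> * (2 ^ k) ^ n / ?C"
        using C unfolding abs_divide[of "?t k" ?C] real_norm_def abs_mult abs_of_pos[OF C] by simp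
      ultimately show ?thesis by (simp only: times_divide_eq_left mult_1)
    qed
    then show "summable (\<lambda>k. \<bar>?t k / ?C\<bar> * (2 ^ k) ^ n)"
      by (rule summable_comparison_test'[OF summable_mult[OF summable_euler_coeff[of n]], of 0])
  qed
  then show ?thesis by (rule exI[of reflection_weights])
qed

text \<open>These are the weights of the w-derivative of a reflected series; moment n of the new
  weights is moment n + 1 of the old ones.\<close>

lemma reflection_weights_shift:
  assumes "reflection_weights a"
  shows "reflection_weights (\<lambda>k. - (2 ^ k) * a k)"
  unfolding reflection_weights_def
proof (intro conjI allI)
  fix n
  have "summable (\<lambda>k. \<bar>a k\<bar> * (2 ^ k) ^ Suc n)" "(\<lambda>k. a k * (- (2 ^ k)) ^ Suc n) sums 1"
    using assms unfolding reflection_weights_def by (rule conjE, simp only:)+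
  then show "summable (\<lambda>k. \<bar>- (2 ^ k) * a k\<bar> * (2 ^ k) ^ n)" "(\<lambda>k. - (2 ^ k) * a k * (- (2 ^ k)) ^ n) sums 1"
    by (simp_all add: abs_mult mult_ac)
qed

section \<open>Smooth division by powers of v through Hadamard integrals\<close>

definition hadamard :: "nat \<Rightarrow> (real \<Rightarrow> real \<Rightarrow> real) \<Rightarrow> real \<Rightarrow> real \<Rightarrow> real" where
  "hadamard p f u v = integral {0..1} (\<lambda>s. s ^ p * f u (s * v))"

lemma continuous_hadamard_kernel:
  assumes "bounded_smooth f"
  shows "continuous_on UNIV (\<lambda>z :: (real \<times> real) \<times> real. snd z ^ p * f (fst (fst z)) (snd z * snd (fst z)))"
proof -
  have "continuous_on UNIV (\<lambda>z :: (real \<times> real) \<times> real. (\<lambda>w. f (fst w) (snd w)) (fst (fst z), snd z * snd (fst z)))"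
    by (rule continuous_on_compose2[OF bounded_smooth_continuous[OF assms]]) (auto intro!: continuous_intros)
  then show ?thesis by (intro continuous_on_mult continuous_on_power continuous_on_snd continuous_on_id) simp
qed

lemma continuous_hadamard_kernel':
  assumes "bounded_smooth f"
  shows "continuous_on A (\<lambda>s. s ^ p * f u (s * v))"
proof -
  have "continuous_on A (\<lambda>s. (\<lambda>z :: (real \<times> real) \<times> real. snd z ^ p * f (fst (fst z)) (snd z * snd (fst z))) ((u, v), s))"
    by (rule continuous_on_compose2[OF continuous_hadamard_kernel[OF assms]]) (auto intro!: continuous_intros)
  then show ?thesis by simp
qed

lemma hadamard_deriv_u:
  assumes f: "bounded_smooth f"
  shows "((\<lambda>u. hadamard p f u v) has_real_derivative hadamard p (pdu f) u v) (at u)"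
proof -
  have "((\<lambda>u. integral (cbox 0 1) (\<lambda>s. s ^ p * f u (s * v))) has_field_derivative
      integral (cbox 0 1) (\<lambda>s. s ^ p * pdu f u (s * v))) (at u within UNIV)"
  proof (rule leibniz_rule_field_derivative)
    show "((\<lambda>u. s ^ p * f u (s * v)) has_field_derivative s ^ p * pdu f u (s * v)) (at u within UNIV)" for u s
      by (intro DERIV_cmult bounded_smooth_deriv_u[OF f])
    show "(\<lambda>s. s ^ p * f u (s * v)) integrable_on cbox 0 1" for u
      by (rule integrable_continuous[OF continuous_hadamard_kernel'[OF f]])
    have "continuous_on (UNIV \<times> cbox 0 1) (\<lambda>x. (\<lambda>z :: (real \<times> real) \<times> real. snd z ^ p * pdu f (fst (fst z)) (snd z * snd (fst z))) ((fst x, v), snd x))"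
      by (rule continuous_on_compose2[OF continuous_hadamard_kernel[OF bounded_smooth_pdu[OF f]]])
        (auto intro!: continuous_intros)
    then show "continuous_on (UNIV \<times> cbox 0 1) (\<lambda>(u, s). s ^ p * pdu f u (s * v))"
      by (simp add: split_beta')
  qed auto
  then show ?thesis by (simp add: hadamard_def)
qed

text \<open>The chain rule on \<open>f u (s * v)\<close> releases a factor s; the power
  \<open>s ^ p\<close> in the integrand makes the class of these integrals closed under
  v-derivatives.\<close>

lemma hadamard_deriv_v:
  assumes f: "bounded_smooth f"
  shows "(hadamard p f u has_real_derivative hadamard (Suc p) (pdv f) u v) (at v)"
proof -
  have "((\<lambda>v. integral (cbox 0 1) (\<lambda>s. s ^ p * f u (s * v))) has_field_derivative
      integral (cbox 0 1) (\<lambda>s. s ^ Suc p * pdv f u (s * v))) (at v within UNIV)"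
  proof (rule leibniz_rule_field_derivative)
    fix v s :: real
    have "((\<lambda>v. f u (s * v)) has_real_derivative pdv f u (s * v) * s) (at v)"
      by (rule DERIV_chain2[OF bounded_smooth_deriv_v[OF f]]) (auto intro!: derivative_eq_intros)
    from DERIV_cmult[OF this, of "s ^ p"]
    show "((\<lambda>v. s ^ p * f u (s * v)) has_field_derivative s ^ Suc p * pdv f u (s * v)) (at v within UNIV)"
      by (simp add: mult_ac)
  next
    show "(\<lambda>s. s ^ p * f u (s * v)) integrable_on cbox 0 1" for v
      by (rule integrable_continuous[OF continuous_hadamard_kernel'[OF f]])
    have "continuous_on (UNIV \<times> cbox 0 1) (\<lambda>x. (\<lambda>z :: (real \<times> real) \<times> real. snd z ^ Suc p * pdv f (fst (fst z)) (snd z * snd (fst z))) ((u, fst x), snd x))"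
      by (rule continuous_on_compose2[OF continuous_hadamard_kernel[OF bounded_smooth_pdv[OF f]]])
        (auto intro!: continuous_intros)
    then show "continuous_on (UNIV \<times> cbox 0 1) (\<lambda>(v, s). s ^ Suc p * pdv f u (s * v))"
      by (simp add: split_beta')
  qed auto
  then show ?thesis by (simp add: hadamard_def[abs_def])
qed

lemma bounded_smooth_hadamard:
  assumes "bounded_smooth f"
  shows "bounded_smooth (hadamard p f)"
proof -
  let ?P = "\<lambda>h :: real \<Rightarrow> real \<Rightarrow> real. \<exists>p f. bounded_smooth f \<and> h = hadamard p f"
  have PI: "?P (hadamard p f)" if "bounded_smooth f" for p f
    by (rule exI[of _ p], rule exI[of _ f], rule conjI[OF that refl])
  show ?thesis
  proof (rule bounded_smooth_family[where P = ?P, OF PI[OF assms]])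
    fix h assume "?P h"
    then obtain p f where f: "bounded_smooth f" and h: "h = hadamard p f" by (elim exE conjE)
    obtain B where B: "\<And>u v. \<bar>f u v\<bar> \<le> B" using bounded_smooth_bounded[OF f] by blast
    show "bounded_step ?P h"
      unfolding h
    proof (rule bounded_stepI[where P = ?P and fu = "hadamard p (pdu f)" and fv = "hadamard (Suc p) (pdv f)"])
      show "?P (hadamard p (pdu f))" by (rule PI[OF bounded_smooth_pdu[OF f]])
      show "?P (hadamard (Suc p) (pdv f))" by (rule PI[OF bounded_smooth_pdv[OF f]])
      show "((\<lambda>u. hadamard p f u v) has_real_derivative hadamard p (pdu f) u v) (at u)" for u v
        by (rule hadamard_deriv_u[OF f])
      show "(hadamard p f u has_real_derivative hadamard (Suc p) (pdv f) u v) (at v)" for u v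
        by (rule hadamard_deriv_v[OF f])
      have "continuous_on UNIV (\<lambda>z. integral (cbox 0 1) (\<lambda>s. s ^ p * f (fst z) (s * snd z)))"
        by (rule integral_continuous_on_param,
            rule continuous_on_subset[OF _ subset_UNIV], unfold split_beta')
           (rule continuous_hadamard_kernel[OF f])
      then show "continuous_on UNIV (\<lambda>z. hadamard p f (fst z) (snd z))"
        by (simp add: hadamard_def)
      show "\<bar>hadamard p f u v\<bar> \<le> B" for u v
      proof -
        have "norm (integral {0..1} (\<lambda>s. s ^ p * f u (s * v))) \<le> B * (1 - 0)"
        proof (rule integral_bound[OF _ continuous_hadamard_kernel'[OF f]])
          fix s :: real assume "s \<in> {0..1}"
          then have "\<bar>s ^ p\<bar> \<le> 1" by (simp add: power_le_one)
          then have "\<bar>s ^ p\<bar> * \<bar>f u (s * v)\<bar> \<le> 1 * B" by (rule mult_mono) (auto simp: B)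
          then show "norm (s ^ p * f u (s * v)) \<le> B" by (simp add: abs_mult)
        qed simp
        then show ?thesis by (simp add: hadamard_def)
      qed
    qed
  qed
qed

lemma pdv_hadamard: "bounded_smooth f \<Longrightarrow> pdv (hadamard p f) = hadamard (Suc p) (pdv f)"
  by (rule pdv_eqI, rule hadamard_deriv_v)

lemma hadamard_at_zero: "hadamard p f u 0 = f u 0 / real (Suc p)"
proof -
  have "((\<lambda>s. s ^ p * f u 0) has_integral (f u 0 / real (Suc p) * 1 ^ Suc p - f u 0 / real (Suc p) * 0 ^ Suc p)) {0..1}"
  proof (rule fundamental_theorem_of_calculus)
    fix s :: real
    have "((\<lambda>s. f u 0 / real (Suc p) * s ^ Suc p) has_real_derivative
        f u 0 / real (Suc p) * (real (Suc p) * s ^ (Suc p - Suc 0))) (at s within {0..1})"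
      by (intro DERIV_cmult DERIV_pow)
    then show "((\<lambda>s. f u 0 / real (Suc p) * s ^ Suc p) has_vector_derivative s ^ p * f u 0) (at s within {0..1})"
      by (simp add: has_real_derivative_iff_has_vector_derivative mult.commute del: of_nat_Suc power_Suc)
  qed simp
  from integral_unique[OF this] show ?thesis
    by (simp only: hadamard_def power_one mult_1_right power_0_Suc mult_zero_right diff_zero)
qed

lemma hadamard_division:
  assumes f: "bounded_smooth f"
  shows "f u v = f u 0 + v * hadamard 0 (pdv f) u v"
proof -
  have "((\<lambda>s. v * pdv f u (s * v)) has_integral (f u (1 * v) - f u (0 * v))) {0..1}"
  proof (rule fundamental_theorem_of_calculus)
    fix s :: real
    have "((\<lambda>s. f u (s * v)) has_real_derivative pdv f u (s * v) * v) (at s)"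
      by (rule DERIV_chain2[OF bounded_smooth_deriv_v[OF f]]) (auto intro!: derivative_eq_intros)
    then show "((\<lambda>s. f u (s * v)) has_vector_derivative v * pdv f u (s * v)) (at s within {0..1})"
      by (simp add: has_real_derivative_iff_has_vector_derivative has_vector_derivative_at_within mult.commute)
  qed simp
  from integral_unique[OF this] show ?thesis
    by (simp add: hadamard_def)
qed

lemma pdv_parity:
  assumes f: "bounded_smooth f" and par: "\<And>u v. f u (- v) = c * f u v"
  shows "pdv f u (- v) = - c * pdv f u v"
proof -
  have "((\<lambda>v. f u (- v)) has_real_derivative pdv f u (- v) * (- 1)) (at v)"
    by (rule DERIV_chain2[OF bounded_smooth_deriv_v[OF f]]) (auto intro!: derivative_eq_intros)
  then have "((\<lambda>v. c * f u v) has_real_derivative pdv f u (- v) * (- 1)) (at v)"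
    unfolding par .
  from DERIV_unique[OF this DERIV_cmult[OF bounded_smooth_deriv_v[OF f]]] show ?thesis by simp
qed

definition even2 :: "(real \<Rightarrow> real \<Rightarrow> real) \<Rightarrow> bool" where
  "even2 f \<longleftrightarrow> (\<forall>u v. f u (- v) = f u v)"

lemma even2D: "even2 f \<Longrightarrow> f u (- v) = f u v"
  unfolding even2_def by simp

lemma even2_abs: "even2 f \<Longrightarrow> f u \<bar>v\<bar> = f u v"
  using even2D[of f u v] by (cases "v \<ge> 0") simp_all

lemma even2_hadamard: "even2 f \<Longrightarrow> even2 (hadamard p f)"
  unfolding even2_def hadamard_def by simp

lemma even2_pdu: "even2 f \<Longrightarrow> even2 (pdu f)"
  unfolding even2_def pdu_def by simp

lemma even2_pdv_odd: "bounded_smooth f \<Longrightarrow> even2 f \<Longrightarrow> pdv f u (- v) = - pdv f u v"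
  using pdv_parity[of f 1 u v] by (simp add: even2D)

lemma even2_pdv_zero: "bounded_smooth f \<Longrightarrow> even2 f \<Longrightarrow> pdv f u 0 = 0"
  using even2_pdv_odd[of f u 0] by simp

lemma even2_pdv_pdv: "bounded_smooth f \<Longrightarrow> even2 f \<Longrightarrow> even2 (pdv (pdv f))"
  unfolding even2_def[of "pdv (pdv f)"]
  using pdv_parity[OF bounded_smooth_pdv, of f "- 1"] even2_pdv_odd[of f] by simp

text \<open>For even \<open>f\<close> this is \<open>pdv f u v / (2 * v)\<close>, continued smoothly
  over v = 0. Its value at \<open>sqrt w\<close> is the w-derivative of
  \<open>f u (sqrt w)\<close>.\<close>

definition half_quotient :: "(real \<Rightarrow> real \<Rightarrow> real) \<Rightarrow> real \<Rightarrow> real \<Rightarrow> real" where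
  "half_quotient f u v = (1 / 2) * hadamard 0 (pdv (pdv f)) u v"

lemma half_quotient:
  assumes f: "bounded_smooth f" "even2 f"
  shows bounded_smooth_half_quotient: "bounded_smooth (half_quotient f)"
    and even2_half_quotient: "even2 (half_quotient f)"
    and pdv_half_quotient: "pdv f u v = 2 * v * half_quotient f u v"
proof -
  note g = bounded_smooth_pdv[OF bounded_smooth_pdv[OF f(1)]]
  show "bounded_smooth (half_quotient f)"
    \<comment> \<open>Multiplication by 1/2 is a linear combination whose second coefficient is
      0.\<close>
    using bounded_smooth_lincomb[OF bounded_smooth_hadamard[OF g, of 0] bounded_smooth_hadamard[OF g, of 0], of "1 / 2" 0]
    by (simp add: half_quotient_def[abs_def])
  show "even2 (half_quotient f)"
    using even2_hadamard[OF even2_pdv_pdv[OF f], of 0] by (simp add: even2_def half_quotient_def)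
  show "pdv f u v = 2 * v * half_quotient f u v"
    using hadamard_division[OF bounded_smooth_pdv[OF f(1)], of u v] even2_pdv_zero[OF f, of u]
    by (simp add: half_quotient_def)
qed

text \<open>When \<open>pdv f u 0 = 0\<close> this is \<open>(f u v - f u 0) / v ^ 2\<close>,
  continued over v = 0. The inner index 1 arises from differentiating the first quotient
  \<open>hadamard 0 (pdv f)\<close>.\<close>

definition second_quotient :: "(real \<Rightarrow> real \<Rightarrow> real) \<Rightarrow> real \<Rightarrow> real \<Rightarrow> real" where
  "second_quotient f = hadamard 0 (hadamard 1 (pdv (pdv f)))"

lemma second_quotient:
  assumes f: "bounded_smooth f" and z: "\<And>u. pdv f u 0 = 0"
  shows bounded_smooth_second_quotient: "bounded_smooth (second_quotient f)"
    and second_quotient_division: "f u v = f u 0 + v ^ 2 * second_quotient f u v"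
    and second_quotient_zero: "second_quotient f u 0 = pdv (pdv f) u 0 / 2"
    and pdv_second_quotient_zero: "pdv (second_quotient f) u 0 = pdv (pdv (pdv f)) u 0 / 6"
proof -
  note f1 = bounded_smooth_pdv[OF f] 
  note f2 = bounded_smooth_pdv[OF f1]
  show "bounded_smooth (second_quotient f)"
    unfolding second_quotient_def by (intro bounded_smooth_hadamard f2)
  have "hadamard 0 (pdv f) u v = v * second_quotient f u v"
    using hadamard_division[OF bounded_smooth_hadamard[OF f1], of 0 u v] z
    by (simp add: hadamard_at_zero pdv_hadamard[OF f1] second_quotient_def)
  then show "f u v = f u 0 + v ^ 2 * second_quotient f u v"
    using hadamard_division[OF f, of u v] by (simp add: power2_eq_square)
  show "second_quotient f u 0 = pdv (pdv f) u 0 / 2"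
    by (simp add: second_quotient_def hadamard_at_zero)
  show "pdv (second_quotient f) u 0 = pdv (pdv (pdv f)) u 0 / 6"
    by (simp add: second_quotient_def hadamard_at_zero pdv_hadamard bounded_smooth_hadamard f2)
qed

section \<open>Seeley's extension and its derivatives\<close>

definition reflected_series :: "(nat \<Rightarrow> real) \<Rightarrow> (real \<Rightarrow> real \<Rightarrow> real) \<Rightarrow> real \<Rightarrow> real \<Rightarrow> real" where
  "reflected_series a f u w = (\<Sum>k. a k * f u (sqrt (2 ^ k * (- w))))"

text \<open>The function \<open>w \<mapsto> f u (sqrt w)\<close>, extended to \<open>w < 0\<close> by Seeley's reflection, whose weights match
  all derivatives at \<open>w = 0\<close>.\<close>

definition seeley :: "(nat \<Rightarrow> real) \<Rightarrow> (real \<Rightarrow> real \<Rightarrow> real) \<Rightarrow> real \<Rightarrow> real \<Rightarrow> real" where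
  "seeley a f u w = (if w \<le> 0 then reflected_series a f u w else f u (sqrt w))"

lemma reflection_weights_summable:
  "reflection_weights a \<Longrightarrow> summable (\<lambda>k. \<bar>a k\<bar> * B)"
proof -
  assume "reflection_weights a"
  then have "summable (\<lambda>k. \<bar>a k\<bar> * (2 ^ k) ^ 0)" unfolding reflection_weights_def by (elim conjE allE)
  then show "summable (\<lambda>k. \<bar>a k\<bar> * B)" by (intro summable_mult2) simp
qed

lemma reflected_series_summable:
  assumes a: "reflection_weights a" and B: "\<And>k. \<bar>x k\<bar> \<le> B"
  shows "summable (\<lambda>k. a k * x k)"
  by (rule summable_comparison_test'[OF reflection_weights_summable[OF a, of B], of 0])
     (simp add: abs_mult mult_left_mono B)

lemma reflected_series_zero:
  assumes "reflection_weights a"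
  shows "reflected_series a f u 0 = f u 0"
proof -
  have "(\<lambda>k. a k * (- (2 ^ k)) ^ 0) sums 1"
    using assms unfolding reflection_weights_def by (elim conjE allE)
  from sums_mult2[OF this, of "f u 0"] have "(\<lambda>k. a k * f u 0) sums f u 0" by simp
  then show ?thesis by (simp add: reflected_series_def sums_unique[symmetric])
qed

lemma seeley_nonneg: "reflection_weights a \<Longrightarrow> w \<ge> 0 \<Longrightarrow> seeley a f u w = f u (sqrt w)"
  by (cases "w = 0") (simp_all add: seeley_def reflected_series_zero)

lemma continuous_seeley:
  assumes a: "reflection_weights a" and f: "bounded_smooth f"
  shows "continuous_on UNIV (\<lambda>z. seeley a f (fst z) (snd z))"
proof -
  have comp: "continuous_on A (\<lambda>z. f (fst z) (h z))" if "continuous_on A h" for h and A :: "(real \<times> real) set"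
  proof -
    have "continuous_on A (\<lambda>z. (\<lambda>w. f (fst w) (snd w)) (fst z, h z))"
      by (rule continuous_on_compose2[OF bounded_smooth_continuous[OF f]])
         (auto intro!: continuous_on_Pair continuous_on_fst continuous_on_id that)
    then show ?thesis by simp
  qed
  obtain B where B: "\<And>u v. \<bar>f u v\<bar> \<le> B" using bounded_smooth_bounded[OF f] by blast
  let ?g = "\<lambda>k z. a k * f (fst z) (sqrt (2 ^ k * (- snd z)))"
  have gc: "continuous_on UNIV (?g k)" for k
    by (rule continuous_on_mult_left, rule comp) (intro continuous_intros)
  \<comment> \<open>The global bound \<open>B\<close> makes the majorant independent of the point,
    although the arguments of \<open>f\<close> are unbounded in k.\<close>
  have "uniform_limit UNIV (\<lambda>n z. \<Sum>k<n. ?g k z) (\<lambda>z. \<Sum>k. ?g k z) sequentially"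
    by (rule Weierstrass_m_test[where M = "\<lambda>k. \<bar>a k\<bar> * B"])
       (auto simp: abs_mult intro!: mult_left_mono B reflection_weights_summable[OF a])
  then have "continuous_on UNIV (\<lambda>z. \<Sum>k. ?g k z)"
    by (rule uniform_limit_theorem[rotated])
       (simp, intro always_eventually allI continuous_on_sum gc)
  then have s: "continuous_on UNIV (\<lambda>z. reflected_series a f (fst z) (snd z))"
    by (simp add: reflected_series_def)
  show ?thesis
    unfolding seeley_def
  proof (rule continuous_on_cases_le)
    show "continuous_on {t \<in> UNIV. snd t \<le> 0} (\<lambda>z. reflected_series a f (fst z) (snd z))"
      by (rule continuous_on_subset[OF s]) simp
    show "continuous_on {t \<in> UNIV. 0 \<le> snd t} (\<lambda>z. f (fst z) (sqrt (snd z)))"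
      by (rule comp) (intro continuous_intros)
    show "continuous_on UNIV (\<lambda>z :: real \<times> real. snd z)" by (intro continuous_intros)
    show "reflected_series a f (fst t) (snd t) = f (fst t) (sqrt (snd t))" if "snd t = 0" for t
      using that by (simp add: reflected_series_zero[OF a])
  qed
qed

lemma seeley_bounded:
  assumes a: "reflection_weights a" and f: "bounded_smooth f"
  shows "\<exists>B. \<forall>u w. \<bar>seeley a f u w\<bar> \<le> B"
proof -
  obtain B where B: "\<And>u v. \<bar>f u v\<bar> \<le> B" using bounded_smooth_bounded[OF f] by blast
  have "\<bar>seeley a f u w\<bar> \<le> max B (\<Sum>k. \<bar>a k\<bar> * B)" for u w
  proof -
    have sm: "summable (\<lambda>k. \<bar>a k * f u (sqrt (2 ^ k * (- w)))\<bar>)"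
      by (rule summable_comparison_test'[OF reflection_weights_summable[OF a, of B], of 0])
         (simp add: abs_mult mult_left_mono B)
    have "\<bar>reflected_series a f u w\<bar> \<le> (\<Sum>k. \<bar>a k * f u (sqrt (2 ^ k * (- w)))\<bar>)"
      unfolding reflected_series_def by (rule summable_rabs[OF sm])
    also have "\<dots> \<le> (\<Sum>k. \<bar>a k\<bar> * B)"
      by (rule suminf_le[OF _ sm reflection_weights_summable[OF a]]) (simp add: abs_mult mult_left_mono B)
    finally have "\<bar>reflected_series a f u w\<bar> \<le> (\<Sum>k. \<bar>a k\<bar> * B)" .
    then show ?thesis using B[of u "sqrt w"] unfolding seeley_def
      by (auto simp: le_max_iff_disj)
  qed
  then show ?thesis by blast
qed

lemma seeley_deriv_u:
  assumes a: "reflection_weights a" and f: "bounded_smooth f"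
  shows "((\<lambda>u. seeley a f u w) has_real_derivative seeley a (pdu f) u w) (at u)"
proof (cases "w \<le> 0")
  case True
  obtain B where B: "\<And>u v. \<bar>f u v\<bar> \<le> B" using bounded_smooth_bounded[OF f] by blast
  obtain C where C: "\<And>u v. \<bar>pdu f u v\<bar> \<le> C"
    using bounded_smooth_bounded[OF bounded_smooth_pdu[OF f]] by blast
  have "((\<lambda>u. \<Sum>k. a k * f u (sqrt (2 ^ k * (- w)))) has_field_derivative
      (\<Sum>k. a k * pdu f u (sqrt (2 ^ k * (- w))))) (at u)"
  proof (rule has_field_derivative_series'(2)[where S = UNIV and x0 = u])
    show "((\<lambda>u. a k * f u (sqrt (2 ^ k * (- w)))) has_field_derivative a k * pdu f u (sqrt (2 ^ k * (- w)))) (at u within UNIV)" for k u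
      by (intro DERIV_cmult bounded_smooth_deriv_u[OF f])
    show "uniformly_convergent_on UNIV (\<lambda>n u. \<Sum>k<n. a k * pdu f u (sqrt (2 ^ k * (- w))))"
      by (rule Weierstrass_m_test'[where M = "\<lambda>k. \<bar>a k\<bar> * C"])
         (auto simp: abs_mult intro!: mult_left_mono C reflection_weights_summable[OF a])
    show "summable (\<lambda>k. a k * f u (sqrt (2 ^ k * (- w))))"
      by (rule reflected_series_summable[OF a B])
  qed auto
  then show ?thesis using True by (simp add: seeley_def reflected_series_def)
next
  case False
  then show ?thesis using bounded_smooth_deriv_u[OF f] by (simp add: seeley_def)
qed

text \<open>The difference quotient in w at 0 is again a Seeley extension, hence continuous. This
  gives the derivative at the seam w = 0 without any exchange of limits.\<close>

lemma seeley_division: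
  assumes a: "reflection_weights a" and f: "bounded_smooth f" "even2 f"
  shows "seeley a f u w = f u 0 + w * seeley (\<lambda>k. - (2 ^ k) * a k) (second_quotient f) u w"
proof -
  note z = even2_pdv_zero[OF f]
  note div = second_quotient_division[OF f(1) z]
  note q = bounded_smooth_second_quotient[OF f(1) z]
  note a' = reflection_weights_shift[OF a]
  show ?thesis
  proof (cases "w \<ge> 0")
    case True
    then show ?thesis
      unfolding seeley_nonneg[OF a True] seeley_nonneg[OF a' True]
      using div[of u "sqrt w"] by simp
  next
    case False
    obtain B where B: "\<And>u v. \<bar>second_quotient f u v\<bar> \<le> B" using bounded_smooth_bounded[OF q] by blast
    let ?v = "\<lambda>k. sqrt (2 ^ k * (- w))"
    have v: "?v k ^ 2 = 2 ^ k * (- w)" for k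
      using False by (intro real_sqrt_pow2) (simp add: mult_nonneg_nonpos)
    have "(\<lambda>k. a k * (- (2 ^ k)) ^ 0) sums 1"
      using a unfolding reflection_weights_def by (elim conjE allE)
    from sums_mult2[OF this, of "f u 0"] have s0: "(\<lambda>k. a k * f u 0) sums f u 0" by simp
    have "(\<lambda>k. (- (2 ^ k) * a k) * second_quotient f u (?v k)) sums
        (\<Sum>k. (- (2 ^ k) * a k) * second_quotient f u (?v k))"
      by (rule summable_sums, rule reflected_series_summable[OF a' B])
    from sums_add[OF s0 sums_mult[OF this, of w]]
    have "(\<lambda>k. a k * f u 0 + w * ((- (2 ^ k) * a k) * second_quotient f u (?v k))) sums
        (f u 0 + w * (\<Sum>k. (- (2 ^ k) * a k) * second_quotient f u (?v k)))" .
    moreover have "a k * f u 0 + w * ((- (2 ^ k) * a k) * second_quotient f u (?v k)) = a k * f u (?v k)" for k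
      unfolding div[of u "?v k"] v by (simp add: algebra_simps)
    ultimately have "(\<lambda>k. a k * f u (?v k)) sums
        (f u 0 + w * (\<Sum>k. (- (2 ^ k) * a k) * second_quotient f u (?v k)))" by (simp only:)
    from sums_unique[OF this] show ?thesis using False by (simp add: seeley_def reflected_series_def)
  qed
qed

lemma seeley_deriv_w:
  assumes a: "reflection_weights a" and f: "bounded_smooth f" "even2 f"
  shows "(seeley a f u has_real_derivative seeley (\<lambda>k. - (2 ^ k) * a k) (half_quotient f) u w) (at w)"
proof -
  note a' = reflection_weights_shift[OF a]
  note h = bounded_smooth_half_quotient[OF f]
  have root: "((\<lambda>x. f u (sqrt (c * x))) has_real_derivative c * half_quotient f u (sqrt (c * x))) (at x)"
    if "c * x > 0" for c x
  proof -
    have "((\<lambda>x. sqrt (c * x)) has_real_derivative c * (inverse (sqrt (c * x)) / 2)) (at x)"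
      using that by (auto intro!: derivative_eq_intros)
    from DERIV_chain2[OF bounded_smooth_deriv_v[OF f(1)] this]
    have "((\<lambda>x. f u (sqrt (c * x))) has_real_derivative
       pdv f u (sqrt (c * x)) * (c * (inverse (sqrt (c * x)) / 2))) (at x)" .
    moreover have "sqrt (c * x) \<noteq> 0"
      by (rule less_imp_neq[OF real_sqrt_gt_zero[OF that], symmetric])
    then have "pdv f u (sqrt (c * x)) * (c * (inverse (sqrt (c * x)) / 2)) = c * half_quotient f u (sqrt (c * x))"
      unfolding pdv_half_quotient[OF f, of u "sqrt (c * x)"] by (simp add: field_simps)
    ultimately show ?thesis by (simp only:)
  qed
  consider "w > 0" | "w < 0" | "w = 0" by linarith
  then show ?thesis
  proof cases
    case 1
    have "((\<lambda>x. f u (sqrt (1 * x))) has_real_derivative 1 * half_quotient f u (sqrt (1 * w))) (at w)"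
      by (rule root) (use 1 in simp)
    then have "((\<lambda>x. f u (sqrt x)) has_real_derivative seeley (\<lambda>k. - (2 ^ k) * a k) (half_quotient f) u w) (at w)"
      using 1 by (simp add: seeley_def)
    then show ?thesis
      by (rule has_field_derivative_transform_within_open[where S = "{0<..}"])
         (use 1 in \<open>auto simp: seeley_def\<close>)
  next
    case 2
    obtain B where B: "\<And>u v. \<bar>f u v\<bar> \<le> B" using bounded_smooth_bounded[OF f(1)] by blast
    obtain C where C: "\<And>u v. \<bar>half_quotient f u v\<bar> \<le> C" using bounded_smooth_bounded[OF h] by blast
    have "((\<lambda>x. \<Sum>k. a k * f u (sqrt (2 ^ k * (- x)))) has_field_derivative
      (\<Sum>k. - (2 ^ k) * a k * half_quotient f u (sqrt (2 ^ k * (- w))))) (at w)"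
    proof (rule has_field_derivative_series'(2)[where S = "{..<0}" and x0 = w])
      fix k :: nat and x :: real assume "x \<in> {..<0}"
      then have "- (2 ^ k) * x > 0" by (simp add: mult_pos_neg)
      from DERIV_cmult[OF root[OF this], of "a k"]
      show "((\<lambda>x. a k * f u (sqrt (2 ^ k * (- x)))) has_field_derivative
          - (2 ^ k) * a k * half_quotient f u (sqrt (2 ^ k * (- x)))) (at x within {..<0})"
        by (simp add: has_field_derivative_at_within mult_ac)
    next
      show "uniformly_convergent_on {..<0} (\<lambda>n x. \<Sum>k<n. - (2 ^ k) * a k * half_quotient f u (sqrt (2 ^ k * (- x))))"
      proof (rule Weierstrass_m_test'[OF _ reflection_weights_summable[OF a', of C]])
        show "norm (- (2 ^ k) * a k * half_quotient f u (sqrt (2 ^ k * - x))) \<le> \<bar>- (2 ^ k) * a k\<bar> * C" for k x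
          unfolding real_norm_def abs_mult[of "- (2 ^ k) * a k"] by (intro mult_left_mono C abs_ge_zero)
      qed
      show "summable (\<lambda>k. a k * f u (sqrt (2 ^ k * (- w))))"
        by (rule reflected_series_summable[OF a B])
    qed (use 2 in \<open>auto simp: interior_open\<close>)
    then have "((\<lambda>x. \<Sum>k. a k * f u (sqrt (2 ^ k * (- x)))) has_real_derivative
       seeley (\<lambda>k. - (2 ^ k) * a k) (half_quotient f) u w) (at w)"
      using 2 by (simp add: seeley_def reflected_series_def)
    then show ?thesis
      by (rule has_field_derivative_transform_within_open[where S = "{..<0}"])
         (use 2 in \<open>auto simp: seeley_def reflected_series_def\<close>)
  next
    case 3
    \<comment> \<open>At the seam the division formula takes over: the factor w vanishes, so
      continuity of the quotient \<open>?g\<close> suffices. Its value there is half of the second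
      v-derivative, as is that of \<open>half_quotient f\<close>.\<close>
    note z = even2_pdv_zero[OF f]
    let ?g = "\<lambda>w. seeley (\<lambda>k. - (2 ^ k) * a k) (second_quotient f) u w"
    have "continuous_on UNIV (\<lambda>w. (\<lambda>z. seeley (\<lambda>k. - (2 ^ k) * a k) (second_quotient f) (fst z) (snd z)) (u, w))"
      by (rule continuous_on_compose2[OF continuous_seeley[OF a' bounded_smooth_second_quotient[OF f(1) z]]])
         (auto intro!: continuous_intros)
    then have "isCont ?g 0" by (simp add: continuous_on_eq_continuous_at)
    from has_derivative_scaleR_vanishing[OF has_derivative_ident refl this]
    have "((\<lambda>w. w * ?g w) has_derivative (\<lambda>k. k * ?g 0)) (at 0)" by simp
    from has_derivative_add[OF has_derivative_const[of "f u 0"] this]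
    have "((\<lambda>w. f u 0 + w * ?g w) has_derivative (\<lambda>k. k * ?g 0)) (at 0)" by simp
    moreover have "seeley a f u = (\<lambda>w. f u 0 + w * ?g w)"
      by (rule ext, rule seeley_division[OF a f])
    moreover have "?g 0 = seeley (\<lambda>k. - (2 ^ k) * a k) (half_quotient f) u 0"
      unfolding seeley_nonneg[OF a' order_refl]
      by (simp add: second_quotient_zero[OF f(1) z] half_quotient_def hadamard_at_zero)
    ultimately show ?thesis unfolding 3 has_field_derivative_def by (simp add: mult_commute_abs)
  qed
qed

text \<open>Extensions are closed under both partial derivatives provided that weights and function
  may vary: d/du replaces \<open>f\<close> by \<open>pdu f\<close>, while d/dw shifts the weights
  and replaces \<open>f\<close> by \<open>half_quotient f\<close>.\<close>

lemma bounded_smooth_seeley: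
  assumes "reflection_weights a" "bounded_smooth f" "even2 f"
  shows "bounded_smooth (seeley a f)"
proof -
  let ?P = "\<lambda>h :: real \<Rightarrow> real \<Rightarrow> real. \<exists>a f. reflection_weights a \<and> bounded_smooth f \<and> even2 f \<and> h = seeley a f"
  have PI: "?P (seeley a f)" if "reflection_weights a" "bounded_smooth f" "even2 f" for a f
    by (rule exI[of _ a], rule exI[of _ f]) (simp add: that)
  show ?thesis
  proof (rule bounded_smooth_family[where P = ?P, OF PI[OF assms]])
    fix h assume "?P h"
    then obtain a f where a: "reflection_weights a" and f: "bounded_smooth f" "even2 f" and h: "h = seeley a f"
      by (elim exE conjE)
    obtain B where B: "\<forall>u w. \<bar>seeley a f u w\<bar> \<le> B" using seeley_bounded[OF a f(1)] by (elim exE)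
    show "bounded_step ?P h"
      unfolding h
    proof (rule bounded_stepI[where P = ?P and B = B and fu = "seeley a (pdu f)"
          and fv = "seeley (\<lambda>k. - (2 ^ k) * a k) (half_quotient f)"])
      show "?P (seeley a (pdu f))"
        by (rule PI[OF a bounded_smooth_pdu[OF f(1)] even2_pdu[OF f(2)]])
      show "?P (seeley (\<lambda>k. - (2 ^ k) * a k) (half_quotient f))"
        by (rule PI[OF reflection_weights_shift[OF a] bounded_smooth_half_quotient[OF f] even2_half_quotient[OF f]])
      show "continuous_on UNIV (\<lambda>z. seeley a f (fst z) (snd z))"
        by (rule continuous_seeley[OF a f(1)])
      show "\<bar>seeley a f u v\<bar> \<le> B" for u v using B by simp
      show "((\<lambda>u. seeley a f u v) has_real_derivative seeley a (pdu f) u v) (at u)" for u v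
        by (rule seeley_deriv_u[OF a f(1)])
      show "(seeley a f u has_real_derivative seeley (\<lambda>k. - (2 ^ k) * a k) (half_quotient f) u v) (at v)" for u v
        by (rule seeley_deriv_w[OF a f])
    qed
  qed
qed

section \<open>Even functions and the decomposition at a cusp\<close>

theorem whitney_even:
  assumes f: "bounded_smooth f" "even2 f"
  obtains E where "bounded_smooth E" "\<And>u v. f u v = E u (v ^ 2)"
proof -
  obtain a where a: "reflection_weights a" using reflection_weights_exist by blast
  have "f u v = seeley a f u (v ^ 2)" for u v
    using even2_abs[OF f(2), of u v] by (simp add: seeley_nonneg[OF a])
  with bounded_smooth_seeley[OF a f] show ?thesis by (rule that)
qed

text \<open>Dividing by \<open>v ^ 2\<close> first leaves a smooth quotient. Its even part
  \<open>e\<close> is a function of \<open>v ^ 2\<close>, and its odd part \<open>d\<close> is v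
  times an even function; Whitney's theorem applies to both.\<close>

theorem whitney_cusp_decomposition:
  assumes f: "bounded_smooth f" and z: "\<And>u. pdv f u 0 = 0"
  obtains E H where "bounded_smooth E" "bounded_smooth H"
    "\<And>u v. f u v = f u 0 + v ^ 2 * E u (v ^ 2) + v ^ 3 * H u (v ^ 2)"
    "\<And>u. E u 0 = pdv (pdv f) u 0 / 2" "\<And>u. H u 0 = pdv (pdv (pdv f)) u 0 / 6"
proof -
  let ?q = "second_quotient f"
  note q = bounded_smooth_second_quotient[OF f z]
  note r = bounded_smooth_reflect[OF q]
  define e where "e = (\<lambda>u v. (1 / 2) * ?q u v + (1 / 2) * ?q u (- v))"
  define d where "d = (\<lambda>u v. (1 / 2) * ?q u v + (- 1 / 2) * ?q u (- v))"
  have e: "bounded_smooth e" "even2 e"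
    unfolding e_def by (rule bounded_smooth_lincomb[OF q r]) (simp add: even2_def)
  have d: "bounded_smooth d"
    unfolding d_def by (rule bounded_smooth_lincomb[OF q r])
  have dodd: "d u (- v) = - 1 * d u v" for u v by (simp add: d_def)
  have d0: "d u 0 = 0" for u by (simp add: d_def)
  have ho: "bounded_smooth (hadamard 0 (pdv d))"
    by (rule bounded_smooth_hadamard[OF bounded_smooth_pdv[OF d]])
  have pe: "even2 (pdv d)"
    unfolding even2_def using pdv_parity[OF d dodd] by simp
  obtain E where E: "bounded_smooth E" "\<And>u v. e u v = E u (v ^ 2)" using whitney_even[OF e] by blast
  obtain H where H: "bounded_smooth H" "\<And>u v. hadamard 0 (pdv d) u v = H u (v ^ 2)"
    using whitney_even[OF ho even2_hadamard[OF pe]] by blast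
  show ?thesis
  proof (rule that[OF E(1) H(1)])
    show "f u v = f u 0 + v ^ 2 * E u (v ^ 2) + v ^ 3 * H u (v ^ 2)" for u v
    proof -
      have "d u v = v * H u (v ^ 2)"
        using hadamard_division[OF d, of u v] by (simp add: d0 H(2))
      moreover have "?q u v = e u v + d u v" by (simp add: e_def d_def)
      ultimately have "?q u v = E u (v ^ 2) + v * H u (v ^ 2)" by (simp add: E(2))
      moreover have "f u v = f u 0 + v ^ 2 * ?q u v" by (rule second_quotient_division[OF f z])
      ultimately show ?thesis by (simp add: power2_eq_square power3_eq_cube algebra_simps)
    qed
    show "E u 0 = pdv (pdv f) u 0 / 2" for u
      using E(2)[of u 0] second_quotient_zero[OF f z, of u] by (simp add: e_def)
    show "H u 0 = pdv (pdv (pdv f)) u 0 / 6" for u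
    proof -
      have "((\<lambda>v. ?q u (- v)) has_real_derivative pdv ?q u (- 0) * (- 1)) (at 0)"
        by (rule DERIV_chain2[OF bounded_smooth_deriv_v[OF q]]) (auto intro!: derivative_eq_intros)
      then have "((\<lambda>v. (1 / 2) * ?q u v + (- 1 / 2) * ?q u (- v)) has_real_derivative
          (1 / 2) * pdv ?q u 0 + (- 1 / 2) * (pdv ?q u (- 0) * (- 1))) (at 0)"
        by (intro DERIV_add DERIV_cmult bounded_smooth_deriv_v[OF q])
      then have "(d u has_real_derivative pdv ?q u 0) (at 0)" by (simp add: d_def)
      from DERIV_unique[OF bounded_smooth_deriv_v[OF d] this]
      have "pdv d u 0 = pdv (pdv (pdv f)) u 0 / 6"
        by (simp add: pdv_second_quotient_zero[OF f z])
      then show ?thesis using H(2)[of u 0] by (simp add: hadamard_at_zero)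
    qed
  qed
qed

section \<open>Recognition of cuspidal edges\<close>

lemma has_vector_derivative_inner:
  "(f has_vector_derivative f') F \<Longrightarrow> ((\<lambda>x. f x \<bullet> b) has_real_derivative f' \<bullet> b) F"
  unfolding has_real_derivative_iff_has_vector_derivative
  by (rule bounded_linear.has_vector_derivative[OF bounded_linear_inner_left])

lemma has_derivative_scaleR_zero:
  fixes q :: "'a::real_normed_vector \<Rightarrow> real" and p :: "'a \<Rightarrow> 'b::real_normed_vector"
  assumes "bounded_linear q" "isCont p 0"
  shows "((\<lambda>y. q y *\<^sub>R p y) has_derivative (\<lambda>h. q h *\<^sub>R p 0)) (at 0)"
  by (rule has_derivative_scaleR_vanishing[OF bounded_linear_imp_has_derivative[OF assms(1)] _ assms(2)])
     (rule linear_0[OF bounded_linear.linear[OF assms(1)]])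

text \<open>The periods place every component of \<open>G\<close> in \<open>bounded_smooth\<close>.
  The differential of the target map at 0 has the columns \<open>q1\<close>, half of
  \<open>p2 0\<close> and a sixth of \<open>p3\<close>, so \<open>indep\<close> is precisely its
  injectivity. \<open>p1\<close>, \<open>p2\<close>, \<open>p3\<close> are the derivatives along the
  kernel line u = 0.\<close>

theorem cuspidal_edge_criterion:
  fixes g :: "real \<times> real \<Rightarrow> real \<times> real \<times> real" and h :: "real \<times> real \<Rightarrow> real \<times> real"
  defines "G \<equiv> \<lambda>x. g (h x)"
  assumes h: "smooth_on UNIV h" "(h has_derivative h') (at 0)" "inj h'"
    and G: "smooth_on UNIV G" "p > 0" "\<And>u v. G (u + p, v) = G (u, v)" "\<And>u v. G (u, v + p) = G (u, v)"
    and sing: "\<And>u. ((\<lambda>v. G (u, v)) has_vector_derivative 0) (at 0)"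
    and p1: "\<And>v. ((\<lambda>v. G (0, v)) has_vector_derivative p1 v) (at v)"
    and p2: "\<And>v. (p1 has_vector_derivative p2 v) (at v)"
    and p3: "(p2 has_vector_derivative p3) (at 0)"
    and q1: "((\<lambda>u. G (u, 0)) has_vector_derivative q1) (at 0)"
    and indep: "\<And>a b c. a *\<^sub>R q1 + b *\<^sub>R p2 0 + c *\<^sub>R p3 = 0 \<Longrightarrow> a = 0 \<and> b = 0 \<and> c = 0"
  shows "A_equiv_at g (h 0) cuspidal_edge 0"
proof -
  let ?f = "\<lambda>b u v. G (u, v) \<bullet> b"
  have bs: "bounded_smooth (?f b)" for b
  proof (rule periodic_bounded_smooth[where p = p and F = "\<lambda>z. G z \<bullet> b"])
    show "smooth_on UNIV (\<lambda>z. G z \<bullet> b)"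
      by (rule smooth_on_linear_compose[OF bounded_linear_inner_left open_UNIV G(1)])
  qed (simp_all only: G(2,3,4))
  have d1: "pdv (?f b) 0 = (\<lambda>v. p1 v \<bullet> b)" for b
  proof (rule ext)
    fix v
    show "pdv (?f b) 0 v = p1 v \<bullet> b"
      by (rule DERIV_unique[OF bounded_smooth_deriv_v[OF bs[of b], of 0 v] has_vector_derivative_inner[OF p1[of v], of b]])
  qed
  have d2: "pdv (pdv (?f b)) 0 = (\<lambda>v. p2 v \<bullet> b)" for b
  proof (rule ext)
    fix v
    have "((\<lambda>v. p1 v \<bullet> b) has_real_derivative pdv (pdv (?f b)) 0 v) (at v)"
      using bounded_smooth_deriv_v[OF bounded_smooth_pdv[OF bs[of b]], of 0 v] unfolding d1 .
    then show "pdv (pdv (?f b)) 0 v = p2 v \<bullet> b"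
      by (rule DERIV_unique[OF _ has_vector_derivative_inner[OF p2[of v], of b]])
  qed
  have d3: "pdv (pdv (pdv (?f b))) 0 0 = p3 \<bullet> b" for b
  proof -
    have "((\<lambda>v. p2 v \<bullet> b) has_real_derivative pdv (pdv (pdv (?f b))) 0 0) (at 0)"
      using bounded_smooth_deriv_v[OF bounded_smooth_pdv[OF bounded_smooth_pdv[OF bs[of b]]], of 0 0]
      unfolding d2 .
    then show ?thesis by (rule DERIV_unique[OF _ has_vector_derivative_inner[OF p3, of b]])
  qed
  have z: "pdv (?f b) u 0 = 0" for b u
  proof -
    have "((\<lambda>v. ?f b u v) has_real_derivative 0 \<bullet> b) (at 0)"
      by (rule has_vector_derivative_inner[OF sing])
    from DERIV_unique[OF bounded_smooth_deriv_v[OF bs[of b], of u 0] this] show ?thesis by simp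
  qed
  have "\<forall>b. \<exists>EH. bounded_smooth (fst EH) \<and> bounded_smooth (snd EH) \<and>
      (\<forall>u v. ?f b u v = ?f b u 0 + v ^ 2 * fst EH u (v ^ 2) + v ^ 3 * snd EH u (v ^ 2)) \<and>
      fst EH 0 0 = p2 0 \<bullet> b / 2 \<and> snd EH 0 0 = p3 \<bullet> b / 6"
  proof
    fix b
    obtain E H where EH: "bounded_smooth E" "bounded_smooth H"
      "\<And>u v. ?f b u v = ?f b u 0 + v ^ 2 * E u (v ^ 2) + v ^ 3 * H u (v ^ 2)"
      "\<And>u. E u 0 = pdv (pdv (?f b)) u 0 / 2" "\<And>u. H u 0 = pdv (pdv (pdv (?f b))) u 0 / 6"
      by (rule whitney_cusp_decomposition[OF bs[of b] z[of b]]) (rule that)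
    have "E 0 0 = p2 0 \<bullet> b / 2" "H 0 0 = p3 \<bullet> b / 6" by (simp_all only: EH(4,5) d2 d3)
    then show "\<exists>EH. bounded_smooth (fst EH) \<and> bounded_smooth (snd EH) \<and>
      (\<forall>u v. ?f b u v = ?f b u 0 + v ^ 2 * fst EH u (v ^ 2) + v ^ 3 * snd EH u (v ^ 2)) \<and>
      fst EH 0 0 = p2 0 \<bullet> b / 2 \<and> snd EH 0 0 = p3 \<bullet> b / 6"
      by (intro exI[of _ "(E, H)"], unfold fst_conv snd_conv, intro conjI allI) (rule EH(1,2,3) | assumption)+
  qed
  from choice[OF this] obtain EH where EH: "\<forall>b. bounded_smooth (fst (EH b)) \<and> bounded_smooth (snd (EH b)) \<and>
      (\<forall>u v. ?f b u v = ?f b u 0 + v ^ 2 * fst (EH b) u (v ^ 2) + v ^ 3 * snd (EH b) u (v ^ 2)) \<and>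
      fst (EH b) 0 0 = p2 0 \<bullet> b / 2 \<and> snd (EH b) 0 0 = p3 \<bullet> b / 6" by (elim exE)
  note EH1 = spec[OF EH, THEN conjunct1]
    and EH2 = spec[OF EH, THEN conjunct2, THEN conjunct1]
    and EH3 = spec[OF EH, THEN conjunct2, THEN conjunct2, THEN conjunct1, THEN spec, THEN spec]
    and EH4 = spec[OF EH, THEN conjunct2, THEN conjunct2, THEN conjunct2, THEN conjunct1]
    and EH5 = spec[OF EH, THEN conjunct2, THEN conjunct2, THEN conjunct2, THEN conjunct2]
  define E H where "E = (\<lambda>z. \<Sum>b\<in>Basis. fst (EH b) (fst z) (snd z) *\<^sub>R b)"
    and "H = (\<lambda>z. \<Sum>b\<in>Basis. snd (EH b) (fst z) (snd z) *\<^sub>R b)"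
  have sm: "smooth_on UNIV E" "smooth_on UNIV H"
    unfolding E_def H_def
    by (intro smooth_on_sum open_UNIV smooth_on_const
          smooth_on_scaleR[OF open_UNIV bounded_smooth_imp_smooth_on[OF EH1]]
          smooth_on_scaleR[OF open_UNIV bounded_smooth_imp_smooth_on[OF EH2]])+
  have E0: "E 0 = (1 / 2) *\<^sub>R p2 0"
  proof -
    have "E 0 = (\<Sum>b\<in>Basis. (((1 / 2) *\<^sub>R p2 0) \<bullet> b) *\<^sub>R b)" by (simp add: E_def EH4)
    then show ?thesis by (simp only: euclidean_representation)
  qed
  have H0: "H 0 = (1 / 6) *\<^sub>R p3"
  proof -
    have "H 0 = (\<Sum>b\<in>Basis. (((1 / 6) *\<^sub>R p3) \<bullet> b) *\<^sub>R b)" by (simp add: H_def EH5)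
    then show ?thesis by (simp only: euclidean_representation)
  qed
  have dec: "G (u, v) = G (u, 0) + v ^ 2 *\<^sub>R E (u, v ^ 2) + v ^ 3 *\<^sub>R H (u, v ^ 2)" for u v
  proof (rule euclidean_eqI)
    fix b :: "real \<times> real \<times> real" assume b: "b \<in> Basis"
    have "E (u, v ^ 2) \<bullet> b = fst (EH b) u (v ^ 2)" "H (u, v ^ 2) \<bullet> b = snd (EH b) u (v ^ 2)"
      using b by (simp_all add: E_def H_def inner_sum_left_Basis)
    moreover have "G (u, v) \<bullet> b = G (u, 0) \<bullet> b + v ^ 2 * fst (EH b) u (v ^ 2) + v ^ 3 * snd (EH b) u (v ^ 2)"
      by (rule EH3)
    ultimately show "G (u, v) \<bullet> b = (G (u, 0) + v ^ 2 *\<^sub>R E (u, v ^ 2) + v ^ 3 *\<^sub>R H (u, v ^ 2)) \<bullet> b"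
      by (simp add: inner_add_left)
  qed
  define \<Psi> where "\<Psi> = (\<lambda>z :: real \<times> real \<times> real. G (fst z, 0) + fst (snd z) *\<^sub>R E (fst z, fst (snd z))
      + snd (snd z) *\<^sub>R H (fst z, fst (snd z)))"
  have lin: "smooth_on UNIV (\<lambda>z :: real \<times> real \<times> real. fst z)" "smooth_on UNIV (\<lambda>z :: real \<times> real \<times> real. fst (snd z))"
    "smooth_on UNIV (\<lambda>z :: real \<times> real \<times> real. snd (snd z))"
    by (intro smooth_on_fst smooth_on_snd smooth_on_id open_UNIV)+
  have sc: "smooth_on UNIV (\<lambda>z. F (c z))" if "smooth_on UNIV F" "smooth_on UNIV c"
    for F :: "real \<times> real \<Rightarrow> real \<times> real \<times> real" and c :: "real \<times> real \<times> real \<Rightarrow> real \<times> real"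
    by (rule smooth_on_compose[OF open_UNIV open_UNIV UNIV_I that(2,1)])
  have pr: "smooth_on UNIV (\<lambda>z :: real \<times> real \<times> real. (fst z, fst (snd z)))"
    "smooth_on UNIV (\<lambda>z :: real \<times> real \<times> real. (fst z, 0 :: real))"
    by (intro smooth_on_Pair lin smooth_on_const open_UNIV)+
  have \<Psi>: "smooth_on UNIV \<Psi>"
    unfolding \<Psi>_def
    by (intro smooth_on_add smooth_on_scaleR open_UNIV lin sc[OF G(1) pr(2)] sc[OF sm(1) pr(1)] sc[OF sm(2) pr(1)])
  have cont: "isCont (\<lambda>z :: real \<times> real \<times> real. F (fst z, fst (snd z))) 0" if "smooth_on UNIV F"
    for F :: "real \<times> real \<Rightarrow> real \<times> real \<times> real"
    by (rule has_derivative_continuous[OF smooth_on_has_derivative[OF sc[OF that pr(1)] open_UNIV UNIV_I]])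
  \<comment> \<open>The factors in front of \<open>E\<close> and \<open>H\<close> vanish at 0, so
    only the values \<open>E 0\<close> and \<open>H 0\<close> enter.\<close>
  have D: "(\<Psi> has_derivative (\<lambda>z. fst z *\<^sub>R q1 + fst (snd z) *\<^sub>R E 0 + snd (snd z) *\<^sub>R H 0)) (at 0)"
  proof -
    have "((\<lambda>z :: real \<times> real \<times> real. G (fst z, 0)) has_derivative (\<lambda>z. fst z *\<^sub>R q1)) (at 0)"
      by (rule has_derivative_compose[where g = "\<lambda>u. G (u, 0)" and f = fst])
         (use q1 in \<open>auto simp: has_vector_derivative_def intro!: derivative_eq_intros\<close>)
    moreover have "((\<lambda>z :: real \<times> real \<times> real. fst (snd z) *\<^sub>R E (fst z, fst (snd z))) has_derivative (\<lambda>z. fst (snd z) *\<^sub>R E 0)) (at 0)"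
      using has_derivative_scaleR_zero[OF bounded_linear_fst_comp[OF bounded_linear_snd] cont[OF sm(1)]]
      by (simp add: zero_prod_def)
    moreover have "((\<lambda>z :: real \<times> real \<times> real. snd (snd z) *\<^sub>R H (fst z, fst (snd z))) has_derivative (\<lambda>z. snd (snd z) *\<^sub>R H 0)) (at 0)"
      using has_derivative_scaleR_zero[OF bounded_linear_snd_comp[OF bounded_linear_snd] cont[OF sm(2)]]
      by (simp add: zero_prod_def)
    ultimately show ?thesis unfolding \<Psi>_def by (intro has_derivative_add)
  qed
  have inj: "inj (\<lambda>z :: real \<times> real \<times> real. fst z *\<^sub>R q1 + fst (snd z) *\<^sub>R E 0 + snd (snd z) *\<^sub>R H 0)"
  proof (rule linear_injective_0[OF has_derivative_linear[OF D], THEN iffD2], intro allI impI)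
    fix z :: "real \<times> real \<times> real"
    assume "fst z *\<^sub>R q1 + fst (snd z) *\<^sub>R E 0 + snd (snd z) *\<^sub>R H 0 = 0"
    then have "fst z *\<^sub>R q1 + (fst (snd z) / 2) *\<^sub>R p2 0 + (snd (snd z) / 6) *\<^sub>R p3 = 0"
      by (simp add: E0 H0)
    from indep[OF this] show "z = 0" by (simp add: prod_eq_iff)
  qed
  have ce0: "cuspidal_edge 0 = 0" by (simp add: cuspidal_edge_def zero_prod_def)
  show ?thesis
  proof (rule A_equiv_atI[OF open_UNIV UNIV_I h open_UNIV UNIV_I \<Psi> _ inj])
    show "(\<Psi> has_derivative (\<lambda>z. fst z *\<^sub>R q1 + fst (snd z) *\<^sub>R E 0 + snd (snd z) *\<^sub>R H 0)) (at (cuspidal_edge 0))"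
      unfolding ce0 by (rule D)
    show "continuous_on UNIV cuspidal_edge"
      unfolding cuspidal_edge_def split_beta' by (intro continuous_intros)
    fix x :: "real \<times> real"
    show "g (h x) = \<Psi> (cuspidal_edge x)"
      using dec[of "fst x" "snd x"] by (simp add: G_def \<Psi>_def cuspidal_edge_def split_beta')
  qed
qed

section \<open>Invariance of fibres and of local injectivity\<close>

lemma A_equiv_atE:
  assumes "A_equiv_at g p f q"
  obtains V U \<phi> W W' \<psi> where "q \<in> V" "diffeo_on V U \<phi>" "\<phi> q = p" "g p \<in> W" "diffeo_on W W' \<psi>"
    "\<And>x. x \<in> V \<Longrightarrow> g (\<phi> x) \<in> W" "\<And>x. x \<in> V \<Longrightarrow> \<psi> (g (\<phi> x)) = f x"
  using assms unfolding A_equiv_at_def by metis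

lemma A_equiv_at_fibre:
  assumes "A_equiv_at g p f q" and "\<And>x. f x = f q \<Longrightarrow> x = q"
    and "\<And>U. open U \<Longrightarrow> p \<in> U \<Longrightarrow> \<exists>y\<in>U. y \<noteq> p \<and> g y = g p"
  shows False
proof -
  obtain V U \<phi> W W' \<psi> where *: "q \<in> V" "diffeo_on V U \<phi>" "\<phi> q = p"
    "\<And>x. x \<in> V \<Longrightarrow> \<psi> (g (\<phi> x)) = f x" by (rule A_equiv_atE[OF assms(1)]) (rule that)
  then have U: "open U" "\<phi> ` V = U" unfolding diffeo_on_def by auto
  then obtain y where y: "y \<in> U" "y \<noteq> p" "g y = g p" using assms(3)[OF U(1)] * by auto
  then obtain x where "x \<in> V" "y = \<phi> x" using U by auto
  then have "f x = f q" using *(4)[of x] *(4)[OF *(1)] y *(3) by simp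
  then show False using assms(2) y *(3) \<open>y = \<phi> x\<close> by blast
qed

text \<open>Injectivity passes from \<open>f1\<close> to \<open>g\<close> on a neighbourhood of
  \<open>p\<close>, and then to \<open>f2\<close> on the part of its domain whose image lies in that
  neighbourhood.\<close>

lemma A_equiv_at_injective:
  assumes "A_equiv_at g p f1 q1" "inj f1" and A: "A_equiv_at g p f2 q2"
    and "\<And>V. open V \<Longrightarrow> q2 \<in> V \<Longrightarrow> \<not> inj_on f2 V"
  shows False
proof -
  obtain V U \<phi> W W' \<psi> where *: "q1 \<in> V" "diffeo_on V U \<phi>" "\<phi> q1 = p"
    "\<And>x. x \<in> V \<Longrightarrow> \<psi> (g (\<phi> x)) = f1 x" by (rule A_equiv_atE[OF assms(1)]) (rule that)
  have U: "open U" "\<phi> ` V = U" using *(2) unfolding diffeo_on_def by auto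
  have pU: "p \<in> U" using *(1,3) U(2) by (metis imageI)
  have inj: "inj_on g U"
  proof (rule inj_onI)
    fix y y' assume y: "y \<in> U" "y' \<in> U" "g y = g y'"
    obtain x where x: "x \<in> V" "y = \<phi> x" using y(1) U by auto
    obtain x' where x': "x' \<in> V" "y' = \<phi> x'" using y(2) U by auto
    have "f1 x = f1 x'" using *(4)[OF x(1)] *(4)[OF x'(1)] y(3) x x' by simp
    then show "y = y'" using injD[OF assms(2)] x x' by blast
  qed
  obtain V2 U2 \<phi>2 W2 W2' \<psi>2 where **: "q2 \<in> V2" "diffeo_on V2 U2 \<phi>2" "\<phi>2 q2 = p" "diffeo_on W2 W2' \<psi>2"
    "\<And>x. x \<in> V2 \<Longrightarrow> g (\<phi>2 x) \<in> W2" "\<And>x. x \<in> V2 \<Longrightarrow> \<psi>2 (g (\<phi>2 x)) = f2 x" by (rule A_equiv_atE[OF A]) (rule that)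
  have d: "open V2" "smooth_on V2 \<phi>2" "inj_on \<phi>2 V2" "inj_on \<psi>2 W2" using **(2,4) unfolding diffeo_on_def by auto
  let ?V = "V2 \<inter> \<phi>2 -` U"
  have "open ?V" using smooth_on_continuous_on[OF d(2)] d(1) U(1) by (metis continuous_on_open_vimage Int_commute)
  moreover have "q2 \<in> ?V" using **(1,3) pU by simp
  ultimately have "\<not> inj_on f2 ?V" by (rule assms(4))
  then obtain x x' where x: "x \<in> ?V" "x' \<in> ?V" "f2 x = f2 x'" "x \<noteq> x'" unfolding inj_on_def by blast
  then have "\<psi>2 (g (\<phi>2 x)) = \<psi>2 (g (\<phi>2 x'))" using **(6) by auto
  then have "g (\<phi>2 x) = g (\<phi>2 x')" using **(5) x d(4) by (auto dest: inj_onD)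
  then have "\<phi>2 x = \<phi>2 x'" using inj x by (auto dest: inj_onD)
  then show False using x d(3) by (auto dest: inj_onD)
qed

section \<open>Obstructions to equivalence\<close>

lemma smooth_on_inverse_derivatives:
  assumes a: "open A" "smooth_on A a" and b: "open B" "smooth_on B b"
    and ab: "\<And>x. x \<in> A \<Longrightarrow> a x \<in> B" "\<And>x. x \<in> A \<Longrightarrow> b (a x) = x" and x: "x \<in> A"
  shows "frechet_derivative b (at (a x)) (frechet_derivative a (at x) h) = h"
proof -
  have "((\<lambda>x. b (a x)) has_derivative (\<lambda>h. frechet_derivative b (at (a x)) (frechet_derivative a (at x) h))) (at x)"
    by (rule has_derivative_compose[OF smooth_on_has_derivative[OF a(2,1) x] smooth_on_has_derivative[OF b(2,1) ab(1)[OF x]]])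
  moreover have "((\<lambda>x. b (a x)) has_derivative (\<lambda>h. h)) (at x)"
    by (rule has_derivative_transform_within_open[OF has_derivative_ident a(1) x]) (simp add: ab)
  ultimately have "(\<lambda>h. frechet_derivative b (at (a x)) (frechet_derivative a (at x) h)) = (\<lambda>h. h)"
    by (rule has_derivative_unique)
  then show ?thesis by (rule fun_cong)
qed

text \<open>This turns an equivalence into first-order data: the differential of \<open>f\<close>
  factors through that of \<open>g\<close>, with factors continuous in the point.
  \<open>\<theta>\<close> is the local inverse of \<open>\<phi>\<close>, and the domains are cut
  down so that the given derivative \<open>g'\<close> is available.\<close>

lemma A_equiv_at_linearize:
  fixes g f :: "'a::euclidean_space \<Rightarrow> 'b::euclidean_space"
  assumes A: "A_equiv_at g p f q" and S: "open S" "p \<in> S"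
    and g': "\<And>y. y \<in> S \<Longrightarrow> (g has_derivative g' y) (at y)"
  obtains V U \<phi> \<theta> \<phi>' \<theta>' \<psi>' where
    "open V" "q \<in> V" "open U" "p \<in> U" "U \<subseteq> S" "\<phi> q = p"
    "\<And>x. x \<in> V \<Longrightarrow> \<phi> x \<in> U" "\<And>x. x \<in> V \<Longrightarrow> \<theta> (\<phi> x) = x"
    "\<And>y. y \<in> U \<Longrightarrow> \<theta> y \<in> V" "\<And>y. y \<in> U \<Longrightarrow> \<phi> (\<theta> y) = y"
    "\<And>x. x \<in> V \<Longrightarrow> (\<phi> has_derivative \<phi>' x) (at x)"
    "\<And>y. y \<in> U \<Longrightarrow> (\<theta> has_derivative \<theta>' y) (at y)"
    "\<And>x h. x \<in> V \<Longrightarrow> \<theta>' (\<phi> x) (\<phi>' x h) = h" "\<And>x h. x \<in> V \<Longrightarrow> \<phi>' x (\<theta>' (\<phi> x) h) = h"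
    "\<And>v. continuous_on U (\<lambda>y. \<theta>' y v)"
    "\<And>x. x \<in> V \<Longrightarrow> (f has_derivative (\<lambda>h. \<psi>' x (g' (\<phi> x) (\<phi>' x h)))) (at x)"
    "\<And>x. x \<in> V \<Longrightarrow> linear (\<psi>' x)" "\<And>x. x \<in> V \<Longrightarrow> inj (\<psi>' x)" "\<And>w. continuous_on V (\<lambda>x. \<psi>' x w)"
proof -
  obtain V0 U0 \<phi> W W' \<psi> where *: "q \<in> V0" "diffeo_on V0 U0 \<phi>" "\<phi> q = p" "diffeo_on W W' \<psi>"
    "\<And>x. x \<in> V0 \<Longrightarrow> g (\<phi> x) \<in> W" "\<And>x. x \<in> V0 \<Longrightarrow> \<psi> (g (\<phi> x)) = f x"
    by (rule A_equiv_atE[OF A]) (rule that)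
  have d: "open V0" "open U0" "\<phi> ` V0 = U0" "inj_on \<phi> V0" "smooth_on V0 \<phi>" "smooth_on U0 (inv_into V0 \<phi>)"
    using *(2) unfolding diffeo_on_def by auto
  have e: "open W" "open W'" "\<psi> ` W = W'" "inj_on \<psi> W" "smooth_on W \<psi>" "smooth_on W' (inv_into W \<psi>)"
    using *(4) unfolding diffeo_on_def by auto
  let ?\<theta> = "inv_into V0 \<phi>"
  let ?D = "\<lambda>f x. frechet_derivative f (at x)"
  define V where "V = V0 \<inter> \<phi> -` S"
  define U where "U = U0 \<inter> S"
  have V: "open V" unfolding V_def
    using continuous_open_preimage[OF smooth_on_continuous_on[OF d(5)] d(1) S(1)] .
  have VV: "x \<in> V0" "\<phi> x \<in> U" "\<phi> x \<in> S" "?\<theta> (\<phi> x) = x" if "x \<in> V" for x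
    using that d unfolding V_def U_def by auto
  have UU: "?\<theta> y \<in> V" "\<phi> (?\<theta> y) = y" "y \<in> U0" if "y \<in> U" for y
    using that d(3,4) unfolding V_def U_def by (auto simp: f_inv_into_f inv_into_into)
  have \<phi>': "(\<phi> has_derivative ?D \<phi> x) (at x)" if "x \<in> V" for x
    by (rule smooth_on_has_derivative[OF d(5,1) VV(1)[OF that]])
  have g\<phi>: "((\<lambda>x. g (\<phi> x)) has_derivative (\<lambda>h. g' (\<phi> x) (?D \<phi> x h))) (at x)" if "x \<in> V" for x
    by (rule has_derivative_compose[OF \<phi>'[OF that] g'[OF VV(3)[OF that]]])
  have gc: "continuous_on V (\<lambda>x. g (\<phi> x))"
    using g\<phi> by (auto intro!: continuous_at_imp_continuous_on has_derivative_continuous)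
  have gW: "g (\<phi> x) \<in> W" if "x \<in> V" for x using *(5) VV(1)[OF that] .
  have \<psi>': "(\<psi> has_derivative ?D \<psi> (g (\<phi> x))) (at (g (\<phi> x)))" if "x \<in> V" for x
    by (rule smooth_on_has_derivative[OF e(5,1) gW[OF that]])
  show ?thesis
  proof (rule that[of V U \<phi> ?\<theta> "?D \<phi>" "?D ?\<theta>" "\<lambda>x. ?D \<psi> (g (\<phi> x))"])
    show "open V" by (rule V)
    show "q \<in> V" using * S unfolding V_def by auto
    show "open U" using d S unfolding U_def by auto
    show "p \<in> U" using *(1,3) d(3) S unfolding U_def by auto
    show "U \<subseteq> S" unfolding U_def by auto
    show "\<phi> q = p" by (rule *(3))
    fix x assume x: "x \<in> V"
    show "\<phi> x \<in> U" "?\<theta> (\<phi> x) = x" by (rule VV(2)[OF x], rule VV(4)[OF x])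
    show "(\<phi> has_derivative ?D \<phi> x) (at x)" by (rule \<phi>'[OF x])
    have t: "\<phi> z \<in> U0" "?\<theta> (\<phi> z) = z" if "z \<in> V0" for z using that d by auto
    have t': "?\<theta> y \<in> V0" "\<phi> (?\<theta> y) = y" if "y \<in> U0" for y
      using that d(3) by (auto simp: f_inv_into_f inv_into_into)
    show "?D ?\<theta> (\<phi> x) (?D \<phi> x h) = h" for h
      by (rule smooth_on_inverse_derivatives[OF d(1,5,2,6) t VV(1)[OF x]])
    show "?D \<phi> x (?D ?\<theta> (\<phi> x) h) = h" for h
      using smooth_on_inverse_derivatives[OF d(2,6,1,5) t' t(1)[OF VV(1)[OF x]], of h] VV(4)[OF x] by simp
    show "linear (?D \<psi> (g (\<phi> x)))" by (rule has_derivative_linear[OF \<psi>'[OF x]])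
    have t2: "\<psi> z \<in> W'" "inv_into W \<psi> (\<psi> z) = z" if "z \<in> W" for z using that e by auto
    show "inj (?D \<psi> (g (\<phi> x)))"
      by (rule inj_on_inverseI[where g = "?D (inv_into W \<psi>) (\<psi> (g (\<phi> x)))"])
         (rule smooth_on_inverse_derivatives[OF e(1,5,2,6) t2 gW[OF x]])
    have "((\<lambda>x. \<psi> (g (\<phi> x))) has_derivative (\<lambda>h. ?D \<psi> (g (\<phi> x)) (g' (\<phi> x) (?D \<phi> x h)))) (at x)"
      by (rule has_derivative_compose[OF g\<phi>[OF x] \<psi>'[OF x]])
    then show "(f has_derivative (\<lambda>h. ?D \<psi> (g (\<phi> x)) (g' (\<phi> x) (?D \<phi> x h)))) (at x)"
      by (rule has_derivative_transform_within_open[OF _ V x]) (use *(6) VV(1) in blast)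
  next
    fix y assume y: "y \<in> U"
    show "?\<theta> y \<in> V" "\<phi> (?\<theta> y) = y" by (rule UU(1)[OF y], rule UU(2)[OF y])
    show "(?\<theta> has_derivative ?D ?\<theta> y) (at y)"
      by (rule smooth_on_has_derivative[OF d(6,2) UU(3)[OF y]])
  next
    show "continuous_on U (\<lambda>y. ?D ?\<theta> y v)" for v
      by (rule continuous_on_subset[OF smooth_on_continuous_on[OF smooth_on_frechet[OF d(6,2)]]])
         (auto simp: U_def)
    show "continuous_on V (\<lambda>x. ?D \<psi> (g (\<phi> x)) w)" for w
      by (rule continuous_on_compose2[OF smooth_on_continuous_on[OF smooth_on_frechet[OF e(5,1), of w]] gc])
         (use gW in blast)
  qed
qed

text \<open>Continuity is known on fixed vectors only; the basis expansion extends it to a moving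
  argument.\<close>

lemma continuous_on_family_apply:
  fixes L :: "'a::topological_space \<Rightarrow> 'b::euclidean_space \<Rightarrow> 'c::real_normed_vector"
  assumes "\<And>x. x \<in> A \<Longrightarrow> linear (L x)" "\<And>v. continuous_on A (\<lambda>x. L x v)" "continuous_on A z"
  shows "continuous_on A (\<lambda>x. L x (z x))"
proof -
  have "continuous_on A (\<lambda>x. \<Sum>b\<in>Basis. (z x \<bullet> b) *\<^sub>R L x b)"
    by (intro continuous_on_sum continuous_on_scaleR continuous_on_inner continuous_on_const assms(2,3))
  then show ?thesis
    by (rule continuous_on_eq) (simp add: linear_basis_sum[OF assms(1), symmetric])
qed

text \<open>If the differential of \<open>g\<close> sends a field \<open>\<xi>\<close> to \<open>l *\<^sub>R k\<close>, then the differential of an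
  equivalent map \<open>f\<close> sends the corresponding field \<open>\<zeta>\<close> to a multiple of \<open>l \<circ> \<phi>\<close>; this is how the
  degeneracy of \<open>g\<close> is compared with that of the normal forms.\<close>

lemma A_equiv_at_field:
  fixes g f :: "'a::euclidean_space \<Rightarrow> 'b::euclidean_space"
  assumes A: "A_equiv_at g p f q" and S: "open S" "p \<in> S"
    and g': "\<And>y. y \<in> S \<Longrightarrow> (g has_derivative g' y) (at y)"
    and f': "\<And>x. (f has_derivative f' x) (at x)"
    and \<xi>: "continuous_on S \<xi>" "\<And>y. y \<in> S \<Longrightarrow> \<xi> y \<noteq> 0"
    and k: "continuous_on S k" "\<And>y. y \<in> S \<Longrightarrow> g' y (\<xi> y) = l y *\<^sub>R k y"
  obtains V U \<phi> \<theta> \<phi>' \<theta>' \<zeta> B where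
    "open V" "q \<in> V" "open U" "p \<in> U" "U \<subseteq> S" "\<phi> q = p"
    "\<And>x. x \<in> V \<Longrightarrow> \<phi> x \<in> U" "\<And>x. x \<in> V \<Longrightarrow> \<theta> (\<phi> x) = x"
    "\<And>y. y \<in> U \<Longrightarrow> \<theta> y \<in> V" "\<And>y. y \<in> U \<Longrightarrow> \<phi> (\<theta> y) = y"
    "\<And>x. x \<in> V \<Longrightarrow> (\<phi> has_derivative \<phi>' x) (at x)"
    "\<And>y. y \<in> U \<Longrightarrow> (\<theta> has_derivative \<theta>' y) (at y)"
    "\<And>x h. x \<in> V \<Longrightarrow> \<theta>' (\<phi> x) (\<phi>' x h) = h" "\<And>x h. x \<in> V \<Longrightarrow> \<phi>' x (\<theta>' (\<phi> x) h) = h"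
    "\<And>x. x \<in> V \<Longrightarrow> \<zeta> x = \<theta>' (\<phi> x) (\<xi> (\<phi> x))"
    "continuous_on V \<zeta>" "\<And>x. x \<in> V \<Longrightarrow> \<zeta> x \<noteq> 0"
    "continuous_on V B" "\<And>x. x \<in> V \<Longrightarrow> f' x (\<zeta> x) = l (\<phi> x) *\<^sub>R B x"
    "\<And>x h. x \<in> V \<Longrightarrow> f' x h = 0 \<Longrightarrow> h \<noteq> 0 \<Longrightarrow> \<not> inj (g' (\<phi> x))"
proof (rule A_equiv_at_linearize[OF A S g'], assumption, goal_cases)
  case (1 V U \<phi> \<theta> \<phi>' \<theta>' \<psi>')
  note * = 1(2-15) and \<theta>c = 1(16) and \<psi> = 1(17-20)
  have \<phi>S: "\<phi> x \<in> S" if "x \<in> V" for x using *(5,7) that by blast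
  have eq: "f' x h = \<psi>' x (g' (\<phi> x) (\<phi>' x h))" if "x \<in> V" for x h
    using has_derivative_unique[OF f' \<psi>(1)[OF that]] by (rule fun_cong)
  have \<phi>c: "continuous_on V \<phi>"
    using *(11) by (auto intro!: continuous_at_imp_continuous_on has_derivative_continuous)
  have \<phi>im: "\<phi> ` V \<subseteq> U" "\<phi> ` V \<subseteq> S" using *(7) \<phi>S by auto
  have lin\<theta>: "linear (\<theta>' (\<phi> x))" if "x \<in> V" for x
    by (rule has_derivative_linear[OF *(12)[OF *(7)[OF that]]])
  show ?case
  proof (rule that[of V U \<phi> \<theta> \<phi>' \<theta>' "\<lambda>x. \<theta>' (\<phi> x) (\<xi> (\<phi> x))" "\<lambda>x. \<psi>' x (k (\<phi> x))", OF *])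
    show "continuous_on V (\<lambda>x. \<theta>' (\<phi> x) (\<xi> (\<phi> x)))"
      by (rule continuous_on_family_apply[OF lin\<theta>
            continuous_on_compose2[OF \<theta>c \<phi>c \<phi>im(1)] continuous_on_compose2[OF \<xi>(1) \<phi>c \<phi>im(2)]])
    show "continuous_on V (\<lambda>x. \<psi>' x (k (\<phi> x)))"
      by (rule continuous_on_family_apply[OF \<psi>(2,4) continuous_on_compose2[OF k(1) \<phi>c \<phi>im(2)]])
    fix x assume x: "x \<in> V"
    show "\<theta>' (\<phi> x) (\<xi> (\<phi> x)) \<noteq> 0"
    proof
      assume "\<theta>' (\<phi> x) (\<xi> (\<phi> x)) = 0"
      then have "\<phi>' x 0 = \<xi> (\<phi> x)" using *(14)[OF x, of "\<xi> (\<phi> x)"] by simp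
      then show False
        using \<xi>(2)[OF \<phi>S[OF x]] linear_0[OF has_derivative_linear[OF *(11)[OF x]]] by simp
    qed
    show "f' x (\<theta>' (\<phi> x) (\<xi> (\<phi> x))) = l (\<phi> x) *\<^sub>R \<psi>' x (k (\<phi> x))"
      unfolding eq[OF x] *(14)[OF x] k(2)[OF \<phi>S[OF x]] by (rule linear_cmul[OF \<psi>(2)[OF x]])
    fix h assume h: "f' x h = 0" "h \<noteq> 0"
    show "\<not> inj (g' (\<phi> x))"
    proof
      assume i: "inj (g' (\<phi> x))"
      have lg: "linear (g' (\<phi> x))" by (rule has_derivative_linear[OF g'[OF \<phi>S[OF x]]])
      have "g' (\<phi> x) (\<phi>' x h) = 0"
        using h(1) \<psi>(2,3)[OF x] unfolding eq[OF x] by (metis injD linear_0)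
      then have "\<phi>' x h = 0" using i lg by (metis injD linear_0)
      then have "\<theta>' (\<phi> x) 0 = h" using *(13)[OF x, of h] by simp
      then show False using h(2) linear_0[OF lin\<theta>[OF x]] by simp
    qed
  qed auto
qed

section \<open>Differentials of the normal forms\<close>

lemma cuspidal_edge_derivative:
  "(cuspidal_edge has_derivative (\<lambda>h. (fst h, 2 * snd x * snd h, 3 * (snd x)^2 * snd h))) (at x)"
  unfolding cuspidal_edge_def split_beta'
  by (auto intro!: derivative_eq_intros simp: fun_eq_iff power2_eq_square power3_eq_cube algebra_simps)

lemma swallowtail_derivative:
  "(swallowtail has_derivative (\<lambda>h. (fst h, 2 * snd x * fst h + (12 * (snd x)^2 + 2 * fst x) * snd h,
     (snd x)^2 * fst h + (12 * (snd x)^3 + 2 * fst x * snd x) * snd h))) (at x)"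
  unfolding swallowtail_def split_beta'
  by (auto intro!: derivative_eq_intros simp: fun_eq_iff power2_eq_square power3_eq_cube algebra_simps)

text \<open>The v-derivative has the common factor \<open>6 * (snd x)^2 - (fst x)^2\<close>, so the
  singular set is a pair of crossing lines with kernel direction (0, 1). For the lips the sign of
  the square of \<open>fst x\<close> is reversed.\<close>

lemma cuspidal_beaks_derivative:
  "(cuspidal_beaks has_derivative (\<lambda>h. (fst h, - 2 * fst x * snd x * fst h + (6 * (snd x)^2 - (fst x)^2) * snd h,
     - 2 * fst x * (snd x)^2 * fst h + 2 * snd x * (6 * (snd x)^2 - (fst x)^2) * snd h))) (at x)"
  unfolding cuspidal_beaks_def split_beta'
  by (auto intro!: derivative_eq_intros simp: fun_eq_iff power2_eq_square power3_eq_cube algebra_simps)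

lemma cuspidal_lips_derivative:
  "(cuspidal_lips has_derivative (\<lambda>h. (fst h, 2 * fst x * snd x * fst h + (6 * (snd x)^2 + (fst x)^2) * snd h,
     2 * fst x * (snd x)^2 * fst h + 2 * snd x * (6 * (snd x)^2 + (fst x)^2) * snd h))) (at x)"
  unfolding cuspidal_lips_def split_beta'
  by (auto intro!: derivative_eq_intros simp: fun_eq_iff power2_eq_square power3_eq_cube algebra_simps)

lemma cuspidal_cross_cap_derivative:
  "(cuspidal_cross_cap has_derivative (\<lambda>h. (fst h, 2 * snd x * snd h, (snd x)^3 * fst h + 3 * fst x * (snd x)^2 * snd h))) (at x)"
  unfolding cuspidal_cross_cap_def split_beta'
  by (auto intro!: derivative_eq_intros simp: fun_eq_iff power2_eq_square power3_eq_cube algebra_simps)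

text \<open>On the zero set of \<open>l\<close> the nowhere vanishing field \<open>\<xi>\<close>
  spans a kernel direction of \<open>g'\<close>, and \<open>l\<close> measures how the kernel is
  left. Keeping \<open>l\<close> apart from the continuous factor \<open>k\<close> lets its order of
  vanishing be compared.\<close>

locale degenerate_field =
  fixes g :: "real \<times> real \<Rightarrow> real \<times> real \<times> real" and p S g' \<xi> k and l :: "real \<times> real \<Rightarrow> real"
  assumes S: "open S" "p \<in> S"
    and g': "\<And>y. y \<in> S \<Longrightarrow> (g has_derivative g' y) (at y)"
    and \<xi>: "continuous_on S \<xi>" "\<And>y. y \<in> S \<Longrightarrow> \<xi> y \<noteq> 0"
    and k: "continuous_on S k" "\<And>y. y \<in> S \<Longrightarrow> g' y (\<xi> y) = l y *\<^sub>R k y"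
begin

text \<open>If \<open>l\<close> vanishes to second order at \<open>p\<close>, then the differential of \<open>f\<close> sends \<open>\<zeta>\<close> to
  \<open>o(x)\<close>, whereas along the line spanned by \<open>w\<close> it has a component \<open>2 * s * snd \<zeta>\<close>.\<close>

lemma not_equiv_of_flat:
  fixes f :: "real \<times> real \<Rightarrow> real \<times> real \<times> real" and w :: "real \<times> real"
  assumes f': "\<And>x. (f has_derivative f' x) (at x)"
    and f1: "\<And>x h. fst (f' x h) = fst h" and w: "\<And>s h. fst (snd (f' (s *\<^sub>R w) h)) = 2 * s * snd h"
    and l: "l p = 0" "(l has_derivative (\<lambda>h. 0)) (at p)"
  shows "\<not> A_equiv_at g p f 0"
proof
  assume A: "A_equiv_at g p f 0"
  show False
  proof (rule A_equiv_at_field[OF A S g' f' \<xi> k], assumption+, goal_cases)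
    case (1 V U \<phi> \<theta> \<phi>' \<theta>' \<zeta> B)
    note V = 1(1,2)
    have at0: "isCont F 0" if "continuous_on V F" for F :: "real \<times> real \<Rightarrow> 'z::real_normed_vector"
      using that V(2) unfolding continuous_on_eq_continuous_at[OF V(1)] by (rule bspec)
    have "((\<lambda>x. l (\<phi> x)) has_derivative (\<lambda>h. 0)) (at 0)"
      using has_derivative_compose[OF 1(11)[OF V(2)], of l "\<lambda>h. 0"] l(2) unfolding 1(6) by simp
    from has_derivative_scaleR_vanishing[OF this _ at0[OF 1(18)]]
    \<comment> \<open>A function that vanishes together with its derivative keeps this property
      after multiplication by the continuous \<open>B\<close>.\<close>
    have D: "((\<lambda>x. l (\<phi> x) *\<^sub>R B x) has_derivative (\<lambda>h. 0)) (at 0)" by (simp add: 1(6) l(1))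
    have c: "((\<lambda>s. s *\<^sub>R w) has_derivative (\<lambda>s. s *\<^sub>R w)) (at 0)" by (auto intro!: derivative_eq_intros)
    have "((\<lambda>s. l (\<phi> (s *\<^sub>R w)) *\<^sub>R B (s *\<^sub>R w)) has_derivative (\<lambda>h. 0)) (at 0)"
      by (rule has_derivative_compose[OF c]) (simp add: D)
    from has_derivative_fst[OF has_derivative_snd[OF this]]
    have Z: "((\<lambda>s. fst (snd (l (\<phi> (s *\<^sub>R w)) *\<^sub>R B (s *\<^sub>R w)))) has_derivative (\<lambda>h. 0)) (at 0)" by simp
    let ?T = "(\<lambda>s. s *\<^sub>R w) -` V"
    have T: "open ?T" by (rule open_vimage[OF V(1)]) (intro continuous_intros)
    have "((\<lambda>s. (2 * s) *\<^sub>R snd (\<zeta> (s *\<^sub>R w))) has_derivative (\<lambda>h. 0)) (at 0)"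
    proof (rule has_derivative_transform_within_open[OF Z T])
      show "0 \<in> ?T" using V(2) by simp
      fix s assume "s \<in> ?T"
      then have "s *\<^sub>R w \<in> V" by simp
      from 1(19)[OF this] w[of s "\<zeta> (s *\<^sub>R w)"]
      show "fst (snd (l (\<phi> (s *\<^sub>R w)) *\<^sub>R B (s *\<^sub>R w))) = (2 * s) *\<^sub>R snd (\<zeta> (s *\<^sub>R w))"
        by (simp only: real_scaleR_def)
    qed
    moreover have "((\<lambda>s. (2 * s) *\<^sub>R snd (\<zeta> (s *\<^sub>R w))) has_derivative (\<lambda>h. (2 * h) *\<^sub>R snd (\<zeta> (0 *\<^sub>R w)))) (at 0)"
    proof (rule has_derivative_scaleR_vanishing)
      show "((\<lambda>s::real. 2 * s) has_derivative (\<lambda>h. 2 * h)) (at 0)" by (auto intro!: derivative_eq_intros)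
      have "isCont (\<lambda>s. \<zeta> (s *\<^sub>R w)) 0"
        using isCont_o2[of 0 "\<lambda>s. s *\<^sub>R w" \<zeta>] at0[OF 1(16)] by simp
      then show "isCont (\<lambda>s. snd (\<zeta> (s *\<^sub>R w))) 0" by (rule isCont_snd)
    qed simp
    \<comment> \<open>The two derivatives force \<open>snd (\<zeta> 0) = 0\<close>. The first
      component of \<open>\<zeta> 0\<close> vanishes since \<open>f'\<close> preserves first
      components and \<open>l p = 0\<close>; but \<open>\<zeta> 0\<close> is nonzero.\<close>
    ultimately have "(\<lambda>h::real. 0) = (\<lambda>h. (2 * h) *\<^sub>R snd (\<zeta> (0 *\<^sub>R w)))" by (rule has_derivative_unique)
    from fun_cong[OF this, of 1] have "snd (\<zeta> 0) = 0" by simp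
    moreover have "fst (\<zeta> 0) = 0"
      using f1[of 0 "\<zeta> 0"] 1(19)[OF V(2)] by (simp add: 1(6) l(1))
    ultimately show False using 1(17)[OF V(2)] by (simp add: prod_eq_iff)
  qed
qed

lemma not_cuspidal_edge_of_flat:
  "l p = 0 \<Longrightarrow> (l has_derivative (\<lambda>h. 0)) (at p) \<Longrightarrow> \<not> A_equiv_at g p cuspidal_edge 0"
  by (rule not_equiv_of_flat[OF cuspidal_edge_derivative, where w = "(0, 1)"]) auto

lemma not_cuspidal_cross_cap_of_flat:
  "l p = 0 \<Longrightarrow> (l has_derivative (\<lambda>h. 0)) (at p) \<Longrightarrow> \<not> A_equiv_at g p cuspidal_cross_cap 0"
  by (rule not_equiv_of_flat[OF cuspidal_cross_cap_derivative, where w = "(0, 1)"]) auto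

text \<open>The v-derivative of the second component is 12 v^2 + 2 u. It is linear along the u-axis
  and quadratic along the v-axis, hence the direction (1, 0).\<close>

lemma not_swallowtail_of_flat:
  "l p = 0 \<Longrightarrow> (l has_derivative (\<lambda>h. 0)) (at p) \<Longrightarrow> \<not> A_equiv_at g p swallowtail 0"
  by (rule not_equiv_of_flat[OF swallowtail_derivative, where w = "(1, 0)"]) auto

lemma not_cuspidal_lips:
  assumes zero: "\<And>U. open U \<Longrightarrow> p \<in> U \<Longrightarrow> \<exists>y\<in>U. y \<noteq> p \<and> l y = 0"
  shows "\<not> A_equiv_at g p cuspidal_lips 0"
proof
  assume A: "A_equiv_at g p cuspidal_lips 0"
  show False
  proof (rule A_equiv_at_field[OF A S g' cuspidal_lips_derivative \<xi> k], assumption+, goal_cases)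
    case (1 V U \<phi> \<theta> \<phi>' \<theta>' \<zeta> B)
    obtain y where y: "y \<in> U" "y \<noteq> p" "l y = 0" using zero[OF 1(3,4)] by blast
    define x where "x = \<theta> y"
    have x: "x \<in> V" "\<phi> x = y" unfolding x_def by (rule 1(9)[OF y(1)], rule 1(10)[OF y(1)])
    from 1(19)[OF x(1)] have "fst (\<zeta> x) = 0" "(6 * (snd x)\<^sup>2 + (fst x)\<^sup>2) * snd (\<zeta> x) = 0"
      unfolding x(2) y(3) by (auto simp: zero_prod_def)
    moreover from this(1) 1(17)[OF x(1)] have "snd (\<zeta> x) \<noteq> 0" by (auto simp: prod_eq_iff)
    ultimately have "6 * (snd x)\<^sup>2 + (fst x)\<^sup>2 = 0" by simp
    then have "(snd x)\<^sup>2 = 0" "(fst x)\<^sup>2 = 0" using zero_le_power2[of "snd x"] zero_le_power2[of "fst x"] by linarith+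
    then have "x = 0" by (simp add: prod_eq_iff)
    then show False using 1(6) x(2) y(2) by simp
  qed
qed

text \<open>The line through \<open>p\<close> in the kernel direction becomes a curve inside 6 v^2 =
  u^2 whose velocity \<open>\<zeta> 0\<close> is a kernel vector, so its u-component is 0 and its
  v-component is not. The equation is violated to second order in the parameter.\<close>

lemma not_cuspidal_beaks_tangent:
  assumes zero: "\<And>s. l (p + s *\<^sub>R \<xi> p) = 0"
  shows "\<not> A_equiv_at g p cuspidal_beaks 0"
proof
  assume A: "A_equiv_at g p cuspidal_beaks 0"
  show False
  proof (rule A_equiv_at_field[OF A S g' cuspidal_beaks_derivative \<xi> k], assumption+, goal_cases)
    case (1 V U \<phi> \<theta> \<phi>' \<theta>' \<zeta> B)
    have ker: "fst (\<zeta> x) = 0" "snd (\<zeta> x) \<noteq> 0" "6 * (snd x)\<^sup>2 = (fst x)\<^sup>2" if x: "x \<in> V" "l (\<phi> x) = 0" for x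
    proof -
      from 1(19)[OF x(1)] have *: "fst (\<zeta> x) = 0" "(6 * (snd x)\<^sup>2 - (fst x)\<^sup>2) * snd (\<zeta> x) = 0"
        unfolding x(2) by (auto simp: zero_prod_def)
      show "fst (\<zeta> x) = 0" by (rule *(1))
      from *(1) 1(17)[OF x(1)] show "snd (\<zeta> x) \<noteq> 0" by (auto simp: prod_eq_iff)
      with *(2) show "6 * (snd x)\<^sup>2 = (fst x)\<^sup>2" by simp
    qed
    let ?c = "\<lambda>s. p + s *\<^sub>R \<xi> p"
    let ?X = "\<lambda>s. \<theta> (?c s)"
    have lp: "l (\<phi> 0) = 0" using zero[of 0] 1(6) by simp
    have "\<theta> p = 0" using 1(8)[OF 1(2)] 1(6) by simp
    then have X0: "?X 0 = 0" by simp
    have c: "(?c has_derivative (\<lambda>s. s *\<^sub>R \<xi> p)) (at 0)" by (auto intro!: derivative_eq_intros)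
    have "(\<theta> has_derivative \<theta>' p) (at (?c 0))" using 1(12)[OF 1(4)] by simp
    from has_derivative_compose[OF c this]
    have "(?X has_derivative (\<lambda>s. \<theta>' p (s *\<^sub>R \<xi> p))) (at 0)" .
    moreover have "\<theta>' p (s *\<^sub>R \<xi> p) = s *\<^sub>R \<zeta> 0" for s
      using linear_cmul[OF has_derivative_linear[OF 1(12)[OF 1(4)]]] 1(15)[OF 1(2)] 1(6) by simp
    ultimately have X: "(?X has_derivative (\<lambda>s. s *\<^sub>R \<zeta> 0)) (at 0)" by (simp only:)
    have dX: "((\<lambda>s. fst (?X s)) has_real_derivative 0) (at 0)" "((\<lambda>s. snd (?X s)) has_real_derivative snd (\<zeta> 0)) (at 0)"
    proof -
      have "(*) (0::real) = (\<lambda>s. 0)" by (rule ext) simp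
      then show "((\<lambda>s. fst (?X s)) has_real_derivative 0) (at 0)"
        using has_derivative_fst[OF X] ker(1)[OF 1(2) lp] by (simp add: has_field_derivative_def)
      show "((\<lambda>s. snd (?X s)) has_real_derivative snd (\<zeta> 0)) (at 0)"
        using has_derivative_snd[OF X] by (simp add: has_field_derivative_def mult_commute_abs)
    qed
    \<comment> \<open>The equation of the two lines is divided by \<open>s^2\<close>, so that the
      difference quotients of the curve appear.\<close>
    have "((\<lambda>s. 6 * ((snd (?X (0 + s)) - snd (?X 0)) / s)\<^sup>2 - ((fst (?X (0 + s)) - fst (?X 0)) / s)\<^sup>2)
        \<longlongrightarrow> 6 * (snd (\<zeta> 0))\<^sup>2 - 0\<^sup>2) (at 0)"
      by (intro tendsto_intros dX[unfolded DERIV_def])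
    then have lim: "((\<lambda>s. 6 * (snd (?X s) / s)\<^sup>2 - (fst (?X s) / s)\<^sup>2) \<longlongrightarrow> 6 * (snd (\<zeta> 0))\<^sup>2) (at 0)"
      using X0 by simp
    have "open (?c -` U)" by (rule open_vimage[OF 1(3)]) (intro continuous_intros)
    then have "\<forall>\<^sub>F s in at 0. s \<in> ?c -` U" by (rule eventually_at_in_open') (use 1(4) in simp)
    then have "\<forall>\<^sub>F s in at 0. 6 * (snd (?X s) / s)\<^sup>2 - (fst (?X s) / s)\<^sup>2 = 0"
    proof eventually_elim
      case (elim s)
      then have s: "?c s \<in> U" by simp
      have "6 * (snd (?X s))\<^sup>2 = (fst (?X s))\<^sup>2"
        by (rule ker(3)[OF 1(9)[OF s]]) (simp only: 1(10)[OF s] zero)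
      then show ?case by (simp add: power_divide flip: diff_divide_distrib)
    qed
    from tendsto_unique[OF _ lim tendsto_eventually[OF this]] have "6 * (snd (\<zeta> 0))\<^sup>2 = 0" by simp
    then show False using ker(2)[OF 1(2) lp] by simp
  qed
qed

end

text \<open>A derivative of fixed sign puts values on both sides of \<open>\<sigma> 0\<close>, and
  the intermediate value theorem fills the gap; continuity near 0 replaces a local inverse.\<close>

lemma locally_onto_of_DERIV:
  fixes \<sigma> :: "real \<Rightarrow> real"
  assumes d: "(\<sigma> has_real_derivative d) (at 0)" "d \<noteq> 0" and r: "r > 0" and c: "\<And>s. \<bar>s\<bar> < r \<Longrightarrow> isCont \<sigma> s"
  shows "\<exists>e>0. \<forall>t. \<bar>t - \<sigma> 0\<bar> < e \<longrightarrow> (\<exists>s. \<bar>s\<bar> < r \<and> \<sigma> s = t)"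
proof -
  have main: "\<exists>e>0. \<forall>t. \<bar>t - \<sigma> 0\<bar> < e \<longrightarrow> (\<exists>s. \<bar>s\<bar> < r \<and> \<sigma> s = t)"
    if d: "(\<sigma> has_real_derivative d) (at 0)" "d > 0" and c: "\<And>s. \<bar>s\<bar> < r \<Longrightarrow> isCont \<sigma> s" for \<sigma> d
  proof -
    obtain a where a: "a > 0" "\<forall>h>0. h < a \<longrightarrow> \<sigma> 0 < \<sigma> (0 + h)" using DERIV_pos_inc_right[OF d] by blast
    obtain b where b: "b > 0" "\<forall>h>0. h < b \<longrightarrow> \<sigma> (0 - h) < \<sigma> 0" using DERIV_pos_inc_left[OF d] by blast
    define h where "h = min (min a b) r / 2"
    have h: "0 < h" "h < a" "h < b" "h < r" using a b r by (auto simp: h_def)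
    have up: "\<sigma> 0 < \<sigma> h" and lo: "\<sigma> (- h) < \<sigma> 0" using a(2) b(2) h by auto
    show ?thesis
    proof (rule exI[of _ "min (\<sigma> h - \<sigma> 0) (\<sigma> 0 - \<sigma> (- h))"], intro conjI allI impI)
      show "0 < min (\<sigma> h - \<sigma> 0) (\<sigma> 0 - \<sigma> (- h))" using up lo by simp
      fix t assume t: "\<bar>t - \<sigma> 0\<bar> < min (\<sigma> h - \<sigma> 0) (\<sigma> 0 - \<sigma> (- h))"
      have "\<exists>s\<ge>- h. s \<le> h \<and> \<sigma> s = t"
        by (rule IVT) (use t h c in auto)
      then obtain s where "- h \<le> s" "s \<le> h" "\<sigma> s = t" by blast
      then show "\<exists>s. \<bar>s\<bar> < r \<and> \<sigma> s = t" using h(4) by (intro exI[of _ s]) auto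
    qed
  qed
  show ?thesis
  proof (cases "d > 0")
    case True
    then show ?thesis by (rule main[OF d(1) _ c])
  next
    case False
    then have "- d > 0" using d(2) by simp
    from main[OF DERIV_minus[OF d(1)] this] c
    have "\<exists>e>0. \<forall>t. \<bar>t - - \<sigma> 0\<bar> < e \<longrightarrow> (\<exists>s. \<bar>s\<bar> < r \<and> - \<sigma> s = t)" by simp
    then obtain e where e: "e > 0" "\<And>t. \<bar>t - - \<sigma> 0\<bar> < e \<Longrightarrow> \<exists>s. \<bar>s\<bar> < r \<and> - \<sigma> s = t" by blast
    have "\<exists>s. \<bar>s\<bar> < r \<and> \<sigma> s = t" if "\<bar>t - \<sigma> 0\<bar> < e" for t
    proof -
      have "\<bar>- t - - \<sigma> 0\<bar> < e" using that by simp
      from e(2)[OF this] show ?thesis by simp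
    qed
    with e(1) show ?thesis by blast
  qed
qed

context degenerate_field
begin

text \<open>Here the singular set of \<open>g\<close> is a union of lines on which the first
  coordinate is constant. A singular line of the beaks whose image moves in the first coordinate
  makes \<open>n\<close> vanish on an interval, and then a whole neighbourhood would be
  singular.\<close>

lemma not_cuspidal_beaks_transversal:
  assumes inj: "\<And>y. y \<in> S \<Longrightarrow> l y \<noteq> 0 \<Longrightarrow> inj (g' y)"
    and n: "\<And>y. y \<in> S \<Longrightarrow> l y = 0 \<longleftrightarrow> n (fst y) = (0::real)"
  shows "\<not> A_equiv_at g p cuspidal_beaks 0"
proof
  assume A: "A_equiv_at g p cuspidal_beaks 0"
  show False
  proof (rule A_equiv_at_field[OF A S g' cuspidal_beaks_derivative \<xi> k], assumption+, goal_cases)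
    case (1 V U \<phi> \<theta> \<phi>' \<theta>' \<zeta> B)
    have \<phi>S: "\<phi> x \<in> S" if "x \<in> V" for x using 1(5) 1(7)[OF that] by blast
    have \<phi>c: "isCont \<phi> x" if "x \<in> V" for x by (rule has_derivative_continuous[OF 1(11)[OF that]])
    have cross: "n (fst (\<phi> x)) = 0" if x: "x \<in> V" "6 * (snd x)\<^sup>2 = (fst x)\<^sup>2" for x
    proof -
      have "\<not> inj (g' (\<phi> x))" by (rule 1(20)[OF x(1), of "(0, 1)"]) (auto simp: x(2) zero_prod_def)
      then have "l (\<phi> x) = 0" using inj[OF \<phi>S[OF x(1)]] by blast
      then show ?thesis using n[OF \<phi>S[OF x(1)]] by simp
    qed
    have L: "linear (\<lambda>h. fst (\<phi>' 0 h))"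
      by (rule has_derivative_linear[OF has_derivative_fst[OF 1(11)[OF 1(2)]]])
    \<comment> \<open>The directions of the two lines span the plane and \<open>\<phi>' 0\<close> is
      onto, so the first coordinate cannot be stationary along both.\<close>
    have "\<exists>w :: real \<times> real. 6 * (snd w)\<^sup>2 = (fst w)\<^sup>2 \<and> fst (\<phi>' 0 w) \<noteq> 0"
    proof (rule ccontr)
      assume no: "\<nexists>w :: real \<times> real. 6 * (snd w)\<^sup>2 = (fst w)\<^sup>2 \<and> fst (\<phi>' 0 w) \<noteq> 0"
      have z: "fst (\<phi>' 0 (s * sqrt 6, s)) = 0" "fst (\<phi>' 0 (- s * sqrt 6, s)) = 0" for s
        using no by (auto simp: power_mult_distrib)
      have "fst (\<phi>' 0 (a, b)) = 0" for a b
      proof -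
        \<comment> \<open>These are the coordinates of \<open>(a, b)\<close> with respect to the
          directions \<open>(sqrt 6, 1)\<close> and \<open>(- sqrt 6, 1)\<close>.\<close>
        let ?m = "(a / sqrt 6 + b) / 2" and ?n = "(b - a / sqrt 6) / 2"
        have "(a, b) = (?m * sqrt 6, ?m) + (- ?n * sqrt 6, ?n)" by (simp add: field_simps)
        then have "fst (\<phi>' 0 (a, b)) = fst (\<phi>' 0 (?m * sqrt 6, ?m)) + fst (\<phi>' 0 (- ?n * sqrt 6, ?n))"
          by (simp only: linear_add[OF L])
        then show ?thesis by (simp only: z)
      qed
      then have "fst (\<phi>' 0 h) = 0" for h by (cases h) simp
      moreover have "fst (\<phi>' 0 (\<theta>' (\<phi> 0) (1, 0))) = 1" by (simp only: 1(14)[OF 1(2)] fst_conv)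
      ultimately show False by simp
    qed
    then obtain w :: "real \<times> real" where w: "6 * (snd w)\<^sup>2 = (fst w)\<^sup>2" "fst (\<phi>' 0 w) \<noteq> 0" by blast
    let ?\<sigma> = "\<lambda>s. fst (\<phi> (s *\<^sub>R w))"
    have "open ((\<lambda>s. s *\<^sub>R w) -` V)" by (rule open_vimage[OF 1(1)]) (intro continuous_intros)
    moreover have "0 \<in> (\<lambda>s. s *\<^sub>R w) -` V" using 1(2) by simp
    ultimately obtain r where r: "r > 0" "ball 0 r \<subseteq> (\<lambda>s. s *\<^sub>R w) -` V" by (rule openE)
    have sV: "s *\<^sub>R w \<in> V" if "\<bar>s\<bar> < r" for s using r(2) that by auto
    have "((\<lambda>s. s *\<^sub>R w) has_derivative (\<lambda>s. s *\<^sub>R w)) (at 0)" by (auto intro!: derivative_eq_intros)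
    then have "(?\<sigma> has_derivative (\<lambda>s. fst (\<phi>' 0 (s *\<^sub>R w)))) (at 0)"
      by (rule has_derivative_compose) (use has_derivative_fst[OF 1(11)[OF 1(2)]] in simp)
    then have "(?\<sigma> has_real_derivative fst (\<phi>' 0 w)) (at 0)"
      by (simp add: has_field_derivative_def linear_cmul[OF L] mult_commute_abs)
    then have "\<exists>e>0. \<forall>t. \<bar>t - ?\<sigma> 0\<bar> < e \<longrightarrow> (\<exists>s. \<bar>s\<bar> < r \<and> ?\<sigma> s = t)"
    proof (rule locally_onto_of_DERIV[OF _ w(2) r(1)])
      fix s :: real assume s: "\<bar>s\<bar> < r"
      have "isCont (\<lambda>s. \<phi> (s *\<^sub>R w)) s"
        by (rule isCont_o2[where f = "\<lambda>s. s *\<^sub>R w" and g = \<phi>, OF _ \<phi>c[OF sV[OF s]]]) (intro continuous_intros)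
      then show "isCont ?\<sigma> s" by (rule isCont_fst)
    qed
    then obtain e where e: "e > 0" "\<And>t. \<bar>t - fst p\<bar> < e \<Longrightarrow> \<exists>s. \<bar>s\<bar> < r \<and> ?\<sigma> s = t"
      using 1(6) by auto
    have n0: "n t = 0" if "\<bar>t - fst p\<bar> < e" for t
    proof -
      from e(2)[OF that] obtain s where s: "\<bar>s\<bar> < r" "?\<sigma> s = t" by (elim exE conjE)
      have "n (?\<sigma> s) = 0"
        by (rule cross[OF sV[OF s(1)]]) (use w(1) in \<open>simp add: power_mult_distrib\<close>)
      then show ?thesis using s(2) by simp
    qed
    let ?O = "V \<inter> \<phi> -` (ball (fst p) e \<times> UNIV)"
    have "continuous_on V \<phi>" using \<phi>c by (auto intro: continuous_at_imp_continuous_on)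
    from continuous_open_preimage[OF this 1(1)] have "open ?O" by (simp add: open_Times)
    moreover have "0 \<in> ?O" using 1(2) 1(6) e(1) by (simp add: mem_Times_iff)
    ultimately obtain d where d: "d > 0" "ball 0 d \<subseteq> ?O" by (rule openE)
    \<comment> \<open>Off the crossing lines the beaks are immersive; a point on the u-axis other
      than the origin contradicts the vanishing of \<open>l\<close> nearby.\<close>
    let ?x = "(d / 2, 0) :: real \<times> real"
    have "?x \<in> ball 0 d" using d(1) by (simp add: norm_Pair mem_ball_0 del: mem_ball)
    from subsetD[OF d(2) this] have x: "?x \<in> V" "\<bar>fst (\<phi> ?x) - fst p\<bar> < e"
      by (simp_all add: dist_real_def abs_minus_commute mem_Times_iff)
    then have "l (\<phi> ?x) = 0" using n[OF \<phi>S[OF x(1)]] n0 by simp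
    with 1(19)[OF x(1)] have "fst (\<zeta> ?x) = 0" "snd (\<zeta> ?x) = 0" using d(1) by (auto simp: zero_prod_def)
    then show False using 1(17)[OF x(1)] by (simp add: prod_eq_iff)
  qed
qed

end

section \<open>Fibres and double points of the normal forms\<close>

lemma normal_forms_fibre:
  "cuspidal_edge x = cuspidal_edge 0 \<Longrightarrow> x = 0" "swallowtail x = swallowtail 0 \<Longrightarrow> x = 0"
  "cuspidal_cross_cap x = cuspidal_cross_cap 0 \<Longrightarrow> x = 0"
  by (cases x; simp add: cuspidal_edge_def swallowtail_def cuspidal_cross_cap_def zero_prod_def)+

lemma inj_cuspidal_edge: "inj cuspidal_edge"
proof (rule injI)
  fix x y :: "real \<times> real" assume e: "cuspidal_edge x = cuspidal_edge y"
  have "odd (3::nat)" by simp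
  then have "snd x = snd y" using e odd_real_root_unique[of 3] 
    by (cases x; cases y) (simp add: cuspidal_edge_def, metis odd_real_root_power_cancel)
  then show "x = y" using e by (cases x; cases y) (simp add: cuspidal_edge_def)
qed

lemma not_inj_on_swallowtail:
  assumes "open V" "0 \<in> V"
  shows "\<not> inj_on swallowtail V"
proof -
  \<comment> \<open>On u = - 2 v^2 the component 4 v^3 + 2 u v vanishes and the others are even in
    v: this parabola is the double point curve.\<close>
  have "open ((\<lambda>s::real. (- 2 * s^2, s)) -` V)" "open ((\<lambda>s::real. (- 2 * s^2, - s)) -` V)"
    by (rule open_vimage[OF assms(1)], intro continuous_intros)+
  then have "open ((\<lambda>s::real. (- 2 * s^2, s)) -` V \<inter> (\<lambda>s::real. (- 2 * s^2, - s)) -` V)" by (rule open_Int)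
  moreover have "0 \<in> (\<lambda>s::real. (- 2 * s^2, s)) -` V \<inter> (\<lambda>s::real. (- 2 * s^2, - s)) -` V"
    using assms(2) by (simp add: zero_prod_def)
  ultimately obtain d where d: "d > 0" "ball 0 d \<subseteq> (\<lambda>s::real. (- 2 * s^2, s)) -` V \<inter> (\<lambda>s::real. (- 2 * s^2, - s)) -` V"
    by (rule openE)
  define s where "s = d / 2"
  have "s \<in> ball 0 d" using d(1) by (simp add: s_def)
  then have s: "(- 2 * s^2, s) \<in> V" "(- 2 * s^2, - s) \<in> V" using d(2) by auto
  have "swallowtail (- 2 * s^2, s) = swallowtail (- 2 * s^2, - s)"
    by (simp add: swallowtail_def power2_eq_square power3_eq_cube)
  from inj_onD[OF _ this s] have "\<not> inj_on swallowtail V \<or> s = - s" by auto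
  moreover have "s \<noteq> - s" using d(1) by (simp add: s_def)
  ultimately show ?thesis by blast
qed

lemma not_inj_on_cuspidal_cross_cap:
  assumes "open V" "0 \<in> V"
  shows "\<not> inj_on cuspidal_cross_cap V"
proof -
  obtain d where d: "d > 0" "ball 0 d \<subseteq> V" using assms by (rule openE)
  define s where "s = d / 2"
  \<comment> \<open>The cross cap intersects itself along u = 0, where the term u v^3
    disappears.\<close>
  have "(0 :: real, s) \<in> ball 0 d" "(0 :: real, - s) \<in> ball 0 d" using d(1) by (simp_all add: s_def norm_Pair mem_ball_0 del: mem_ball)
  then have s: "(0, s) \<in> V" "(0, - s) \<in> V" using d(2) by auto
  have "cuspidal_cross_cap (0, s) = cuspidal_cross_cap (0, - s)"
    by (simp add: cuspidal_cross_cap_def)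
  from inj_onD[OF _ this s] have "\<not> inj_on cuspidal_cross_cap V \<or> s = - s" by auto
  moreover have "s \<noteq> - s" using d(1) by (simp add: s_def)
  ultimately show ?thesis by blast
qed

section \<open>The Frenet type frame\<close>

lemma vector_4:
  "(vector [x, y, z, w] :: real ^ 4) $ 1 = x" "(vector [x, y, z, w] :: real ^ 4) $ 2 = y"
  "(vector [x, y, z, w] :: real ^ 4) $ 3 = z" "(vector [x, y, z, w] :: real ^ 4) $ 4 = w"
  unfolding vector_def by simp_all

lemma lor_simps:
  "lor (x + y) z = lor x z + lor y z" "lor x (y + z) = lor x y + lor x z"
  "lor (x - y) z = lor x z - lor y z" "lor x (y - z) = lor x y - lor x z"
  "lor (c *\<^sub>R x) z = c * lor x z" "lor x (c *\<^sub>R z) = c * lor x z"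
  "lor (- x) z = - lor x z" "lor x (- z) = - lor x z" "lor 0 z = 0" "lor x 0 = 0"
  by (simp_all add: lor_def algebra_simps)

lemma lor_commute: "lor x y = lor y x"
  by (simp add: lor_def mult.commute)

lemma smooth_on_lor: "open S \<Longrightarrow> smooth_on S f \<Longrightarrow> smooth_on S g \<Longrightarrow> smooth_on S (\<lambda>t. lor (f t) (g t))"
  unfolding lor_def by (intro smooth_on_add smooth_on_mult smooth_on_minus smooth_on_nth)

lemma has_real_derivative_lor:
  assumes "(f has_vector_derivative f') (at t)" "(g has_vector_derivative g') (at t)"
  shows "((\<lambda>t. lor (f t) (g t)) has_real_derivative lor f' (g t) + lor (f t) g') (at t)"
proof -
  have f: "((\<lambda>t. f t $ i) has_real_derivative f' $ i) (at t)" for i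
    unfolding has_real_derivative_iff_has_vector_derivative
    by (rule bounded_linear.has_vector_derivative[OF bounded_linear_vec_nth assms(1)])
  have g: "((\<lambda>t. g t $ i) has_real_derivative g' $ i) (at t)" for i
    unfolding has_real_derivative_iff_has_vector_derivative
    by (rule bounded_linear.has_vector_derivative[OF bounded_linear_vec_nth assms(2)])
  show ?thesis
    unfolding lor_def by (rule derivative_eq_intros f g refl)+ (simp add: algebra_simps)
qed

lemma lor_wedge3: "lor (wedge3 x y z) x = 0" "lor (wedge3 x y z) y = 0" "lor (wedge3 x y z) z = 0"
  unfolding lor_def wedge3_def vector_4 det3_def by (simp_all add: algebra_simps)

text \<open>A Gram determinant; the sign is the determinant of the metric. For a frame with Gram
  matrix diag(-1, 1, 1) it makes the wedge product a unit spacelike vector.\<close>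

lemma lor_wedge3_self:
  "lor (wedge3 x y z) (wedge3 x y z) = - det3 (lor x x) (lor x y) (lor x z) (lor x y) (lor y y) (lor y z)
      (lor x z) (lor y z) (lor z z)"
  unfolding lor_def wedge3_def vector_4 det3_def by algebra

lemma smooth_on_wedge3:
  assumes S: "open S" and f: "smooth_on S f" "smooth_on S g" "smooth_on S h"
  shows "smooth_on S (\<lambda>t. wedge3 (f t) (g t) (h t))"
proof (rule smooth_on_vec[OF S])
  fix i :: 4
  note * = smooth_on_nth[OF S f(1)] smooth_on_nth[OF S f(2)] smooth_on_nth[OF S f(3)]
  show "smooth_on S (\<lambda>t. wedge3 (f t) (g t) (h t) $ i)"
    using exhaust_4[of i] unfolding wedge3_def det3_def
    by (elim disjE; simp only: vector_4)
       (intro smooth_on_minus smooth_on_add smooth_on_diff smooth_on_mult S *)+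
qed

text \<open>The four products \<open>?L\<close> form a left inverse of the combination
  \<open>?R\<close>, with a sign on the timelike coordinate because \<open>lor g g = -1\<close>. By
  dimension every vector has the form \<open>?R z\<close>.\<close>

lemma lor_frame_eqI:
  assumes "lor g g = -1" "lor a a = 1" "lor b b = 1" "lor m m = 1"
    "lor g a = 0" "lor g b = 0" "lor g m = 0" "lor a b = 0" "lor a m = 0" "lor b m = 0"
    and eq: "lor x g = lor y g" "lor x a = lor y a" "lor x b = lor y b" "lor x m = lor y m"
  shows "x = y"
proof -
  let ?L = "\<lambda>x. vector [lor x g, lor x a, lor x b, lor x m] :: real ^ 4"
  let ?R = "\<lambda>z :: real ^ 4. - (z $ 1) *\<^sub>R g + z $ 2 *\<^sub>R a + z $ 3 *\<^sub>R b + z $ 4 *\<^sub>R m"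
  have lin: "linear ?R"
    by (rule linearI) (simp_all add: algebra_simps)
  have LR: "?L (?R z) = z" for z
    using assms(1-10)
    by (simp add: vec_eq_iff forall_4 vector_4 lor_simps lor_commute[of a g] lor_commute[of b g]
        lor_commute[of b a] lor_commute[of m g] lor_commute[of m a] lor_commute[of m b])
  then have "inj ?R" by (rule inj_on_inverseI)
  then have "surj ?R" by (rule linear_injective_imp_surjective[OF lin _ refl])
  then obtain z w where zw: "x = ?R z" "y = ?R w" unfolding surj_def by blast
  have "?L x = ?L y" by (simp only: eq)
  then have "z = w" unfolding zw LR .
  then show ?thesis unfolding zw by (simp only:)
qed

section \<open>Frame equations and Frenet type formulas along the curve\<close>

locale frenet_curve =
  fixes I :: "real set" and \<gamma> v1 v2 :: "real \<Rightarrow> real ^ 4"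
  assumes fc: "hyp_framed_curve I \<gamma> v1 v2"
    and ab: "\<forall>t\<in>I. (ha \<gamma> v1 v2 t)^2 + (hb \<gamma> v1 v2 t)^2 \<noteq> 0"
    and AM: "\<forall>t\<in>I. (hA \<gamma> v1 v2 t)^2 > (hM \<gamma> v1 v2 t)^2"
    and MA: "\<forall>t\<in>I. hM \<gamma> v1 v2 t * deriv (hA \<gamma> v1 v2) t - deriv (hM \<gamma> v1 v2) t * hA \<gamma> v1 v2 t = 0"
begin

abbreviation "mu \<equiv> hmu \<gamma> v1 v2"
abbreviation "a \<equiv> ha \<gamma> v1 v2"
abbreviation "b \<equiv> hb \<gamma> v1 v2"
abbreviation "n \<equiv> hn \<gamma> v1 v2"
abbreviation "M \<equiv> hM \<gamma> v1 v2"
abbreviation "N \<equiv> hN \<gamma> v1 v2"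
abbreviation "A \<equiv> hA \<gamma> v1 v2"
abbreviation "n1 \<equiv> hn1 \<gamma> v1 v2"
abbreviation "n2 \<equiv> hn2 \<gamma> v1 v2"
abbreviation "D f t \<equiv> vector_derivative f (at t)"

lemma I: "open I" "is_interval I"
  and smooth_frame: "smooth_on I \<gamma>" "smooth_on I v1" "smooth_on I v2"
  using fc unfolding hyp_framed_curve_def by simp_all

lemma frame_lor:
  assumes "t \<in> I"
  shows "lor (\<gamma> t) (\<gamma> t) = -1" "lor (v1 t) (v1 t) = 1" "lor (v2 t) (v2 t) = 1" "lor (mu t) (mu t) = 1"
    "lor (\<gamma> t) (v1 t) = 0" "lor (\<gamma> t) (v2 t) = 0" "lor (\<gamma> t) (mu t) = 0"
    "lor (v1 t) (v2 t) = 0" "lor (v1 t) (mu t) = 0" "lor (v2 t) (mu t) = 0"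
    "lor (D \<gamma> t) (v1 t) = 0" "lor (D \<gamma> t) (v2 t) = 0"
proof -
  show *: "lor (\<gamma> t) (\<gamma> t) = -1" "lor (v1 t) (v1 t) = 1" "lor (v2 t) (v2 t) = 1"
    "lor (\<gamma> t) (v1 t) = 0" "lor (\<gamma> t) (v2 t) = 0" "lor (v1 t) (v2 t) = 0"
    "lor (D \<gamma> t) (v1 t) = 0" "lor (D \<gamma> t) (v2 t) = 0"
    using fc assms unfolding hyp_framed_curve_def by simp_all
  show "lor (\<gamma> t) (mu t) = 0" "lor (v1 t) (mu t) = 0" "lor (v2 t) (mu t) = 0"
    unfolding hmu_def by (subst lor_commute, rule lor_wedge3)+
  show "lor (mu t) (mu t) = 1"
    unfolding hmu_def lor_wedge3_self * det3_def by simp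
qed

lemma frame_eqI:
  assumes "t \<in> I" "lor x (\<gamma> t) = lor y (\<gamma> t)" "lor x (v1 t) = lor y (v1 t)"
    "lor x (v2 t) = lor y (v2 t)" "lor x (mu t) = lor y (mu t)"
  shows "x = y"
  by (rule lor_frame_eqI[OF frame_lor(1-10)[OF assms(1)] assms(2-5)])

lemma smooth_mu: "smooth_on I mu"
  unfolding hmu_def[abs_def] by (rule smooth_on_wedge3[OF I(1) smooth_frame])

lemma frame_deriv:
  assumes "t \<in> I"
  shows "(\<gamma> has_vector_derivative D \<gamma> t) (at t)" "(v1 has_vector_derivative D v1 t) (at t)"
    "(v2 has_vector_derivative D v2 t) (at t)" "(mu has_vector_derivative D mu t) (at t)"
  by (rule smooth_on_vector_derivative(1)[OF I(1) _ assms], rule smooth_frame smooth_mu)+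

lemma lor_const_deriv:
  assumes t: "t \<in> I" and f: "(f has_vector_derivative f') (at t)" "(g has_vector_derivative g') (at t)"
    and c: "\<And>t. t \<in> I \<Longrightarrow> lor (f t) (g t) = c"
  shows "lor f' (g t) = - lor g' (f t)"
proof -
  have "((\<lambda>t. lor (f t) (g t)) has_real_derivative 0) (at t)"
    by (rule has_field_derivative_transform_within_open[OF DERIV_const[of c] I(1) t]) (simp add: c)
  from DERIV_unique[OF has_real_derivative_lor[OF f] this] show ?thesis
    using lor_commute[of "f t" g'] by simp
qed

text \<open>Differentiating the constant products of the moving frame yields all products of the
  derivatives with the frame, and these determine the derivatives.\<close>

lemma frame_equations:
  assumes t: "t \<in> I"
  shows "D \<gamma> t = M t *\<^sub>R mu t" "D v1 t = n t *\<^sub>R v2 t + a t *\<^sub>R mu t"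
    "D v2 t = - n t *\<^sub>R v1 t + b t *\<^sub>R mu t" "D mu t = M t *\<^sub>R \<gamma> t - a t *\<^sub>R v1 t - b t *\<^sub>R v2 t"
proof -
  note d = frame_deriv[OF t] and l = frame_lor[OF t]
  have l': "lor (v1 t) (\<gamma> t) = 0" "lor (v2 t) (\<gamma> t) = 0" "lor (mu t) (\<gamma> t) = 0"
    "lor (v2 t) (v1 t) = 0" "lor (mu t) (v1 t) = 0" "lor (mu t) (v2 t) = 0"
    by (subst lor_commute, rule l)+
  note c = lor_const_deriv[OF t]
  have self: "lor (D \<gamma> t) (\<gamma> t) = 0" "lor (D v1 t) (v1 t) = 0" "lor (D v2 t) (v2 t) = 0" "lor (D mu t) (mu t) = 0"
    using c[OF d(1) d(1) frame_lor(1)] c[OF d(2) d(2) frame_lor(2)] c[OF d(3) d(3) frame_lor(3)]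
      c[OF d(4) d(4) frame_lor(4)] by linarith+
  have mix: "lor (D v1 t) (\<gamma> t) = 0" "lor (D v2 t) (\<gamma> t) = 0" "lor (D mu t) (\<gamma> t) = - M t"
    "lor (D v2 t) (v1 t) = - n t" "lor (D mu t) (v1 t) = - a t" "lor (D mu t) (v2 t) = - b t"
    using c[OF d(1) d(2) frame_lor(5)] c[OF d(1) d(3) frame_lor(6)] c[OF d(1) d(4) frame_lor(7)]
      c[OF d(2) d(3) frame_lor(8)] c[OF d(2) d(4) frame_lor(9)] c[OF d(3) d(4) frame_lor(10)] l(11,12)
    by (simp_all add: hM_def hm_def hn_def ha_def hb_def)
  have def: "lor (D \<gamma> t) (mu t) = M t" "lor (D v1 t) (v2 t) = n t" "lor (D v1 t) (mu t) = a t" "lor (D v2 t) (mu t) = b t"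
    by (simp_all add: hM_def hm_def hn_def ha_def hb_def)
  show "D \<gamma> t = M t *\<^sub>R mu t" "D v1 t = n t *\<^sub>R v2 t + a t *\<^sub>R mu t"
    "D v2 t = - n t *\<^sub>R v1 t + b t *\<^sub>R mu t" "D mu t = M t *\<^sub>R \<gamma> t - a t *\<^sub>R v1 t - b t *\<^sub>R v2 t"
    by (rule frame_eqI[OF t]; simp add: lor_simps l l' self mix def)+
qed

lemma smooth_invariants: "smooth_on I a" "smooth_on I b" "smooth_on I n" "smooth_on I M"
proof -
  note v = smooth_on_vector_derivative(2)[OF I(1)]
  show "smooth_on I a" "smooth_on I b" "smooth_on I n" "smooth_on I M"
    unfolding ha_def[abs_def] hb_def[abs_def] hn_def[abs_def] hM_def[abs_def] hm_def
    by (rule smooth_on_lor[OF I(1) v], rule smooth_frame, rule smooth_mu smooth_frame)+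
qed

lemma A_pos: "t \<in> I \<Longrightarrow> (a t)^2 + (b t)^2 > 0" "t \<in> I \<Longrightarrow> A t > 0" "t \<in> I \<Longrightarrow> (A t)^2 = (a t)^2 + (b t)^2"
proof -
  assume "t \<in> I"
  then have "(a t)^2 + (b t)^2 \<noteq> 0" using ab by blast
  moreover have "(a t)^2 + (b t)^2 \<ge> 0" by simp
  ultimately show *: "(a t)^2 + (b t)^2 > 0" by linarith
  then show "A t > 0" "(A t)^2 = (a t)^2 + (b t)^2" by (simp_all add: hA_def)
qed

lemma smooth_A: "smooth_on I A"
  unfolding hA_def[abs_def]
  by (rule smooth_on_sqrt[OF I(1) smooth_on_add[OF I(1) smooth_on_power[OF I(1) smooth_invariants(1)]
        smooth_on_power[OF I(1) smooth_invariants(2)]] A_pos(1)])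

lemma smooth_N: "smooth_on I N"
proof -
  note s = smooth_invariants and d = smooth_on_deriv(2)[OF I(1)]
  have "smooth_on I (\<lambda>t. (a t)^2 + (b t)^2)"
    by (intro smooth_on_add smooth_on_power I(1) s)
  moreover have "smooth_on I (hf \<gamma> v1 v2)"
    unfolding hf_def[abs_def]
    by (intro smooth_on_add[OF I(1)] smooth_on_diff[OF I(1)] smooth_on_mult[OF I(1)] smooth_on_power[OF I(1)]
          s d[OF s(1)] d[OF s(2)])
  ultimately show ?thesis
    unfolding hN_def[abs_def] using ab by (intro smooth_on_divide[OF I(1)]) auto
qed

lemma smooth_normals: "smooth_on I n1" "smooth_on I n2"
proof -
  have i: "smooth_on I (\<lambda>t. 1 / A t)"
    by (rule smooth_on_divide[OF I(1) smooth_on_const[OF I(1)] smooth_A]) (use A_pos(2) in force)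
  note s = smooth_invariants and f = smooth_frame
  show "smooth_on I n1"
    unfolding hn1_def[abs_def]
    by (rule smooth_on_scaleR[OF I(1) i smooth_on_add[OF I(1) smooth_on_scaleR[OF I(1) s(1) f(2)] smooth_on_scaleR[OF I(1) s(2) f(3)]]])
  show "smooth_on I n2"
    unfolding hn2_def[abs_def]
    by (rule smooth_on_scaleR[OF I(1) i smooth_on_add[OF I(1) smooth_on_scaleR[OF I(1) smooth_on_minus[OF I(1) s(2)] f(2)] smooth_on_scaleR[OF I(1) s(1) f(3)]]])
qed

lemma A_deriv:
  assumes t: "t \<in> I"
  shows "(A has_real_derivative (a t * deriv a t + b t * deriv b t) / A t) (at t)"
proof -
  note dA = smooth_on_deriv(1)[OF I(1) smooth_A t]
    and da = smooth_on_deriv(1)[OF I(1) smooth_invariants(1) t]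
    and db = smooth_on_deriv(1)[OF I(1) smooth_invariants(2) t]
  have e: "of_nat 2 * (x * y ^ (2 - Suc 0)) = 2 * (x * y)" for x y :: real by simp
  have "((\<lambda>t. (A t)^2) has_real_derivative 2 * (deriv a t * a t) + 2 * (deriv b t * b t)) (at t)"
    by (rule has_field_derivative_transform_within_open
          [OF DERIV_add[OF DERIV_power[OF da, of 2, unfolded e] DERIV_power[OF db, of 2, unfolded e]] I(1) t])
       (rule A_pos(3)[symmetric])
  from DERIV_unique[OF DERIV_power[OF dA, of 2, unfolded e] this]
  have "deriv A t * A t = a t * deriv a t + b t * deriv b t" by (simp only: mult.commute)
  then have "deriv A t = (a t * deriv a t + b t * deriv b t) / A t"
    using A_pos(2)[OF t] by (metis less_irrefl nonzero_eq_divide_eq)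
  with dA show ?thesis by (simp only:)
qed

text \<open>These are the coefficients of \<open>v1\<close> and \<open>v2\<close> in the derivative
  of \<open>n1\<close>, with \<open>da\<close> and \<open>db\<close> for the derivatives of
  \<open>a\<close> and \<open>b\<close>; up to sign and order they also serve for \<open>n2\<close>.
  Over the common denominator \<open>A^2 * A\<close> only a polynomial identity is left.\<close>

lemma frenet_coefficient_identity:
  fixes A a b n da db :: real
  assumes "A > 0" "A^2 = a^2 + b^2"
  shows "- (a * da + b * db) / A / A^2 * a + 1 / A * (da - n * b) = (a * db - da * b + n * (a^2 + b^2)) / (a^2 + b^2) * (- b / A)"
    and "- (a * da + b * db) / A / A^2 * b + 1 / A * (db + n * a) = (a * db - da * b + n * (a^2 + b^2)) / (a^2 + b^2) * (a / A)"
proof -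
  have e: "x / A / A^2 * y + 1 / A * z = (x * y + z * A^2) / (A^2 * A)" for x y z
    using assms(1) by (simp add: field_simps)
  have e2: "x / A^2 * (y / A) = (x * y) / (A^2 * A)" for x y by simp
  have p: "- (a * da + b * db) * a + (da - n * b) * A^2 = (a * db - da * b + n * A^2) * (- b)"
    "- (a * da + b * db) * b + (db + n * a) * A^2 = (a * db - da * b + n * A^2) * a"
    unfolding assms(2) by algebra+
  show "- (a * da + b * db) / A / A^2 * a + 1 / A * (da - n * b) = (a * db - da * b + n * (a^2 + b^2)) / (a^2 + b^2) * (- b / A)"
    "- (a * da + b * db) / A / A^2 * b + 1 / A * (db + n * a) = (a * db - da * b + n * (a^2 + b^2)) / (a^2 + b^2) * (a / A)"
    unfolding assms(2)[symmetric] e e2 p by (rule refl)+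
qed

lemma normal_deriv:
  assumes t: "t \<in> I"
  shows "(n1 has_vector_derivative N t *\<^sub>R n2 t + A t *\<^sub>R mu t) (at t)"
    and "(n2 has_vector_derivative - N t *\<^sub>R n1 t) (at t)"
proof -
  note A = A_pos(2)[OF t] and A2 = A_pos(3)[OF t]
  note da = smooth_on_deriv(1)[OF I(1) smooth_invariants(1) t]
    and db = smooth_on_deriv(1)[OF I(1) smooth_invariants(2) t]
  let ?da = "deriv a t" and ?db = "deriv b t"
  let ?i = "- (a t * ?da + b t * ?db) / A t / (A t)^2"
  have i: "((\<lambda>t. 1 / A t) has_real_derivative ?i) (at t)"
  proof -
    have "(0 * x - 1 * (w / x)) / (x * x) = - w / x / x^2" for x w :: real by (simp add: power2_eq_square)
    then show ?thesis
      using DERIV_divide[OF DERIV_const[of 1] A_deriv[OF t]] A by (simp only: less_imp_neq[OF A, symmetric] simp_thms not_False_eq_True)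
  qed
  note id = frenet_coefficient_identity[OF A A2, of ?da ?db "n t"]
  have N: "N t = (a t * ?db - ?da * b t + n t * ((a t)^2 + (b t)^2)) / ((a t)^2 + (b t)^2)"
    by (simp add: hN_def hf_def)
  have id1: "?i * a t + 1 / A t * (?da - n t * b t) = N t * (- b t / A t)"
    and id2: "?i * b t + 1 / A t * (?db + n t * a t) = N t * (a t / A t)"
    unfolding N by (rule id)+
  have id3: "((a t)^2 + (b t)^2) / A t = A t"
    unfolding A2[symmetric] using A by (simp add: power2_eq_square)
  have v1: "(v1 has_vector_derivative n t *\<^sub>R v2 t + a t *\<^sub>R mu t) (at t)"
    and v2: "(v2 has_vector_derivative - n t *\<^sub>R v1 t + b t *\<^sub>R mu t) (at t)"
    using frame_deriv(2,3)[OF t] unfolding frame_equations(2,3)[OF t] .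
  have "(n1 has_vector_derivative (1 / A t) *\<^sub>R ((a t *\<^sub>R (n t *\<^sub>R v2 t + a t *\<^sub>R mu t) + ?da *\<^sub>R v1 t)
      + (b t *\<^sub>R (- n t *\<^sub>R v1 t + b t *\<^sub>R mu t) + ?db *\<^sub>R v2 t)) + ?i *\<^sub>R (a t *\<^sub>R v1 t + b t *\<^sub>R v2 t)) (at t)"
    unfolding hn1_def[abs_def]
    by (intro has_vector_derivative_scaleR has_vector_derivative_add i da db v1 v2)
  also have "(1 / A t) *\<^sub>R ((a t *\<^sub>R (n t *\<^sub>R v2 t + a t *\<^sub>R mu t) + ?da *\<^sub>R v1 t)
      + (b t *\<^sub>R (- n t *\<^sub>R v1 t + b t *\<^sub>R mu t) + ?db *\<^sub>R v2 t)) + ?i *\<^sub>R (a t *\<^sub>R v1 t + b t *\<^sub>R v2 t)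
    = (?i * a t + 1 / A t * (?da - n t * b t)) *\<^sub>R v1 t + (?i * b t + 1 / A t * (?db + n t * a t)) *\<^sub>R v2 t
      + (((a t)^2 + (b t)^2) / A t) *\<^sub>R mu t"
    by (simp add: vec_eq_iff algebra_simps power2_eq_square add_divide_distrib diff_divide_distrib)
  also have "\<dots> = N t *\<^sub>R n2 t + A t *\<^sub>R mu t"
    unfolding id1 id2 id3 hn2_def by (simp add: algebra_simps)
  finally show "(n1 has_vector_derivative N t *\<^sub>R n2 t + A t *\<^sub>R mu t) (at t)" .
  have "(n2 has_vector_derivative (1 / A t) *\<^sub>R ((- b t *\<^sub>R (n t *\<^sub>R v2 t + a t *\<^sub>R mu t) + - ?db *\<^sub>R v1 t)
      + (a t *\<^sub>R (- n t *\<^sub>R v1 t + b t *\<^sub>R mu t) + ?da *\<^sub>R v2 t)) + ?i *\<^sub>R (- b t *\<^sub>R v1 t + a t *\<^sub>R v2 t)) (at t)"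
    unfolding hn2_def[abs_def]
    by (intro has_vector_derivative_scaleR has_vector_derivative_add DERIV_minus i da db v1 v2)
  also have "(1 / A t) *\<^sub>R ((- b t *\<^sub>R (n t *\<^sub>R v2 t + a t *\<^sub>R mu t) + - ?db *\<^sub>R v1 t)
      + (a t *\<^sub>R (- n t *\<^sub>R v1 t + b t *\<^sub>R mu t) + ?da *\<^sub>R v2 t)) + ?i *\<^sub>R (- b t *\<^sub>R v1 t + a t *\<^sub>R v2 t)
    = - (?i * b t + 1 / A t * (?db + n t * a t)) *\<^sub>R v1 t + (?i * a t + 1 / A t * (?da - n t * b t)) *\<^sub>R v2 t"
    by (simp add: vec_eq_iff algebra_simps add_divide_distrib diff_divide_distrib)
  also have "\<dots> = - N t *\<^sub>R n1 t"
    unfolding id1 id2 hn1_def by (simp add: algebra_simps)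
  finally show "(n2 has_vector_derivative - N t *\<^sub>R n1 t) (at t)" .
qed

lemma ratio_constant: "\<exists>c. (\<forall>t\<in>I. M t = c * A t) \<and> c^2 < 1" if "t0 \<in> I"
proof -
  have "((\<lambda>t. M t / A t) has_real_derivative 0) (at t within I)" if t: "t \<in> I" for t
  proof -
    have "((\<lambda>t. M t / A t) has_real_derivative (deriv M t * A t - M t * deriv A t) / (A t * A t)) (at t)"
      by (rule DERIV_divide[OF smooth_on_deriv(1)[OF I(1) smooth_invariants(4) t] smooth_on_deriv(1)[OF I(1) smooth_A t]])
         (use A_pos(2)[OF t] in simp)
    moreover have "deriv M t * A t - M t * deriv A t = 0" using MA t by fastforce
    ultimately show ?thesis by (simp add: has_field_derivative_at_within)
  qed
  from has_field_derivative_zero_constant[OF is_interval_convex[OF I(2)] this]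
  obtain c where c: "\<And>t. t \<in> I \<Longrightarrow> M t / A t = c" by blast
  have Mc: "M t = c * A t" if "t \<in> I" for t
    using c[OF that] A_pos(2)[OF that] by (simp add: divide_eq_eq)
  have "(c * A t0)^2 < (A t0)^2" using bspec[OF AM that] unfolding Mc[OF that] .
  then have "c^2 * (A t0)^2 < 1 * (A t0)^2" by (simp add: power_mult_distrib)
  then have "c^2 < 1" using A_pos(2)[OF that] by (subst (asm) mult_less_cancel_right_pos) simp_all
  then show ?thesis using Mc by blast
qed

end

section \<open>The focal surface for constant M/A\<close>

lemma bounded_linear_chartH: "bounded_linear chartH"
  unfolding chartH_def[abs_def] by (intro bounded_linear_Pair bounded_linear_vec_nth)

lemma chartH_simps: "chartH (x + y) = chartH x + chartH y" "chartH (c *\<^sub>R x) = c *\<^sub>R chartH x"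
  using bounded_linear_chartH by (simp_all add: bounded_linear.linear linear_add linear_cmul)

text \<open>A timelike \<open>x\<close> has \<open>x $ 1\<close> nonzero, so orthogonality to
  \<open>x\<close> recovers the coordinate that the chart drops. Independence in R^4 thus carries
  over to the chart.\<close>

lemma chartH_eq_0_imp:
  assumes "chartH z = 0" "lor x z = 0" "lor x x = -1"
  shows "z = 0"
proof -
  have z: "z $ 2 = 0" "z $ 3 = 0" "z $ 4 = 0" using assms(1) by (simp_all add: chartH_def zero_prod_def)
  have "x $ 1 \<noteq> 0"
  proof
    assume "x $ 1 = 0"
    then have "lor x x = (x $ 2)^2 + (x $ 3)^2 + (x $ 4)^2" by (simp add: lor_def power2_eq_square)
    then have "lor x x \<ge> 0" by simp
    then show False using assms(3) by simp
  qed
  then have "z $ 1 = 0" using assms(2) z by (simp add: lor_def)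
  with z show ?thesis by (simp add: vec_eq_iff forall_4)
qed

text \<open>The product will be the first derivative of the surface along the kernel, so
  \<open>p2\<close> and \<open>p3\<close> are its second and third. Since
  \<open>\<rho> 0 = 0\<close>, the second derivative of \<open>k\<close> drops out of
  \<open>p3\<close>.\<close>

lemma scaleR_product_derivatives:
  fixes \<rho> :: "real \<Rightarrow> real" and k :: "real \<Rightarrow> 'b::real_normed_vector"
  assumes \<rho>: "smooth_on UNIV \<rho>" "\<rho> 0 = 0" and k: "smooth_on UNIV k"
  obtains p2 p3 where "\<And>v. ((\<lambda>v. \<rho> v *\<^sub>R k v) has_vector_derivative p2 v) (at v)"
    "(p2 has_vector_derivative p3) (at 0)" "p2 0 = deriv \<rho> 0 *\<^sub>R k 0"
    "p3 = deriv (deriv \<rho>) 0 *\<^sub>R k 0 + (2 * deriv \<rho> 0) *\<^sub>R vector_derivative k (at 0)"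
proof -
  note r = smooth_on_deriv[OF open_UNIV \<rho>(1)]
  note rr = smooth_on_deriv(1)[OF open_UNIV r(2) UNIV_I]
  note kk = smooth_on_vector_derivative[OF open_UNIV k]
  note kkk = smooth_on_vector_derivative(1)[OF open_UNIV kk(2) UNIV_I]
  let ?p2 = "\<lambda>v. \<rho> v *\<^sub>R vector_derivative k (at v) + deriv \<rho> v *\<^sub>R k v"
  show ?thesis
  proof (rule that[of ?p2])
    show "((\<lambda>v. \<rho> v *\<^sub>R k v) has_vector_derivative ?p2 v) (at v)" for v
      by (rule has_vector_derivative_scaleR[OF r(1)[OF UNIV_I] kk(1)[OF UNIV_I]])
    show "(?p2 has_vector_derivative
        ((\<rho> 0 *\<^sub>R vector_derivative (\<lambda>x. vector_derivative k (at x)) (at 0) + deriv \<rho> 0 *\<^sub>R vector_derivative k (at 0))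
        + (deriv \<rho> 0 *\<^sub>R vector_derivative k (at 0) + deriv (deriv \<rho>) 0 *\<^sub>R k 0))) (at 0)"
      by (intro has_vector_derivative_add has_vector_derivative_scaleR r(1)[OF UNIV_I] rr kk(1)[OF UNIV_I] kkk)
    show "?p2 0 = deriv \<rho> 0 *\<^sub>R k 0" by (simp add: \<rho>(2))
    show "(\<rho> 0 *\<^sub>R vector_derivative (\<lambda>x. vector_derivative k (at x)) (at 0) + deriv \<rho> 0 *\<^sub>R vector_derivative k (at 0))
        + (deriv \<rho> 0 *\<^sub>R vector_derivative k (at 0) + deriv (deriv \<rho>) 0 *\<^sub>R k 0)
      = deriv (deriv \<rho>) 0 *\<^sub>R k 0 + (2 * deriv \<rho> 0) *\<^sub>R vector_derivative k (at 0)"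
      by (simp add: \<rho>(2) scaleR_2 flip: scaleR_scaleR)
  qed
qed

locale constant_ratio_curve = frenet_curve +
  fixes c :: real
  assumes c: "\<And>t. t \<in> I \<Longrightarrow> M t = c * A t" "c^2 < 1"
begin

definition "s = sqrt (1 - c^2)"
text \<open>\<open>e\<close> and \<open>g\<close> arise from \<open>\<gamma>\<close> and
  \<open>n1\<close> by the Lorentz boost of velocity \<open>c\<close>. It cancels \<open>mu\<close>
  in the derivative of \<open>e\<close>: the derivative of \<open>\<gamma>\<close> is
  \<open>(c * A t) *\<^sub>R mu t\<close>, and that of \<open>n1\<close> contains
  \<open>A t *\<^sub>R mu t\<close>.\<close>

definition "e t = (1 / s) *\<^sub>R (\<gamma> t - c *\<^sub>R n1 t)"
definition "g t = (1 / s) *\<^sub>R (n1 t - c *\<^sub>R \<gamma> t)"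
definition "nu t = N t / s"
definition "kap t = c * nu t"
definition "X z = cosh (snd z) *\<^sub>R e (fst z) + sinh (snd z) *\<^sub>R n2 (fst z)"
definition "Xth z = sinh (snd z) *\<^sub>R e (fst z) + cosh (snd z) *\<^sub>R n2 (fst z)"
text \<open>Over the curve's domain \<open>Xth\<close> and \<open>g\<close> are orthonormal, so this
  form of the differential shows that the rank drops exactly where the coefficient of
  \<open>g\<close> vanishes.\<close>

definition "dX z h = fst h *\<^sub>R (- kap (fst z) *\<^sub>R Xth z - (nu (fst z) * sinh (snd z)) *\<^sub>R g (fst z)) + snd h *\<^sub>R Xth z"
definition "l z = - (nu (fst z) * sinh (snd z))"

abbreviation "F \<equiv> focal_h \<gamma> v1 v2"

lemma s: "s > 0" "s^2 = 1 - c^2" "s \<noteq> 0"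
  using c(2) by (simp_all add: s_def)

lemma focal_eq:
  assumes "fst z \<in> I"
  shows "F z = X z"
proof -
  obtain t \<theta> where z: "z = (t, \<theta>)" by (cases z)
  have t: "t \<in> I" using assms z by simp
  have "(A t)^2 - (M t)^2 = (s * A t)^2"
    unfolding c(1)[OF t] power_mult_distrib s(2) by (simp add: algebra_simps)
  then have q: "sqrt ((A t)^2 - (M t)^2) = s * A t"
    using s(1) A_pos(2)[OF t] by simp
  have "(cosh \<theta> / (s * A t)) *\<^sub>R (A t *\<^sub>R \<gamma> t - (c * A t) *\<^sub>R n1 t) = cosh \<theta> *\<^sub>R e t"
    using s(1) A_pos(2)[OF t] by (simp add: e_def vec_eq_iff field_simps)
  then show ?thesis
    unfolding z focal_h_def X_def prod.case q unfolding c(1)[OF t] by simp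
qed

lemma n1_eq: "n1 t = (1 / s) *\<^sub>R (g t + c *\<^sub>R e t)"
proof -
  have "g t + c *\<^sub>R e t = ((1 - c^2) / s) *\<^sub>R n1 t"
    by (simp add: g_def e_def algebra_simps power2_eq_square diff_divide_distrib)
  also have "(1 - c^2) / s = s" unfolding s(2)[symmetric] by (simp add: power2_eq_square)
  finally show ?thesis using s(3) by simp
qed

lemma basis_deriv:
  assumes t: "t \<in> I"
  shows "(e has_vector_derivative - kap t *\<^sub>R n2 t) (at t)"
    and "(g has_vector_derivative nu t *\<^sub>R n2 t + (s * A t) *\<^sub>R mu t) (at t)"
    and "(n2 has_vector_derivative - nu t *\<^sub>R (g t + c *\<^sub>R e t)) (at t)"
proof -
  have \<gamma>: "(\<gamma> has_vector_derivative (c * A t) *\<^sub>R mu t) (at t)"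
    using frame_deriv(1)[OF t] unfolding frame_equations(1)[OF t] c(1)[OF t] .
  note n = normal_deriv[OF t]
  have "(e has_vector_derivative (1 / s) *\<^sub>R ((c * A t) *\<^sub>R mu t - c *\<^sub>R (N t *\<^sub>R n2 t + A t *\<^sub>R mu t))) (at t)"
    unfolding e_def[abs_def]
    by (intro bounded_linear.has_vector_derivative[OF bounded_linear_scaleR_right] has_vector_derivative_diff \<gamma> n)
  moreover have "(1 / s) *\<^sub>R ((c * A t) *\<^sub>R mu t - c *\<^sub>R (N t *\<^sub>R n2 t + A t *\<^sub>R mu t)) = - kap t *\<^sub>R n2 t"
    by (simp add: kap_def nu_def algebra_simps)
  ultimately show "(e has_vector_derivative - kap t *\<^sub>R n2 t) (at t)" by (simp only:)
  have "(g has_vector_derivative (1 / s) *\<^sub>R ((N t *\<^sub>R n2 t + A t *\<^sub>R mu t) - c *\<^sub>R ((c * A t) *\<^sub>R mu t))) (at t)"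
    unfolding g_def[abs_def]
    by (intro bounded_linear.has_vector_derivative[OF bounded_linear_scaleR_right] has_vector_derivative_diff \<gamma> n)
  moreover have "(1 / s) *\<^sub>R ((N t *\<^sub>R n2 t + A t *\<^sub>R mu t) - c *\<^sub>R ((c * A t) *\<^sub>R mu t)) = nu t *\<^sub>R n2 t + (s * A t) *\<^sub>R mu t"
  proof -
    have "(1 / s) * (A t - c * (c * A t)) = s * A t"
    proof -
      have "A t - c * (c * A t) = s^2 * A t" unfolding s(2) by (simp add: algebra_simps power2_eq_square)
      then show ?thesis using s(3) by (simp add: power2_eq_square)
    qed
    moreover have "(1 / s) *\<^sub>R ((N t *\<^sub>R n2 t + A t *\<^sub>R mu t) - c *\<^sub>R ((c * A t) *\<^sub>R mu t))
        = nu t *\<^sub>R n2 t + ((1 / s) * (A t - c * (c * A t))) *\<^sub>R mu t"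
      by (simp add: nu_def algebra_simps)
    ultimately show ?thesis by (simp only:)
  qed
  ultimately show "(g has_vector_derivative nu t *\<^sub>R n2 t + (s * A t) *\<^sub>R mu t) (at t)" by (simp only:)
  have "- N t *\<^sub>R n1 t = - nu t *\<^sub>R (g t + c *\<^sub>R e t)" unfolding n1_eq nu_def by simp
  then show "(n2 has_vector_derivative - nu t *\<^sub>R (g t + c *\<^sub>R e t)) (at t)" using n(2) by (simp only:)
qed

lemma basis_lor:
  assumes t: "t \<in> I"
  shows "lor (e t) (e t) = -1" "lor (g t) (g t) = 1" "lor (n2 t) (n2 t) = 1" "lor (mu t) (mu t) = 1"
    "lor (e t) (g t) = 0" "lor (e t) (n2 t) = 0" "lor (e t) (mu t) = 0"
    "lor (g t) (n2 t) = 0" "lor (g t) (mu t) = 0" "lor (n2 t) (mu t) = 0"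
    "lor (g t) (e t) = 0" "lor (n2 t) (e t) = 0" "lor (mu t) (e t) = 0"
    "lor (n2 t) (g t) = 0" "lor (mu t) (g t) = 0" "lor (mu t) (n2 t) = 0"
proof -
  note l = frame_lor[OF t]
  have l': "lor (v1 t) (\<gamma> t) = 0" "lor (v2 t) (\<gamma> t) = 0" "lor (v2 t) (v1 t) = 0"
    by (subst lor_commute, rule l)+
  have A: "A t \<noteq> 0" "a t * a t + b t * b t = A t * A t"
    using A_pos(2,3)[OF t] by (simp_all add: power2_eq_square)
  have nn: "lor (n1 t) (n1 t) = 1" "lor (n2 t) (n2 t) = 1" "lor (n1 t) (n2 t) = 0"
    "lor (\<gamma> t) (n1 t) = 0" "lor (\<gamma> t) (n2 t) = 0" "lor (n1 t) (mu t) = 0" "lor (n2 t) (mu t) = 0" "lor (n1 t) (\<gamma> t) = 0"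
  proof -
    have "lor (n1 t) (n1 t) = (1 / A t) * ((1 / A t) * (a t * a t + b t * b t))"
      "lor (n2 t) (n2 t) = (1 / A t) * ((1 / A t) * (a t * a t + b t * b t))"
      by (simp_all add: hn1_def hn2_def lor_simps l l' algebra_simps)
    then show "lor (n1 t) (n1 t) = 1" "lor (n2 t) (n2 t) = 1" unfolding A(2) using A(1) by simp_all
    show "lor (n1 t) (n2 t) = 0" "lor (\<gamma> t) (n1 t) = 0" "lor (\<gamma> t) (n2 t) = 0" "lor (n1 t) (mu t) = 0" "lor (n2 t) (mu t) = 0"
      "lor (n1 t) (\<gamma> t) = 0"
      by (simp_all add: hn1_def hn2_def lor_simps l l')
  qed
  have sc: "(1 / s) * ((1 / s) * (1 - c * c)) = 1"
    using s(2,3) by (simp add: power2_eq_square field_simps)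
  have "lor (e t) (e t) = - ((1 / s) * ((1 / s) * (1 - c * c)))" "lor (g t) (g t) = (1 / s) * ((1 / s) * (1 - c * c))"
    by (simp_all add: e_def g_def lor_simps nn l algebra_simps)
  then show ee: "lor (e t) (e t) = -1" "lor (g t) (g t) = 1" unfolding sc by simp_all
  show m: "lor (n2 t) (n2 t) = 1" "lor (mu t) (mu t) = 1"
    "lor (e t) (g t) = 0" "lor (e t) (n2 t) = 0" "lor (e t) (mu t) = 0"
    "lor (g t) (n2 t) = 0" "lor (g t) (mu t) = 0" "lor (n2 t) (mu t) = 0"
    by (simp_all add: e_def g_def lor_simps nn l)
  show "lor (g t) (e t) = 0" "lor (n2 t) (e t) = 0" "lor (mu t) (e t) = 0"
    "lor (n2 t) (g t) = 0" "lor (mu t) (g t) = 0" "lor (mu t) (n2 t) = 0"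
    by (subst lor_commute, rule m)+
qed

lemma X_lor:
  assumes t: "fst z \<in> I"
  shows "lor (X z) (X z) = -1" "lor (Xth z) (Xth z) = 1" "lor (X z) (Xth z) = 0"
    "lor (X z) (g (fst z)) = 0" "lor (Xth z) (g (fst z)) = 0" "lor (g (fst z)) (Xth z) = 0"
    "lor (X z) (mu (fst z)) = 0" "lor (Xth z) (mu (fst z)) = 0" "lor (X z) (n2 (fst z)) = sinh (snd z)"
proof -
  have h: "cosh x * cosh x = 1 + sinh x * sinh x" for x :: real
    using cosh_square_eq[of x] by (simp add: power2_eq_square)
  show "lor (X z) (X z) = -1" "lor (Xth z) (Xth z) = 1" "lor (X z) (Xth z) = 0"
    "lor (X z) (g (fst z)) = 0" "lor (Xth z) (g (fst z)) = 0" "lor (g (fst z)) (Xth z) = 0"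
    "lor (X z) (mu (fst z)) = 0" "lor (Xth z) (mu (fst z)) = 0" "lor (X z) (n2 (fst z)) = sinh (snd z)"
    by (simp_all add: X_def Xth_def lor_simps basis_lor[OF t] h)
qed

lemma X_derivative:
  assumes t: "fst z \<in> I"
  shows "(X has_derivative dX z) (at z)"
proof -
  note d = basis_deriv[OF t]
  have f: "(fst has_derivative fst) (at z)" by (auto intro!: derivative_eq_intros)
  have comp: "((\<lambda>z. p (fst z)) has_derivative (\<lambda>h. fst h *\<^sub>R p')) (at z)"
    if "(p has_vector_derivative p') (at (fst z))" for p :: "real \<Rightarrow> real ^ 4" and p'
    by (rule has_derivative_compose[OF f that[unfolded has_vector_derivative_def]])
  have ch: "((\<lambda>z :: real \<times> real. cosh (snd z)) has_derivative (\<lambda>h. snd h * sinh (snd z))) (at z)"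
  proof -
    have "(cosh has_real_derivative sinh (snd z)) (at (snd z))" by (auto intro!: derivative_eq_intros)
    then have "(cosh has_derivative (\<lambda>x. x * sinh (snd z))) (at (snd z))"
      by (simp add: has_field_derivative_def mult_commute_abs)
    from has_derivative_compose[OF bounded_linear_imp_has_derivative[OF bounded_linear_snd] this]
    show ?thesis .
  qed
  have sh: "((\<lambda>z :: real \<times> real. sinh (snd z)) has_derivative (\<lambda>h. snd h * cosh (snd z))) (at z)"
  proof -
    have "(sinh has_real_derivative cosh (snd z)) (at (snd z))" by (auto intro!: derivative_eq_intros)
    then have "(sinh has_derivative (\<lambda>x. x * cosh (snd z))) (at (snd z))"
      by (simp add: has_field_derivative_def mult_commute_abs)
    from has_derivative_compose[OF bounded_linear_imp_has_derivative[OF bounded_linear_snd] this]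
    show ?thesis .
  qed
  have "(X has_derivative (\<lambda>h. (cosh (snd z) *\<^sub>R (fst h *\<^sub>R (- kap (fst z) *\<^sub>R n2 (fst z))) + (snd h * sinh (snd z)) *\<^sub>R e (fst z))
      + (sinh (snd z) *\<^sub>R (fst h *\<^sub>R (- nu (fst z) *\<^sub>R (g (fst z) + c *\<^sub>R e (fst z)))) + (snd h * cosh (snd z)) *\<^sub>R n2 (fst z)))) (at z)"
    unfolding X_def[abs_def]
    by (intro has_derivative_add has_derivative_scaleR ch sh comp d)
  moreover have "(\<lambda>h. (cosh (snd z) *\<^sub>R (fst h *\<^sub>R (- kap (fst z) *\<^sub>R n2 (fst z))) + (snd h * sinh (snd z)) *\<^sub>R e (fst z))
      + (sinh (snd z) *\<^sub>R (fst h *\<^sub>R (- nu (fst z) *\<^sub>R (g (fst z) + c *\<^sub>R e (fst z)))) + (snd h * cosh (snd z)) *\<^sub>R n2 (fst z))) = dX z"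
    by (rule ext) (simp add: dX_def Xth_def kap_def algebra_simps)
  ultimately show ?thesis by (simp only:)
qed

lemma strip_open: "open (I \<times> (UNIV :: real set))"
  by (rule open_Times[OF I(1) open_UNIV])

lemma F_derivative:
  assumes t: "fst z \<in> I"
  shows "(F has_derivative dX z) (at z)"
  by (rule has_derivative_transform_within_open[OF X_derivative[OF t] strip_open])
     (use t in \<open>auto simp: mem_Times_iff focal_eq\<close>)

lemma chart_derivative:
  assumes t: "fst z \<in> I"
  shows "(chartH \<circ> F has_derivative (\<lambda>h. chartH (dX z h))) (at z)"
  unfolding o_def by (rule bounded_linear.has_derivative[OF bounded_linear_chartH F_derivative[OF t]])

lemma dX_zero:
  assumes t: "fst z \<in> I" and l: "l z \<noteq> 0" and h: "dX z h = 0"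
  shows "h = 0"
proof -
  have "lor (dX z h) (g (fst z)) = fst h * l z"
    by (simp add: dX_def l_def lor_simps X_lor[OF t] basis_lor[OF t])
  then have f: "fst h = 0" using h l by (simp add: lor_simps)
  have "lor (dX z h) (Xth z) = snd h"
    by (simp add: dX_def f lor_simps X_lor[OF t])
  then have "snd h = 0" using h by (simp add: lor_simps)
  with f show ?thesis by (simp add: prod_eq_iff)
qed

lemma linear_dX: "fst z \<in> I \<Longrightarrow> linear (dX z)"
  by (rule has_derivative_linear[OF X_derivative])

lemma chart_inj:
  assumes t: "fst z \<in> I" and l: "l z \<noteq> 0"
  shows "inj (\<lambda>h. chartH (dX z h))"
proof (rule linear_injective_0[OF has_derivative_linear[OF chart_derivative[OF t]], THEN iffD2], intro allI impI)
  fix h assume "chartH (dX z h) = 0"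
  moreover have "lor (X z) (dX z h) = 0" by (simp add: dX_def lor_simps X_lor[OF t])
  ultimately have "dX z h = 0" using X_lor(1)[OF t] by (rule chartH_eq_0_imp)
  then show "h = 0" by (rule dX_zero[OF t l])
qed

lemma singular_imp: "fst z \<in> I \<Longrightarrow> singular_point F z \<Longrightarrow> l z = 0"
proof (rule ccontr)
  assume t: "fst z \<in> I" and sg: "singular_point F z" and "l z \<noteq> 0"
  have "inj (dX z)"
    by (rule linear_injective_0[OF linear_dX[OF t], THEN iffD2], intro allI impI, rule dX_zero[OF t \<open>l z \<noteq> 0\<close>])
  then show False
    using sg frechet_derivative_at[OF F_derivative[OF t]] by (simp add: singular_point_def)
qed

lemma smooth_basis: "smooth_on I e" "smooth_on I g" "smooth_on I nu" "smooth_on I kap"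
proof -
  note sm = smooth_normals smooth_frame(1) smooth_on_const[OF I(1)]
  show "smooth_on I e" unfolding e_def[abs_def]
    by (rule smooth_on_scaleR[OF I(1) sm(4) smooth_on_diff[OF I(1) sm(3) smooth_on_scaleR[OF I(1) sm(4) sm(1)]]])
  show "smooth_on I g" unfolding g_def[abs_def]
    by (rule smooth_on_scaleR[OF I(1) sm(4) smooth_on_diff[OF I(1) sm(1) smooth_on_scaleR[OF I(1) sm(4) sm(3)]]])
  show nu: "smooth_on I nu" unfolding nu_def[abs_def]
    by (rule smooth_on_divide[OF I(1) smooth_N sm(4)]) (rule s(3))
  show "smooth_on I kap" unfolding kap_def[abs_def]
    by (rule smooth_on_mult[OF I(1) sm(4) nu])
qed

end

section \<open>Straightening the kernel field; the cuspidal edge\<close>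

context constant_ratio_curve
begin

lemma curve_derivative:
  assumes w: "(p has_vector_derivative w) (at v)" and t: "fst (p v) \<in> I"
  shows "((\<lambda>v. (chartH \<circ> F) (p v)) has_vector_derivative chartH (dX (p v) w)) (at v)"
proof -
  have "((\<lambda>v. (chartH \<circ> F) (p v)) has_derivative (\<lambda>h. chartH (dX (p v) (h *\<^sub>R w)))) (at v)"
    by (rule has_derivative_compose[OF w[unfolded has_vector_derivative_def] chart_derivative[OF t]])
  then show ?thesis
    unfolding has_vector_derivative_def linear_cmul[OF linear_dX[OF t]] chartH_simps .
qed

lemma dX_kernel: "dX z (d, kap (fst z) * d) = (d * l z) *\<^sub>R g (fst z)"
  by (simp add: dX_def l_def algebra_simps)

lemma smooth_X: "smooth_on (I \<times> UNIV) X"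
proof -
  note o = strip_open
  have i: "smooth_on (I \<times> UNIV) (\<lambda>z :: real \<times> real. fst z)" "smooth_on (I \<times> UNIV) (\<lambda>z :: real \<times> real. snd z)"
    by (rule smooth_on_fst[OF o smooth_on_id[OF o]], rule smooth_on_snd[OF o smooth_on_id[OF o]])
  have m: "fst z \<in> I" if "z \<in> I \<times> UNIV" for z :: "real \<times> real" using that by auto
  show ?thesis unfolding X_def[abs_def]
    by (rule smooth_on_add[OF o smooth_on_scaleR[OF o smooth_on_cosh[OF o i(2)] smooth_on_compose[OF o I(1) m i(1) smooth_basis(1)]]
          smooth_on_scaleR[OF o smooth_on_sinh[OF o i(2)] smooth_on_compose[OF o I(1) m i(1) smooth_normals(2)]]])
qed

text \<open>\<open>K\<close> straightens the kernel field (1, kap): along its integral curves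
  \<theta> - K(t) is constant.\<close>

lemma antiderivative_near:
  assumes t0: "t0 \<in> I"
  obtains r K where "r > 0" "\<And>t. \<bar>t - t0\<bar> < r \<Longrightarrow> t \<in> I" "K t0 = 0"
    "\<And>t. \<bar>t - t0\<bar> < r \<Longrightarrow> (K has_real_derivative kap t) (at t)"
proof -
  obtain r where r: "r > 0" "cball t0 r \<subseteq> I" using I(1) t0 open_contains_cball by metis
  have sub: "{t0 - r..t0 + r} \<subseteq> I" using r(2) by (simp add: cball_eq_atLeastAtMost)
  have cont: "continuous_on {t0 - r..t0 + r} kap"
    by (rule continuous_on_subset[OF smooth_on_continuous_on[OF smooth_basis(4)] sub])
  let ?K = "\<lambda>t. integral {t0 - r..t} kap - integral {t0 - r..t0} kap"
  show ?thesis
  proof (rule that[of r ?K])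
    show "r > 0" by fact
    show "?K t0 = 0" by simp
    fix t assume t: "\<bar>t - t0\<bar> < r"
    then have t': "t0 - r < t" "t < t0 + r" by linarith+
    then show "t \<in> I" using sub by auto
    have "((\<lambda>t. integral {t0 - r..t} kap) has_vector_derivative kap t) (at t within {t0 - r..t0 + r})"
      by (rule integral_has_vector_derivative[OF cont]) (use t' in simp)
    then have "((\<lambda>t. integral {t0 - r..t} kap) has_real_derivative kap t) (at t)"
      unfolding at_within_Icc_at[OF t'] has_real_derivative_iff_has_vector_derivative .
    from DERIV_diff[OF this DERIV_const]
    show "(?K has_real_derivative kap t) (at t)" by simp
  qed
qed

text \<open>In the coordinates \<open>(u, v) \<mapsto> (t0 + \<beta> * u + v, \<theta>0 + \<alpha> * u + (K (t0 + \<beta> * u + v) - K (t0 + \<beta> * u)))\<close>, where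
  \<open>K' = kap\<close>, the kernel field is \<open>\<partial>\<^sub>v\<close> and the singular set is \<open>v = 0\<close>. Substituting \<open>\<delta> * sin\<close> for \<open>u\<close> and \<open>v\<close>
  makes the map globally defined and periodic.\<close>

lemma cuspidal_edge_at:
  assumes t0: "t0 \<in> I" and \<beta>: "\<bar>\<beta>\<bar> \<le> 1" and sing: "\<And>x. nu (t0 + \<beta> * x) * sinh (\<theta>0 + \<alpha> * x) = 0"
    and reg: "deriv nu t0 * sinh \<theta>0 + nu t0 * cosh \<theta>0 * kap t0 \<noteq> 0" and det: "\<alpha> - \<beta> * kap t0 \<noteq> 0"
  shows "A_equiv_at (chartH \<circ> F) (t0, \<theta>0) cuspidal_edge 0"
proof -
  \<comment> \<open>The singular line has the direction \<open>(\<beta>, \<alpha>)\<close> and the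
    kernel is spanned by \<open>(1, kap t0)\<close>: \<open>det\<close> states their transversality,
    and \<open>reg\<close> that \<open>l\<close> has a nonzero derivative along the kernel.\<close>
  obtain r K where r: "r > 0" "\<And>t. \<bar>t - t0\<bar> < r \<Longrightarrow> t \<in> I" and K: "K t0 = 0"
    "\<And>t. \<bar>t - t0\<bar> < r \<Longrightarrow> (K has_real_derivative kap t) (at t)"
    by (rule antiderivative_near[OF t0]) (rule that)
  \<comment> \<open>With \<open>\<bar>\<beta>\<bar> \<le> 1\<close> both sine terms together move t
    by at most \<open>2 * \<delta>\<close>, which is less than \<open>r\<close>.\<close>
  define \<delta> where "\<delta> = r / 3"
  have \<delta>: "\<delta> > 0" "\<delta> + \<delta> < r" using r(1) by (simp_all add: \<delta>_def)
  define B where "B u = t0 + \<beta> * (\<delta> * sin u)" for u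
  define T where "T u v = B u + \<delta> * sin v" for u v
  define h where "h z = (T (fst z) (snd z), \<theta>0 + \<alpha> * (\<delta> * sin (fst z)) + (K (T (fst z) (snd z)) - K (B (fst z))))" for z
  have ds: "\<bar>\<delta> * sin x\<bar> \<le> \<delta>" for x
    using \<delta>(1) by (simp add: abs_mult mult_left_le)
  have bs: "\<bar>\<beta> * (\<delta> * sin x)\<bar> \<le> \<delta>" for x
    unfolding abs_mult[of \<beta>] using mult_mono[OF \<beta> ds[of x]] by simp
  have B: "\<bar>B u - t0\<bar> < r" for u using bs[of u] \<delta> unfolding B_def by linarith
  have T: "\<bar>T u v - t0\<bar> < r" for u v using bs[of u] ds[of v] \<delta> unfolding T_def B_def by linarith
  have TI: "T u v \<in> I" for u v by (rule r(2)[OF T])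
  have B0: "B 0 = t0" and T0: "T u 0 = B u" for u by (simp_all add: B_def T_def)
  have h00: "h 0 = (t0, \<theta>0)" by (simp add: h_def T0 B0)
  let ?J = "{t. \<bar>t - t0\<bar> < r}"
  have J: "open ?J"
  proof -
    have "?J = ball t0 r" by (auto simp: dist_real_def abs_minus_commute)
    then show ?thesis by simp
  qed
  have sK: "smooth_on ?J K"
  proof (rule smooth_onI_vector_derivative[OF J])
    show "smooth_on ?J kap" by (rule smooth_on_subset[OF J _ smooth_basis(4)]) (use r(2) in blast)
    show "(K has_vector_derivative kap x) (at x)" if "x \<in> ?J" for x
      using K(2) that by (simp add: has_real_derivative_iff_has_vector_derivative)
  qed
  have sB: "smooth_on UNIV (\<lambda>z :: real \<times> real. B (fst z))"
    unfolding B_def[abs_def]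
    by (intro smooth_on_add smooth_on_mult smooth_on_const smooth_on_sin smooth_on_fst smooth_on_id open_UNIV)
  have sT: "smooth_on UNIV (\<lambda>z :: real \<times> real. T (fst z) (snd z))"
    unfolding T_def[abs_def]
    by (intro smooth_on_add[OF open_UNIV sB] smooth_on_mult smooth_on_const smooth_on_sin smooth_on_snd smooth_on_id open_UNIV)
  have sKT: "smooth_on UNIV (\<lambda>z :: real \<times> real. K (T (fst z) (snd z)))"
    by (rule smooth_on_compose[OF open_UNIV J _ sT sK]) (simp add: T)
  have sKB: "smooth_on UNIV (\<lambda>z :: real \<times> real. K (B (fst z)))"
    by (rule smooth_on_compose[OF open_UNIV J _ sB sK]) (simp add: B)
  have "smooth_on UNIV (\<lambda>z :: real \<times> real. \<theta>0 + \<alpha> * (\<delta> * sin (fst z)))"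
    by (intro smooth_on_add smooth_on_mult smooth_on_const smooth_on_sin smooth_on_fst smooth_on_id open_UNIV)
  from smooth_on_Pair[OF open_UNIV sT smooth_on_add[OF open_UNIV this smooth_on_diff[OF open_UNIV sKT sKB]]]
  have sh: "smooth_on UNIV h" unfolding h_def[abs_def] .
  have fh: "fst (h z) \<in> I" for z by (simp add: h_def TI)
  have GX: "(chartH \<circ> F) (h z) = chartH (X (h z))" for z by (simp add: focal_eq[OF fh])
  have sXh: "smooth_on UNIV (\<lambda>z. X (h z))"
    by (rule smooth_on_compose[OF open_UNIV strip_open _ sh smooth_X]) (simp add: mem_Times_iff fh)
  have sG: "smooth_on UNIV (\<lambda>z. (chartH \<circ> F) (h z))"
    unfolding GX by (rule smooth_on_linear_compose[OF bounded_linear_chartH open_UNIV sXh])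
  have hv: "((\<lambda>v. h (u, v)) has_vector_derivative (\<delta> * cos v, kap (fst (h (u, v))) * (\<delta> * cos v))) (at v)" for u v
  proof -
    have 1: "(T u has_real_derivative \<delta> * cos v) (at v)"
      unfolding T_def[abs_def] by (auto intro!: derivative_eq_intros)
    have 2: "((\<lambda>v. K (T u v)) has_real_derivative kap (T u v) * (\<delta> * cos v)) (at v)"
      by (rule DERIV_chain2[OF K(2)[OF T[of u v]] 1])
    have "((\<lambda>v. \<theta>0 + \<alpha> * (\<delta> * sin u) + (K (T u v) - K (B u))) has_real_derivative 0 + (kap (T u v) * (\<delta> * cos v) - 0)) (at v)"
      by (rule DERIV_add[OF DERIV_const DERIV_diff[OF 2 DERIV_const]])
    then have 3: "((\<lambda>v. \<theta>0 + \<alpha> * (\<delta> * sin u) + (K (T u v) - K (B u))) has_real_derivative kap (T u v) * (\<delta> * cos v)) (at v)"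
      by (simp only: add_0_left diff_0_right)
    show ?thesis
      unfolding h_def fst_conv snd_conv
      by (rule has_vector_derivative_Pair[OF 1[unfolded has_real_derivative_iff_has_vector_derivative]
            3[unfolded has_real_derivative_iff_has_vector_derivative]])
  qed
  have Gv: "((\<lambda>v. (chartH \<circ> F) (h (u, v))) has_vector_derivative (\<delta> * cos v * l (h (u, v))) *\<^sub>R chartH (g (T u v))) (at v)" for u v
    using curve_derivative[OF hv[of u v] fh] unfolding dX_kernel chartH_simps by (simp add: h_def)
  have l0: "l (h (u, 0)) = 0" for u
    using sing[of "\<delta> * sin u"] by (simp add: l_def h_def T0 B_def)
  \<comment> \<open>The derivative of the chart image along the kernel curve through the base point
    is \<open>\<rho> v *\<^sub>R k v\<close>, with a scalar factor that vanishes at 0.\<close>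
  define \<rho> where "\<rho> v = \<delta> * cos v * l (h (0, v))" for v
  define k where "k v = chartH (g (T 0 v))" for v
  have \<rho>0: "\<rho> 0 = 0" by (simp add: \<rho>_def l0)
  have sT0: "smooth_on UNIV (T 0)"
    unfolding T_def[abs_def] by (intro smooth_on_add smooth_on_mult smooth_on_const smooth_on_sin smooth_on_id open_UNIV)
  have snT: "smooth_on UNIV (\<lambda>v. nu (T 0 v))"
    by (rule smooth_on_compose[OF open_UNIV I(1) TI sT0 smooth_basis(3)])
  have sKT0: "smooth_on UNIV (\<lambda>v. \<theta>0 + K (T 0 v))"
    by (rule smooth_on_add[OF open_UNIV smooth_on_const[OF open_UNIV] smooth_on_compose[OF open_UNIV J _ sT0 sK]]) (simp add: T)
  have \<rho>eq: "\<rho> = (\<lambda>v. \<delta> * cos v * (- (nu (T 0 v) * sinh (\<theta>0 + K (T 0 v)))))"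
    by (rule ext) (simp add: \<rho>_def l_def h_def B0 K(1))
  have s\<rho>: "smooth_on UNIV \<rho>"
    unfolding \<rho>eq
    by (intro smooth_on_mult[OF open_UNIV] smooth_on_minus[OF open_UNIV] smooth_on_sinh[OF open_UNIV] snT sKT0
        smooth_on_const[OF open_UNIV] smooth_on_cos[OF open_UNIV] smooth_on_id[OF open_UNIV])
  have sk: "smooth_on UNIV k"
    unfolding k_def[abs_def]
    by (rule smooth_on_linear_compose[OF bounded_linear_chartH open_UNIV
          smooth_on_compose[OF open_UNIV I(1) TI sT0 smooth_basis(2)]])
  have dT: "(T 0 has_real_derivative \<delta>) (at 0)"
    unfolding T_def[abs_def] by (auto intro!: derivative_eq_intros)
  have T00: "T 0 0 = t0" by (simp add: T0 B0)
  have d\<rho>: "deriv \<rho> 0 = - \<delta> * \<delta> * (deriv nu t0 * sinh \<theta>0 + nu t0 * cosh \<theta>0 * kap t0)"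
  proof (rule DERIV_imp_deriv)
    have 1: "((\<lambda>v. nu (T 0 v)) has_real_derivative deriv nu (T 0 0) * \<delta>) (at 0)"
      by (rule DERIV_chain2[OF smooth_on_deriv(1)[OF I(1) smooth_basis(3) TI[of 0 0]] dT])
    have 2: "((\<lambda>v. K (T 0 v)) has_real_derivative kap (T 0 0) * \<delta>) (at 0)"
      by (rule DERIV_chain2[OF K(2)[OF T[of 0 0]] dT])
    show "(\<rho> has_real_derivative - \<delta> * \<delta> * (deriv nu t0 * sinh \<theta>0 + nu t0 * cosh \<theta>0 * kap t0)) (at 0)"
      unfolding \<rho>eq
      by (rule derivative_eq_intros 1 2 refl)+ (simp add: T00 K(1) algebra_simps)
  qed
  then have \<rho>': "deriv \<rho> 0 \<noteq> 0" using reg \<delta>(1) by simp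
  have dk: "vector_derivative k (at 0) = chartH (\<delta> *\<^sub>R (nu t0 *\<^sub>R n2 t0 + (s * A t0) *\<^sub>R mu t0))"
  proof (rule vector_derivative_at)
    have "(g \<circ> T 0 has_vector_derivative \<delta> *\<^sub>R (nu (T 0 0) *\<^sub>R n2 (T 0 0) + (s * A (T 0 0)) *\<^sub>R mu (T 0 0))) (at 0)"
      by (rule vector_diff_chain_at[where f = "T 0" and g = g and x = 0, OF _ basis_deriv(2)[OF TI[of 0 0]]])
         (use dT in \<open>simp add: has_real_derivative_iff_has_vector_derivative\<close>)
    from bounded_linear.has_vector_derivative[OF bounded_linear_chartH this]
    show "(k has_vector_derivative chartH (\<delta> *\<^sub>R (nu t0 *\<^sub>R n2 t0 + (s * A t0) *\<^sub>R mu t0))) (at 0)"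
      unfolding T00 k_def[abs_def] o_def .
  qed
  obtain p2 p3 where p2: "\<And>v. ((\<lambda>v. \<rho> v *\<^sub>R k v) has_vector_derivative p2 v) (at v)"
    and p3: "(p2 has_vector_derivative p3) (at 0)" and p20: "p2 0 = deriv \<rho> 0 *\<^sub>R k 0"
    and p3eq: "p3 = deriv (deriv \<rho>) 0 *\<^sub>R k 0 + (2 * deriv \<rho> 0) *\<^sub>R vector_derivative k (at 0)"
    by (rule scaleR_product_derivatives[OF s\<rho> \<rho>0 sk]) (rule that)
  have hu: "((\<lambda>u. h (u, 0)) has_vector_derivative (\<beta> * \<delta>, \<alpha> * \<delta>)) (at 0)"
  proof -
    have "((\<lambda>u. t0 + \<beta> * (\<delta> * sin u)) has_real_derivative \<beta> * \<delta>) (at 0)"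
      "((\<lambda>u. \<theta>0 + \<alpha> * (\<delta> * sin u)) has_real_derivative \<alpha> * \<delta>) (at 0)"
      by (auto intro!: derivative_eq_intros)
    then show ?thesis
      unfolding h_def fst_conv snd_conv T0 diff_self add_0_right unfolding B_def
      by (intro has_vector_derivative_Pair) (simp_all add: has_real_derivative_iff_has_vector_derivative)
  qed
  have z0: "nu t0 * sinh \<theta>0 = 0" using sing[of 0] by simp
  let ?z = "(t0, \<theta>0)"
  have q1: "((\<lambda>u. (chartH \<circ> F) (h (u, 0))) has_vector_derivative (\<delta> * (\<alpha> - \<beta> * kap t0)) *\<^sub>R chartH (Xth ?z)) (at 0)"
  proof -
    have "h (0, 0) = ?z" using h00 by (simp add: zero_prod_def)
    then have "((\<lambda>u. (chartH \<circ> F) (h (u, 0))) has_vector_derivative chartH (dX ?z (\<beta> * \<delta>, \<alpha> * \<delta>))) (at 0)"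
      using curve_derivative[OF hu fh] by simp
    moreover have "dX ?z (\<beta> * \<delta>, \<alpha> * \<delta>) = (\<delta> * (\<alpha> - \<beta> * kap t0)) *\<^sub>R Xth ?z"
      using z0 by (simp add: dX_def algebra_simps)
    ultimately show ?thesis by (simp only: chartH_simps)
  qed
  have zI: "fst ?z \<in> I" using t0 by simp
  note L = X_lor[OF zI, unfolded fst_conv snd_conv] and bl = basis_lor[OF t0]
  have k0: "k 0 = chartH (g t0)" by (simp add: k_def T00)
  have indep: "a' = 0 \<and> b' = 0 \<and> c' = 0"
    if eq: "a' *\<^sub>R ((\<delta> * (\<alpha> - \<beta> * kap t0)) *\<^sub>R chartH (Xth ?z)) + b' *\<^sub>R p2 0 + c' *\<^sub>R p3 = 0" for a' b' c'
  proof -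
    let ?a = "a' * (\<delta> * (\<alpha> - \<beta> * kap t0))" and ?b = "b' * deriv \<rho> 0 + c' * deriv (deriv \<rho>) 0" and ?c = "c' * (2 * deriv \<rho> 0) * \<delta>"
    \<comment> \<open>The combination is lifted to R^4. It is orthogonal to \<open>X ?z\<close>, the
      \<open>n2\<close> term being harmless because \<open>nu t0 * sinh \<theta>0 = 0\<close>; hence
      it vanishes with its chart image. Only the third derivative contains \<open>mu\<close>, so
      products with \<open>mu\<close>, \<open>g\<close> and \<open>Xth\<close> annihilate
      \<open>c'\<close>, \<open>b'\<close> and \<open>a'\<close> in this order.\<close>
    define w where "w = ?a *\<^sub>R Xth ?z + ?b *\<^sub>R g t0 + ?c *\<^sub>R (nu t0 *\<^sub>R n2 t0 + (s * A t0) *\<^sub>R mu t0)"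
    have "chartH w = 0"
      using eq unfolding w_def p20 p3eq k0 dk chartH_simps by (simp add: algebra_simps)
    moreover have "lor (X ?z) w = 0"
      using z0 by (simp add: w_def lor_simps L)
    ultimately have w0: "w = 0" using L(1) by (rule chartH_eq_0_imp)
    have "lor w (mu t0) = ?c * (s * A t0)"
      by (simp add: w_def lor_simps L bl)
    then have c0: "c' = 0" using w0 \<rho>' \<delta>(1) s(1) A_pos(2)[OF t0] by (simp add: lor_simps)
    have "lor w (g t0) = ?b"
      by (simp add: w_def c0 lor_simps L bl)
    then have b0: "b' = 0" using w0 c0 \<rho>' by (simp add: lor_simps)
    have "lor w (Xth ?z) = ?a"
      by (simp add: w_def c0 b0 lor_simps L)
    then have "a' = 0" using w0 \<delta>(1) det by (simp add: lor_simps)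
    with b0 c0 show ?thesis by blast
  qed
  let ?h' = "\<lambda>z :: real \<times> real. (\<beta> * (\<delta> * fst z) + \<delta> * snd z, \<alpha> * (\<delta> * fst z) + (kap t0 * (\<beta> * (\<delta> * fst z) + \<delta> * snd z) - kap t0 * (\<beta> * (\<delta> * fst z))))"
  have dh: "(h has_derivative ?h') (at 0)"
  proof -
    have dB: "((\<lambda>z :: real \<times> real. B (fst z)) has_derivative (\<lambda>z. \<beta> * (\<delta> * fst z))) (at 0)"
      unfolding B_def[abs_def] by (auto intro!: derivative_eq_intros)
    have dTz: "((\<lambda>z :: real \<times> real. T (fst z) (snd z)) has_derivative (\<lambda>z. \<beta> * (\<delta> * fst z) + \<delta> * snd z)) (at 0)"
      unfolding T_def[abs_def] by (rule has_derivative_add[OF dB]) (auto intro!: derivative_eq_intros)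
    have dK: "(K has_derivative (\<lambda>x. kap t0 * x)) (at t0)"
      using K(2)[of t0] r(1) by (simp add: has_field_derivative_def)
    have 1: "((\<lambda>z :: real \<times> real. K (T (fst z) (snd z))) has_derivative (\<lambda>z. kap t0 * (\<beta> * (\<delta> * fst z) + \<delta> * snd z))) (at 0)"
      by (rule has_derivative_compose[OF dTz, of K]) (simp add: T00 dK)
    have 2: "((\<lambda>z :: real \<times> real. K (B (fst z))) has_derivative (\<lambda>z. kap t0 * (\<beta> * (\<delta> * fst z)))) (at 0)"
      by (rule has_derivative_compose[OF dB, of K]) (simp add: B0 dK)
    have 3: "((\<lambda>z :: real \<times> real. \<theta>0 + \<alpha> * (\<delta> * sin (fst z))) has_derivative (\<lambda>z. \<alpha> * (\<delta> * fst z))) (at 0)"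
      by (auto intro!: derivative_eq_intros)
    show ?thesis
      unfolding h_def[abs_def] by (rule has_derivative_Pair[OF dTz has_derivative_add[OF 3 has_derivative_diff[OF 1 2]]])
  qed
  have ih: "inj ?h'"
  proof (rule linear_injective_0[OF has_derivative_linear[OF dh], THEN iffD2], intro allI impI)
    fix z assume "?h' z = 0"
    note zz = this[unfolded zero_prod_def prod.inject]
    note z = conjunct1[OF zz] conjunct2[OF zz]
    have "\<delta> * (\<alpha> - \<beta> * kap t0) * fst z = 0" using z(2) unfolding z(1) by (simp add: algebra_simps)
    then have "fst z = 0" using \<delta>(1) det by simp
    moreover from this z(1) have "snd z = 0" using \<delta>(1) by simp
    ultimately show "z = 0" by (simp add: prod_eq_iff)
  qed
  have per: "h (u + 2 * pi, v) = h (u, v)" "h (u, v + 2 * pi) = h (u, v)" for u v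
    by (simp_all add: h_def T_def B_def)
  have "A_equiv_at (chartH \<circ> F) (h 0) cuspidal_edge 0"
  proof (rule cuspidal_edge_criterion[where p = "2 * pi" and ?p2.0 = p2, OF sh dh ih sG _ _ _ _ _ _ p3 q1 indep])
    show "(chartH \<circ> F) (h (u + 2 * pi, v)) = (chartH \<circ> F) (h (u, v))"
      "(chartH \<circ> F) (h (u, v + 2 * pi)) = (chartH \<circ> F) (h (u, v))" for u v
      by (simp_all only: per)
    show "((\<lambda>v. (chartH \<circ> F) (h (u, v))) has_vector_derivative 0) (at 0)" for u
      using Gv[of u 0] by (simp add: l0)
    show "((\<lambda>v. (chartH \<circ> F) (h (0, v))) has_vector_derivative \<rho> v *\<^sub>R k v) (at v)" for v
      using Gv[of 0 v] unfolding \<rho>_def k_def .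
    show "((\<lambda>v. \<rho> v *\<^sub>R k v) has_vector_derivative p2 v) (at v)" for v by (rule p2)
  qed simp_all
  then show ?thesis unfolding h00 .
qed

end

lemma exists_near_on_line:
  fixes p w :: "'a::real_normed_vector"
  assumes "open U" "p \<in> U" "w \<noteq> 0"
  shows "\<exists>s. s \<noteq> 0 \<and> p + s *\<^sub>R w \<in> U"
proof -
  have "open ((\<lambda>s. p + s *\<^sub>R w) -` U)" by (rule open_vimage[OF assms(1)]) (intro continuous_intros)
  moreover have "0 \<in> (\<lambda>s. p + s *\<^sub>R w) -` U" using assms(2) by simp
  ultimately obtain d where d: "d > 0" "ball 0 d \<subseteq> (\<lambda>s. p + s *\<^sub>R w) -` U" by (rule openE)
  have "d / 2 \<in> ball 0 d" using d(1) by simp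
  then have "p + (d / 2) *\<^sub>R w \<in> U" using d(2) by blast
  then show ?thesis using d(1) by (intro exI[of _ "d / 2"]) simp
qed

section \<open>Application of the criteria to the focal surface\<close>

context constant_ratio_curve
begin

text \<open>The domain stays free: one use takes the whole strip, another removes the line \<theta>
  = 0 so that the zeros of \<open>l\<close> depend on t alone.\<close>

lemma degenerate_field_on:
  assumes "open S" "z0 \<in> S" "S \<subseteq> I \<times> UNIV"
  shows "degenerate_field (chartH \<circ> F) z0 S (\<lambda>z h. chartH (dX z h)) (\<lambda>z. (1, kap (fst z))) (\<lambda>z. chartH (g (fst z))) l"
proof
  have m: "fst z \<in> I" if "z \<in> S" for z using assms(3) that by auto
  show "open S" "z0 \<in> S" by fact+
  show "(chartH \<circ> F has_derivative (\<lambda>h. chartH (dX z h))) (at z)" if "z \<in> S" for z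
    by (rule chart_derivative[OF m[OF that]])
  have im: "fst ` S \<subseteq> I" using m by auto
  have cf: "continuous_on S fst" by (intro continuous_intros)
  have "continuous_on S (\<lambda>z. kap (fst z))"
    by (rule continuous_on_compose2[OF smooth_on_continuous_on[OF smooth_basis(4)] cf im])
  then show "continuous_on S (\<lambda>z. (1, kap (fst z)))" by (intro continuous_on_Pair continuous_on_const)
  show "(1 :: real, kap (fst z)) \<noteq> 0" for z by (simp add: prod_eq_iff)
  show "continuous_on S (\<lambda>z. chartH (g (fst z)))"
    by (rule bounded_linear.continuous_on[OF bounded_linear_chartH
          continuous_on_compose2[OF smooth_on_continuous_on[OF smooth_basis(2)] cf im]])
  show "chartH (dX z (1, kap (fst z))) = l z *\<^sub>R chartH (g (fst z))" for z
    using dX_kernel[of z 1] by (simp add: chartH_simps)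
qed

text \<open>On \<theta> = 0 the surface is \<open>e t\<close>, whose derivative is
  \<open>- kap t *\<^sub>R n2 t\<close>; this vanishes for c = 0, so the whole line lies in one
  fibre.\<close>

lemma not_finite_fibre:
  assumes t0: "t0 \<in> I" and c0: "c = 0" and f: "\<And>x. f x = f 0 \<Longrightarrow> x = 0"
  shows "\<not> A_equiv_at (chartH \<circ> F) (t0, 0) f 0"
proof
  assume A: "A_equiv_at (chartH \<circ> F) (t0, 0) f 0"
  have e0: "(e has_derivative (\<lambda>h. 0)) (at t within I)" if "t \<in> I" for t
  proof -
    have k0: "kap t = 0" unfolding kap_def using c0 by simp
    have "(e has_vector_derivative 0) (at t)"
      using basis_deriv(1)[OF that] unfolding k0 minus_zero scaleR_zero_left .
    then show ?thesis
      unfolding has_vector_derivative_def scaleR_zero_right by (rule has_derivative_at_withinI)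
  qed
  have "\<exists>e'. \<forall>t\<in>I. e t = e'"
    by (rule has_derivative_zero_constant[OF is_interval_convex[OF I(2)] e0])
  then obtain e' where "\<forall>t\<in>I. e t = e'" by (elim exE)
  then have e': "e t = e'" if "t \<in> I" for t using that by (rule bspec)
  have Fe: "(chartH \<circ> F) (t, 0) = chartH e'" if "t \<in> I" for t
    using focal_eq[of "(t, 0)"] that e'[OF that] by (simp add: X_def)
  show False
  proof (rule A_equiv_at_fibre[OF A])
    show "x = 0" if "f x = f 0" for x by (rule f[OF that])
    fix U :: "(real \<times> real) set" assume U: "open U" "(t0, 0) \<in> U"
    have "open (U \<inter> I \<times> UNIV)" by (rule open_Int[OF U(1) strip_open])
    moreover have "(t0, 0) \<in> U \<inter> I \<times> UNIV" using U(2) t0 by simp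
    moreover have "(1, 0) \<noteq> (0 :: real \<times> real)" by (simp add: prod_eq_iff)
    ultimately have "\<exists>r. r \<noteq> 0 \<and> (t0, 0) + r *\<^sub>R (1, 0) \<in> U \<inter> I \<times> UNIV"
      by (rule exists_near_on_line)
    then obtain r where r: "r \<noteq> 0" "(t0, 0) + r *\<^sub>R (1, 0) \<in> U \<inter> I \<times> UNIV" by (elim exE conjE)
    then have r': "(t0 + r, 0) \<in> U" "t0 + r \<in> I" by simp_all
    have "(chartH \<circ> F) (t0 + r, 0) = (chartH \<circ> F) (t0, 0)" unfolding Fe[OF r'(2)] Fe[OF t0] ..
    moreover have "(t0 + r, 0) \<noteq> (t0, 0 :: real)" using r(1) by simp
    ultimately show "\<exists>y\<in>U. y \<noteq> (t0, 0) \<and> (chartH \<circ> F) y = (chartH \<circ> F) (t0, 0)"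
      by (intro bexI[OF _ r'(1)] conjI)
  qed
qed

lemma l_derivative:
  assumes t: "fst z \<in> I"
  shows "(l has_derivative (\<lambda>h. - (fst h * (deriv nu (fst z) * sinh (snd z)) + snd h * (nu (fst z) * cosh (snd z))))) (at z)"
proof -
  have "(nu has_derivative (\<lambda>x. x * deriv nu (fst z))) (at (fst z))"
    using smooth_on_deriv(1)[OF I(1) smooth_basis(3) t] by (simp add: has_field_derivative_def mult_commute_abs)
  from has_derivative_compose[OF bounded_linear_imp_has_derivative[OF bounded_linear_fst] this]
  have 1: "((\<lambda>z. nu (fst z)) has_derivative (\<lambda>h. fst h * deriv nu (fst z))) (at z)" .
  have "(sinh has_real_derivative cosh (snd z)) (at (snd z))" by (auto intro!: derivative_eq_intros)
  then have "(sinh has_derivative (\<lambda>x. x * cosh (snd z))) (at (snd z))"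
    by (simp add: has_field_derivative_def mult_commute_abs)
  from has_derivative_compose[OF bounded_linear_imp_has_derivative[OF bounded_linear_snd] this]
  have 2: "((\<lambda>z :: real \<times> real. sinh (snd z)) has_derivative (\<lambda>h. snd h * cosh (snd z))) (at z)" .
  have "(l has_derivative (\<lambda>h. - (nu (fst z) * (snd h * cosh (snd z)) + fst h * deriv nu (fst z) * sinh (snd z)))) (at z)"
    unfolding l_def[abs_def] by (intro has_derivative_minus has_derivative_mult 1 2)
  moreover have "(\<lambda>h. - (nu (fst z) * (snd h * cosh (snd z)) + fst h * deriv nu (fst z) * sinh (snd z)))
      = (\<lambda>h. - (fst h * (deriv nu (fst z) * sinh (snd z)) + snd h * (nu (fst z) * cosh (snd z))))"
    by (rule ext) (simp add: algebra_simps)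
  ultimately show ?thesis by (simp only:)
qed

text \<open>Since \<open>sqrt ((A t)^2 - (M t)^2) = s * A t\<close>, the function is
  \<open>s^2 * (A t)^2 * nu t\<close>; at a zero of \<open>nu\<close> only the derivative of
  \<open>nu\<close> survives.\<close>

lemma regularity_deriv:
  assumes t: "t \<in> I" and N0: "nu t = 0"
  shows "deriv (\<lambda>t. A t * N t * sqrt ((A t)^2 - (M t)^2)) t = (s * s * (A t * A t)) * deriv nu t"
proof (rule DERIV_imp_deriv)
  have q: "(s * s * (A u * A u)) * nu u = A u * N u * sqrt ((A u)^2 - (M u)^2)" if u: "u \<in> I" for u
  proof -
    have "(A u)^2 - (M u)^2 = (s * A u)^2"
      unfolding c(1)[OF u] power_mult_distrib s(2) by (simp add: algebra_simps)
    then have "sqrt ((A u)^2 - (M u)^2) = s * A u" using s(1) A_pos(2)[OF u] by simp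
    moreover have "N u = s * nu u" using s(3) by (simp add: nu_def)
    ultimately show ?thesis by (simp only: mult_ac)
  qed
  have sm: "smooth_on I (\<lambda>u. s * s * (A u * A u))"
    by (rule smooth_on_mult[OF I(1) smooth_on_const[OF I(1)] smooth_on_mult[OF I(1) smooth_A smooth_A]])
  have eq: "deriv (\<lambda>u. s * s * (A u * A u)) t * nu t + deriv nu t * (s * s * (A t * A t)) = (s * s * (A t * A t)) * deriv nu t"
    unfolding N0 by simp
  have "((\<lambda>u. (s * s * (A u * A u)) * nu u) has_real_derivative
     deriv (\<lambda>u. s * s * (A u * A u)) t * nu t + deriv nu t * (s * s * (A t * A t))) (at t)"
    by (rule DERIV_mult[OF smooth_on_deriv(1)[OF I(1) sm t] smooth_on_deriv(1)[OF I(1) smooth_basis(3) t]])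
  then have "((\<lambda>u. (s * s * (A u * A u)) * nu u) has_real_derivative (s * s * (A t * A t)) * deriv nu t) (at t)"
    unfolding eq .
  then show "((\<lambda>t. A t * N t * sqrt ((A t)^2 - (M t)^2)) has_real_derivative (s * s * (A t * A t)) * deriv nu t) (at t)"
    by (rule has_field_derivative_transform_within_open[OF _ I(1) t]) (rule q)
qed

lemma classification:
  assumes t0: "t0 \<in> I" and sing: "singular_point F (t0, \<theta>0)"
  shows "(N t0 \<noteq> 0 \<longrightarrow>
            (surf_germ_is F (t0, \<theta>0) cuspidal_edge \<longleftrightarrow> M t0 \<noteq> 0) \<and>
            \<not> surf_germ_is F (t0, \<theta>0) swallowtail \<and>
            \<not> surf_germ_is F (t0, \<theta>0) cuspidal_cross_cap)
       \<and> (N t0 = 0 \<longrightarrow>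
            (surf_germ_is F (t0, \<theta>0) cuspidal_edge \<longleftrightarrow>
               \<theta>0 \<noteq> 0 \<and> deriv (\<lambda>t. A t * N t * sqrt ((A t)^2 - (M t)^2)) t0 \<noteq> 0) \<and>
            \<not> surf_germ_is F (t0, \<theta>0) cuspidal_beaks \<and>
            \<not> surf_germ_is F (t0, \<theta>0) cuspidal_lips \<and>
            \<not> surf_germ_is F (t0, \<theta>0) swallowtail \<and>
            \<not> surf_germ_is F (t0, \<theta>0) cuspidal_cross_cap)"
proof -
  let ?z = "(t0, \<theta>0)"
  let ?E = "\<lambda>f. A_equiv_at (chartH \<circ> F) ?z f 0"
  have germ: "surf_germ_is F ?z f \<longleftrightarrow> ?E f" for f
    by (simp add: surf_germ_is_def zero_prod_def)
  have N_nu: "N t0 = 0 \<longleftrightarrow> nu t0 = 0" using s(3) by (simp add: nu_def)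
  have M_c: "M t0 = 0 \<longleftrightarrow> c = 0" using c(1)[OF t0] A_pos(2)[OF t0] by simp
  have "l ?z = 0" by (rule singular_imp[OF _ sing]) (simp add: t0)
  then have nus: "nu t0 * sinh \<theta>0 = 0" by (simp add: l_def)
  have inj_excl: "\<not> ?E swallowtail" "\<not> ?E cuspidal_cross_cap" if "?E cuspidal_edge"
  proof -
    show "\<not> ?E swallowtail"
      by (rule notI, rule A_equiv_at_injective[OF that inj_cuspidal_edge _ not_inj_on_swallowtail])
    show "\<not> ?E cuspidal_cross_cap"
      by (rule notI, rule A_equiv_at_injective[OF that inj_cuspidal_edge _ not_inj_on_cuspidal_cross_cap])
  qed
  have nonzero: "(?E cuspidal_edge \<longleftrightarrow> M t0 \<noteq> 0) \<and> \<not> ?E swallowtail \<and> \<not> ?E cuspidal_cross_cap" if n: "nu t0 \<noteq> 0"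
  proof -
    have \<theta>: "\<theta>0 = 0" using nus n by simp
    show ?thesis
    proof (cases "c = 0")
      case True
      have "\<not> ?E cuspidal_edge" unfolding \<theta> by (rule not_finite_fibre[OF t0 True normal_forms_fibre(1)])
      moreover have "\<not> ?E swallowtail" unfolding \<theta> by (rule not_finite_fibre[OF t0 True normal_forms_fibre(2)])
      moreover have "\<not> ?E cuspidal_cross_cap" unfolding \<theta> by (rule not_finite_fibre[OF t0 True normal_forms_fibre(3)])
      ultimately show ?thesis using True M_c by blast
    next
      case False
      have kap: "kap t0 \<noteq> 0" using False n by (simp add: kap_def)
      \<comment> \<open>The singular set is \<theta> = 0, a line in the direction of t;
        transversality to the kernel is \<open>kap t0 \<noteq> 0\<close>.\<close>
      have "?E cuspidal_edge"
        by (rule cuspidal_edge_at[OF t0, where \<alpha> = 0 and \<beta> = 1]) (use \<theta> n kap in simp_all)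
      then show ?thesis using inj_excl False M_c by blast
    qed
  qed
  have zero: "(?E cuspidal_edge \<longleftrightarrow> \<theta>0 \<noteq> 0 \<and> deriv nu t0 \<noteq> 0) \<and> \<not> ?E cuspidal_beaks \<and> \<not> ?E cuspidal_lips \<and>
      \<not> ?E swallowtail \<and> \<not> ?E cuspidal_cross_cap" if n: "nu t0 = 0"
  proof -
    interpret df: degenerate_field "chartH \<circ> F" ?z "I \<times> UNIV" "\<lambda>z h. chartH (dX z h)"
        "\<lambda>z. (1, kap (fst z))" "\<lambda>z. chartH (g (fst z))" l
      by (rule degenerate_field_on[OF strip_open]) (simp_all add: t0)
    have lz: "l ?z = 0" by (simp add: l_def n)
    have lips: "\<not> ?E cuspidal_lips"
    proof (rule df.not_cuspidal_lips)
      fix U :: "(real \<times> real) set" assume U: "open U" "?z \<in> U"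
      have "(0, 1) \<noteq> (0 :: real \<times> real)" by (simp add: prod_eq_iff)
      from exists_near_on_line[OF U this] obtain r where r: "r \<noteq> 0" "?z + r *\<^sub>R (0, 1) \<in> U" by blast
      show "\<exists>y\<in>U. y \<noteq> ?z \<and> l y = 0"
        by (rule bexI[OF _ r(2)]) (use r(1) in \<open>simp add: l_def n\<close>)
    qed
    \<comment> \<open>If \<theta>0 = 0, the kernel at the point is (1, 0) because kap vanishes with
      nu, and it is tangent to the singular line \<theta> = 0. Otherwise that line is cut
      away.\<close>
    have beaks: "\<not> ?E cuspidal_beaks"
    proof (cases "\<theta>0 = 0")
      case True
      show ?thesis
        by (rule df.not_cuspidal_beaks_tangent) (simp add: l_def kap_def n True)
    next
      case False
      have op: "open (I \<times> (- {0 :: real}))" by (rule open_Times[OF I(1)]) auto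
      interpret df': degenerate_field "chartH \<circ> F" ?z "I \<times> (- {0})" "\<lambda>z h. chartH (dX z h)"
          "\<lambda>z. (1, kap (fst z))" "\<lambda>z. chartH (g (fst z))" l
        by (rule degenerate_field_on[OF op]) (use t0 False in auto)
      show ?thesis
      proof (rule df'.not_cuspidal_beaks_transversal[where n = nu])
        fix y :: "real \<times> real" assume y: "y \<in> I \<times> (- {0})"
        then have y': "fst y \<in> I" "snd y \<noteq> 0" by auto
        show "inj (\<lambda>h. chartH (dX y h))" if "l y \<noteq> 0" by (rule chart_inj[OF y'(1) that])
        show "l y = 0 \<longleftrightarrow> nu (fst y) = 0" using y'(2) by (simp add: l_def)
      qed
    qed
    show ?thesis
    proof (cases "\<theta>0 \<noteq> 0 \<and> deriv nu t0 \<noteq> 0")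
      case True
      \<comment> \<open>Now the singular line is t = t0, in the direction of \<theta>, and the
        kernel is (1, 0).\<close>
      have "?E cuspidal_edge"
        by (rule cuspidal_edge_at[OF t0, where \<alpha> = 1 and \<beta> = 0]) (use True n in simp_all)
      then show ?thesis using inj_excl True lips beaks by blast
    next
      case False
      \<comment> \<open>One partial derivative of \<open>l\<close> carries the factor
        \<open>nu t0\<close>, the other the product of \<open>deriv nu t0\<close> and
        \<open>sinh \<theta>0\<close>; both are 0 here.\<close>
      have "(l has_derivative (\<lambda>h. 0)) (at ?z)"
      proof -
        have z: "deriv nu t0 * sinh \<theta>0 = 0" using False by auto
        show ?thesis using l_derivative[of ?z, unfolded fst_conv snd_conv, OF t0, unfolded z n] by simp
      qed
      then show ?thesis
        using False lips beaks df.not_cuspidal_edge_of_flat[OF lz] df.not_swallowtail_of_flat[OF lz]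
          df.not_cuspidal_cross_cap_of_flat[OF lz] by blast
    qed
  qed
  have "deriv (\<lambda>t. A t * N t * sqrt ((A t)^2 - (M t)^2)) t0 \<noteq> 0 \<longleftrightarrow> deriv nu t0 \<noteq> 0" if "nu t0 = 0"
    using regularity_deriv[OF t0 that] s(3) A_pos(2)[OF t0] by simp
  then show ?thesis using nonzero zero unfolding germ N_nu by blast
qed

end

theorem mainTheorem13:
  fixes I :: "real set" and \<gamma> v1 v2 :: "real \<Rightarrow> real^4" and t0 \<theta>0 :: real
  assumes fc: "hyp_framed_curve I \<gamma> v1 v2"
    and ab: "\<forall>t\<in>I. (ha \<gamma> v1 v2 t)^2 + (hb \<gamma> v1 v2 t)^2 \<noteq> 0"
    and AM: "\<forall>t\<in>I. (hA \<gamma> v1 v2 t)^2 > (hM \<gamma> v1 v2 t)^2"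
    and MA: "\<forall>t\<in>I. hM \<gamma> v1 v2 t * deriv (hA \<gamma> v1 v2) t - deriv (hM \<gamma> v1 v2) t * hA \<gamma> v1 v2 t = 0"
    and t0: "t0 \<in> I"
    and sing: "singular_point (focal_h \<gamma> v1 v2) (t0, \<theta>0)"
  shows "(hN \<gamma> v1 v2 t0 \<noteq> 0 \<longrightarrow>
            (surf_germ_is (focal_h \<gamma> v1 v2) (t0, \<theta>0) cuspidal_edge \<longleftrightarrow> hM \<gamma> v1 v2 t0 \<noteq> 0) \<and>
            \<not> surf_germ_is (focal_h \<gamma> v1 v2) (t0, \<theta>0) swallowtail \<and>
            \<not> surf_germ_is (focal_h \<gamma> v1 v2) (t0, \<theta>0) cuspidal_cross_cap)
       \<and> (hN \<gamma> v1 v2 t0 = 0 \<longrightarrow>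
            (surf_germ_is (focal_h \<gamma> v1 v2) (t0, \<theta>0) cuspidal_edge \<longleftrightarrow>
               \<theta>0 \<noteq> 0 \<and>
               deriv (\<lambda>t. hA \<gamma> v1 v2 t * hN \<gamma> v1 v2 t *
                        sqrt ((hA \<gamma> v1 v2 t)^2 - (hM \<gamma> v1 v2 t)^2)) t0 \<noteq> 0) \<and>
            \<not> surf_germ_is (focal_h \<gamma> v1 v2) (t0, \<theta>0) cuspidal_beaks \<and>
            \<not> surf_germ_is (focal_h \<gamma> v1 v2) (t0, \<theta>0) cuspidal_lips \<and>
            \<not> surf_germ_is (focal_h \<gamma> v1 v2) (t0, \<theta>0) swallowtail \<and>
            \<not> surf_germ_is (focal_h \<gamma> v1 v2) (t0, \<theta>0) cuspidal_cross_cap)"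
proof -
  interpret frenet_curve I \<gamma> v1 v2
    by (rule frenet_curve.intro[OF fc ab AM MA])
  obtain c where c: "\<forall>t\<in>I. hM \<gamma> v1 v2 t = c * hA \<gamma> v1 v2 t" "c^2 < 1"
    using ratio_constant[OF t0] by (elim exE conjE)
  interpret constant_ratio_curve I \<gamma> v1 v2 c
    by (standard) (use c in auto)
  show ?thesis by (rule classification[OF t0 sing])
qed

end
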